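(* Let $\mathcal{S},\mathcal{U}$ be disjoint finite sets of finite-valued discrete random variables with $\mathcal{V}=\mathcal{S}\cup\mathcal{U}$, whose joint distribution is given by a graphical model, such that the variables in $\mathcal{S}$ are independent given $\mathcal{U}$. Let $\mathcal{W}\subseteq\mathcal{V}$ be nonempty, let each $X\in\mathcal{W}$ have a positive integer cost $c(X)$, put $c(\mathcal{A})=\sum_{X\in\mathcal{A}}c(X)$ for $\mathcal{A}\subseteq\mathcal{W}$, and let $L>0$ be a budget. Let $F(\mathcal{A})=H(\mathcal{U})-H(\mathcal{U}\setminus\mathcal{A}\mid\mathcal{A})$ for $\mathcal{A}\subseteq\mathcal{W}$, and $OPT=\max\{F(\mathcal{A}):\mathcal{A}\subseteq\mathcal{W},\ c(\mathcal{A})\le L\}$. Then for any $\varepsilon>0$ and $\delta>0$, the partial-enumeration greedy algorithm with constant integer parameter $d$ described in the context, in which every conditional entropy is approximated by sampling (with a number of samples chosen depending on $\varepsilon,\delta,L,|\mathcal{W}|,K,d$), computes, if $d\ge3$, a set $\hat{\mathcal{A}}$ such that $$F(\hat{\mathcal{A}})\ \ge\ (1-1/e)\,OPT-\varepsilon$$ with probability at least $1-\delta$, in time $$\mathcal{O}\left(c_{inf}\;|\mathcal{W}|^{d+2}\left\lceil\left(\frac{L\log K}{\varepsilon}\right)^2\log\frac{|\mathcal{W}|^{d+2}}{\delta}\right\rceil\right),$$ where $c_{inf}$ is the cost of probabilistic inference and $K=\max_{X\in\mathcal{W}}|\mathrm{dom}(X)|$.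
   Context: $H$ denotes Shannon entropy: for a finite set $\mathcal{A}$ of discrete random variables, $H(\mathcal{A})=-\sum_{\mathbf a}P(\mathbf a)\log P(\mathbf a)$ is the entropy of their joint distribution (with $H(\emptyset)=0$), and $H(\mathcal{A}\mid\mathcal{B})=-\sum_{\mathbf a,\mathbf b}P(\mathbf a,\mathbf b)\log P(\mathbf a\mid\mathbf b)$. $\mathrm{dom}(X)$ is the set of values of $X$. "Independent given $\mathcal{U}$" means mutually conditionally independent given the joint value of all variables in $\mathcal{U}$. Sampling estimator for $H(X\mid\mathcal{B})$ (where $\mathcal{B}\subseteq\mathcal{V}$, $X\in\mathcal{V}\setminus\mathcal{B}$) with $N$ samples: draw $N$ independent samples $\mathbf b_1,\dots,\mathbf b_N$ of the joint value of $\mathcal{B}$ from the model; for each $i$ compute by probabilistic inference the conditional distribution $P(X\mid\mathbf b_i)$ and $H(X\mid\mathbf b_i)=-\sum_xP(x\mid\mathbf b_i)\log P(x\mid\mathbf b_i)$; return $\hat H=\frac1N\sum_{i=1}^N H(X\mid\mathbf b_i)$. The quantity $c_{inf}$ covers generating one sample and performing one such inference step. For $\mathcal{G}\subseteq\mathcal{W}$ and $X\in\mathcal{W}\setminus\mathcal{G}$, the marginal increase $\Delta_X(\mathcal{G})=F(\mathcal{G}\cup\{X\})-F(\mathcal{G})$ equals $H(X\mid\mathcal{G})-H(X\mid\mathcal{U})$ if $X\in\mathcal{S}$ and $H(X\mid\mathcal{G})$ otherwise; the algorithm estimates it by replacing each conditional entropy by its sampling estimate, and evaluates $F$ on a set as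 a sum of estimated marginal increases. Partial-enumeration greedy algorithm with parameter $d$: (1) let $\mathcal{A}_1$ maximize $F(\mathcal{A})$ over all $\mathcal{A}\subseteq\mathcal{W}$ with $|\mathcal{A}|<d$ and $c(\mathcal{A})\le L$; let $\mathcal{A}_2:=\emptyset$. (2) For each $\mathcal{G}\subseteq\mathcal{W}$ with $|\mathcal{G}|=d$ and $c(\mathcal{G})\le L$: set $\mathcal{W}':=\mathcal{W}\setminus\mathcal{G}$; while $\mathcal{W}'\ne\emptyset$, pick $X^*\in\mathcal{W}'$ maximizing $\Delta_X(\mathcal{G})/c(X)$, set $\mathcal{G}:=\mathcal{G}\cup\{X^*\}$ if $c(\mathcal{G})+c(X^* )\le L$, and in any case set $\mathcal{W}':=\mathcal{W}'\setminus\{X^*\}$; after the while loop, if $F(\mathcal{G})>F(\mathcal{A}_2)$ set $\mathcal{A}_2:=\mathcal{G}$. (3) Return whichever of $\mathcal{A}_1,\mathcal{A}_2$ has the larger value of $F$.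
   Formalization: The ceiling factor in the time bound is replaced by max(1, ceiling), since for K=1 or δ ≥ |W|^(d+2) the stated bound is zero or negative, which no running time can meet; c_inf is taken to be at least one elementary step. *)

theory Defs
  imports "HOL-Probability.Probability"
begin

section \<open>Finite families of random variables\<close>

text \<open>
  A variable is an index of type \<open>'i\<close>; a joint value of the variables in \<open>V\<close> is a function in
  \<open>Pi\<^sub>E V vals\<close>, and the joint distribution is a \<open>pmf\<close> on such functions. The joint value of the
  variables in a subset is the restriction to that subset.
\<close>

definition marginal :: "('i \<Rightarrow> 'v) pmf \<Rightarrow> 'i set \<Rightarrow> ('i \<Rightarrow> 'v) pmf" where
  "marginal p A = map_pmf (\<lambda>\<omega>. restrict \<omega> A) p"

text \<open>The model conditioned on the event that the variables in \<open>B\<close> have the joint value \<open>b\<close>.\<close>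

definition given :: "('i \<Rightarrow> 'v) pmf \<Rightarrow> 'i set \<Rightarrow> ('i \<Rightarrow> 'v) \<Rightarrow> ('i \<Rightarrow> 'v) pmf" where
  "given p B b = cond_pmf p {\<omega>. restrict \<omega> B = b}"

text \<open>
  A graphical model over \<open>V\<close>: a finite family \<open>Cs\<close> of scopes (cliques, or families of a Bayesian
  network) with nonnegative potentials \<open>\<psi> C\<close> on the joint values of the scope, the distribution being
  their normalised product.
\<close>

definition graphical_model ::
  "'i set \<Rightarrow> ('i \<Rightarrow> 'v set) \<Rightarrow> 'i set set \<Rightarrow> ('i set \<Rightarrow> ('i \<Rightarrow> 'v) \<Rightarrow> real) \<Rightarrow> ('i \<Rightarrow> 'v) pmf \<Rightarrow> bool"
where
  "graphical_model V vals Cs \<psi> p \<longleftrightarrow>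
     finite V \<and> (\<forall>X\<in>V. finite (vals X)) \<and> Cs \<subseteq> Pow V \<and>
     (\<forall>C\<in>Cs. \<forall>a\<in>Pi\<^sub>E C vals. 0 \<le> \<psi> C a) \<and>
     set_pmf p \<subseteq> Pi\<^sub>E V vals \<and>
     (\<forall>\<omega>\<in>Pi\<^sub>E V vals.
        pmf p \<omega> = (\<Prod>C\<in>Cs. \<psi> C (restrict \<omega> C)) /
                   (\<Sum>\<omega>'\<in>Pi\<^sub>E V vals. \<Prod>C\<in>Cs. \<psi> C (restrict \<omega>' C)))"

definition independent_given :: "('i \<Rightarrow> 'v) pmf \<Rightarrow> 'i set \<Rightarrow> 'i set \<Rightarrow> bool" where
  "independent_given p S U \<longleftrightarrow>
     (\<forall>u\<in>set_pmf (marginal p U).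
        prob_space.indep_vars (measure_pmf (given p U u)) (\<lambda>_. count_space UNIV) (\<lambda>X \<omega>. \<omega> X) S)"

section \<open>Entropy\<close>

text \<open>
  Entropies are in nats: a different base rescales \<open>F\<close>, \<open>OPT\<close>, \<open>\<epsilon>\<close> and \<open>log K\<close> by a common factor.
  Sums range over supports, which implements the convention \<open>0 log 0 = 0\<close>.
\<close>

definition pmf_entropy :: "'a pmf \<Rightarrow> real" where
  "pmf_entropy q = - (\<Sum>x\<in>set_pmf q. pmf q x * ln (pmf q x))"

definition joint_entropy :: "('i \<Rightarrow> 'v) pmf \<Rightarrow> 'i set \<Rightarrow> real" where
  "joint_entropy p A = pmf_entropy (marginal p A)"

definition cond_entropy :: "('i \<Rightarrow> 'v) pmf \<Rightarrow> 'i set \<Rightarrow> 'i set \<Rightarrow> real" where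
  "cond_entropy p A B =
     (let q = map_pmf (\<lambda>\<omega>. (restrict \<omega> A, restrict \<omega> B)) p
      in - (\<Sum>(a, b)\<in>set_pmf q. pmf q (a, b) * ln (pmf (marginal (given p B b) A) a)))"

text \<open>\<open>H(X | b)\<close> for a single joint value \<open>b\<close> of the variables in \<open>B\<close>.\<close>

definition entropy_at :: "('i \<Rightarrow> 'v) pmf \<Rightarrow> 'i \<Rightarrow> 'i set \<Rightarrow> ('i \<Rightarrow> 'v) \<Rightarrow> real" where
  "entropy_at p X B b = pmf_entropy (map_pmf (\<lambda>\<omega>. \<omega> X) (given p B b))"

definition info_gain :: "('i \<Rightarrow> 'v) pmf \<Rightarrow> 'i set \<Rightarrow> 'i set \<Rightarrow> real" where
  "info_gain p U A = joint_entropy p U - cond_entropy p (U - A) A"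

section \<open>Randomised computations with a running time\<close>

text \<open>
  A randomised computation yields a distribution on pairs of a result and the time used.
  Time is measured in elementary steps (arithmetic operations, comparisons, list and set updates);
  drawing one sample and performing one inference on it takes \<open>c_inf\<close> steps.
\<close>

type_synonym 'a timed = "('a \<times> real) pmf"

definition ret :: "'a \<Rightarrow> 'a timed" where
  "ret x = return_pmf (x, 0)"

definition tick :: "real \<Rightarrow> unit timed" where
  "tick t = return_pmf ((), t)"

definition bindt :: "'a timed \<Rightarrow> ('a \<Rightarrow> 'b timed) \<Rightarrow> 'b timed" (infixl "\<bind>\<^sub>t" 54) where
  "m \<bind>\<^sub>t f = bind_pmf m (\<lambda>(x, s). map_pmf (\<lambda>(y, t). (y, s + t)) (f x))"

primrec mapt :: "('a \<Rightarrow> 'b timed) \<Rightarrow> 'a list \<Rightarrow> 'b list timed" where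
  "mapt f [] = ret []"
| "mapt f (x # xs) = f x \<bind>\<^sub>t (\<lambda>y. mapt f xs \<bind>\<^sub>t (\<lambda>ys. ret (y # ys)))"

primrec foldt :: "('a \<Rightarrow> 's \<Rightarrow> 's timed) \<Rightarrow> 'a list \<Rightarrow> 's \<Rightarrow> 's timed" where
  "foldt f [] s = ret s"
| "foldt f (x # xs) s = f x s \<bind>\<^sub>t (\<lambda>s'. foldt f xs s')"

section \<open>Sampling estimators\<close>

definition sample_cond_entropy ::
  "real \<Rightarrow> nat \<Rightarrow> ('i \<Rightarrow> 'v) pmf \<Rightarrow> 'i \<Rightarrow> 'i set \<Rightarrow> real timed"
where
  "sample_cond_entropy c_inf N p X B =
     map_pmf
       (\<lambda>bs. ((\<Sum>b\<leftarrow>bs. entropy_at p X B b) / real N, real N * (c_inf + 1) + 1))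
       (replicate_pmf N (marginal p B))"

text \<open>Estimated marginal increase of \<open>info_gain p U\<close> when \<open>X\<close> is added to \<open>G\<close>.\<close>

definition sample_increase ::
  "real \<Rightarrow> nat \<Rightarrow> ('i \<Rightarrow> 'v) pmf \<Rightarrow> 'i set \<Rightarrow> 'i set \<Rightarrow> 'i \<Rightarrow> 'i set \<Rightarrow> real timed"
where
  "sample_increase c_inf N p S U X G =
     tick 1 \<bind>\<^sub>t (\<lambda>_.
       if X \<in> S then
         sample_cond_entropy c_inf N p X G \<bind>\<^sub>t (\<lambda>h.
         sample_cond_entropy c_inf N p X U \<bind>\<^sub>t (\<lambda>h'.
         tick 1 \<bind>\<^sub>t (\<lambda>_. ret (h - h'))))
       else sample_cond_entropy c_inf N p X G)"

section \<open>Partial-enumeration greedy algorithm\<close>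

text \<open>
  The algorithm is parametric in a procedure \<open>\<Delta>\<close> for marginal increases, in the order in which the
  ground set is listed, and in a rule \<open>pick\<close> that returns the position of a maximum in a list
  and so decides how ties are broken.
\<close>

definition maximum_rule :: "(real list \<Rightarrow> nat) \<Rightarrow> bool" where
  "maximum_rule pick \<longleftrightarrow>
     (\<forall>rs. rs \<noteq> [] \<longrightarrow> pick rs < length rs \<and> (\<forall>r\<in>set rs. r \<le> rs ! pick rs))"

text \<open>The sublists of length \<open>k\<close>; for a distinct list they represent its \<open>k\<close>-element subsets.\<close>

fun sublists_of_length :: "nat \<Rightarrow> 'a list \<Rightarrow> 'a list list" where
  "sublists_of_length 0 xs = [[]]"
| "sublists_of_length (Suc k) [] = []"
| "sublists_of_length (Suc k) (x # xs) =
     map ((#) x) (sublists_of_length k xs) @ sublists_of_length (Suc k) xs"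

text \<open>
  All feasible subsets of the given sizes. Each subset generated costs at most \<open>length ws\<close> steps
  for producing it, \<open>length A\<close> for adding up its cost, and one comparison with \<open>L\<close>.
\<close>

definition feasible_sublists ::
  "('i \<Rightarrow> nat) \<Rightarrow> real \<Rightarrow> 'i list \<Rightarrow> nat list \<Rightarrow> 'i list list timed"
where
  "feasible_sublists c L ws ks =
     (let As = concat (map (\<lambda>k. sublists_of_length k ws) ks)
      in tick (\<Sum>A\<leftarrow>As. real (length ws + length A + 1)) \<bind>\<^sub>t (\<lambda>_.
         ret (filter (\<lambda>A. real (sum c (set A)) \<le> L) As)))"

text \<open>The value of \<open>G \<union> set xs\<close> minus that of \<open>G\<close>, as a sum of marginal increases.\<close>

primrec eval_increases :: "('i \<Rightarrow> 'i set \<Rightarrow> real timed) \<Rightarrow> 'i list \<Rightarrow> 'i set \<Rightarrow> real timed" where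
  "eval_increases \<Delta> [] G = ret 0"
| "eval_increases \<Delta> (X # xs) G =
     \<Delta> X G \<bind>\<^sub>t (\<lambda>\<delta>. eval_increases \<Delta> xs (insert X G) \<bind>\<^sub>t (\<lambda>v. tick 2 \<bind>\<^sub>t (\<lambda>_. ret (\<delta> + v))))"

text \<open>
  A maximiser over all feasible sets with fewer than \<open>d\<close> elements, and its value.
\<close>

definition best_small_set ::
  "('i \<Rightarrow> 'i set \<Rightarrow> real timed) \<Rightarrow> ('i \<Rightarrow> nat) \<Rightarrow> real \<Rightarrow> (real list \<Rightarrow> nat) \<Rightarrow> nat \<Rightarrow> 'i list
     \<Rightarrow> ('i set \<times> real) timed"
where
  "best_small_set \<Delta> c L pick d ws =
     feasible_sublists c L ws [0..<d] \<bind>\<^sub>t (\<lambda>As.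
     mapt (\<lambda>A. eval_increases \<Delta> A {}) As \<bind>\<^sub>t (\<lambda>vs.
     tick (real (length vs)) \<bind>\<^sub>t (\<lambda>_.
     ret (set (As ! pick vs), vs ! pick vs))))"

text \<open>
  The greedy completion of a set \<open>G\<close>, where \<open>W'\<close> is the list of remaining elements and \<open>v\<close> the value of \<open>G\<close>.
  Every pass removes exactly one element from \<open>W'\<close>, so the loop makes \<open>length W'\<close> passes; this number
  is the recursion argument. The time of a pass, apart from the estimates, is that of the
  divisions, the search for the maximum, the removal, and the test and update of \<open>G\<close>.
\<close>

primrec greedy_loop ::
  "('i \<Rightarrow> 'i set \<Rightarrow> real timed) \<Rightarrow> ('i \<Rightarrow> nat) \<Rightarrow> real \<Rightarrow> (real list \<Rightarrow> nat) \<Rightarrow> nat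
     \<Rightarrow> 'i list \<Rightarrow> 'i set \<times> real \<Rightarrow> ('i set \<times> real) timed"
where
  "greedy_loop \<Delta> c L pick 0 W' Gv = ret Gv"
| "greedy_loop \<Delta> c L pick (Suc k) W' Gv =
     (let (G, v) = Gv in
      mapt (\<lambda>X. \<Delta> X G) W' \<bind>\<^sub>t (\<lambda>\<delta>s.
      tick (real (3 * length W' + card G + 4)) \<bind>\<^sub>t (\<lambda>_.
        let i = pick (map2 (\<lambda>\<delta> X. \<delta> / real (c X)) \<delta>s W');
            X = W' ! i;
            Gv' = (if real (sum c G + c X) \<le> L then (insert X G, v + \<delta>s ! i) else (G, v))
        in greedy_loop \<Delta> c L pick k (take i W' @ drop (Suc i) W') Gv')))"

definition greedy_from ::
  "('i \<Rightarrow> 'i set \<Rightarrow> real timed) \<Rightarrow> ('i \<Rightarrow> nat) \<Rightarrow> real \<Rightarrow> (real list \<Rightarrow> nat) \<Rightarrow> 'i list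
     \<Rightarrow> 'i list \<Rightarrow> ('i set \<times> real) timed"
where
  "greedy_from \<Delta> c L pick ws G =
     (let W' = filter (\<lambda>X. X \<notin> set G) ws in
      tick (real (length ws * length G + 1)) \<bind>\<^sub>t (\<lambda>_.
      eval_increases \<Delta> G {} \<bind>\<^sub>t (\<lambda>v.
      greedy_loop \<Delta> c L pick (length W') W' (set G, v))))"

definition partial_enumeration_greedy ::
  "('i \<Rightarrow> 'i set \<Rightarrow> real timed) \<Rightarrow> ('i \<Rightarrow> nat) \<Rightarrow> real \<Rightarrow> (real list \<Rightarrow> nat) \<Rightarrow> nat \<Rightarrow> 'i list
     \<Rightarrow> 'i set timed"
where
  "partial_enumeration_greedy \<Delta> c L pick d ws =
     best_small_set \<Delta> c L pick d ws \<bind>\<^sub>t (\<lambda>(A\<^sub>1, v\<^sub>1).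
     feasible_sublists c L ws [d] \<bind>\<^sub>t (\<lambda>Gs.
     foldt
       (\<lambda>G (A\<^sub>2, v\<^sub>2).
          greedy_from \<Delta> c L pick ws G \<bind>\<^sub>t (\<lambda>(G', v).
          tick 2 \<bind>\<^sub>t (\<lambda>_. ret (if v > v\<^sub>2 then (G', v) else (A\<^sub>2, v\<^sub>2)))))
       Gs ({}, 0) \<bind>\<^sub>t (\<lambda>(A\<^sub>2, v\<^sub>2).
     tick 1 \<bind>\<^sub>t (\<lambda>_. ret (if pick [v\<^sub>1, v\<^sub>2] = 0 then A\<^sub>1 else A\<^sub>2)))))"

end

theory Submission
  imports Defs
begin

text \<open>
  By conditional independence \<open>info_gain p U A = H(A) - (\<Sum>X\<in>A \<inter> S. H(X | U))\<close>, which is monotone and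
  submodular. Hoeffding's inequality and a union bound over the \<open>O(n\<^bsup>d+2\<^esup>)\<close> estimates make every
  estimated increment correct up to \<open>\<epsilon> / (4 L)\<close> with probability \<open>1 - \<delta>\<close>. For an optimal set \<open>B\<close> with
  at least \<open>d\<close> elements consider the greedy run started from the first \<open>d\<close> elements of \<open>B\<close> in the
  order of decreasing increments, up to the first moment an element \<open>X\<close> of \<open>B\<close> is rejected. By
  submodularity the gap to \<open>F B\<close> has shrunk by the factor \<open>1 / e\<close> once \<open>X\<close> is added, and
  adding \<open>X\<close> gains at most \<open>1 / d \<le> 1 / 3\<close> of the value of the initial set. Costs are at
  least 1, so at most \<open>L\<close> elements are ever added and the errors add up to at most \<open>\<epsilon>\<close>.
\<close>

section \<open>Reasoning about timed randomised computations\<close>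

text \<open>The sets at which increments are estimated depend on earlier estimates, so there is no
  fixed family of events to which a union bound could be applied. Accuracy is therefore stated for
  one query with arbitrary arguments, and failure probabilities are added along the computation. The
  sample size contains the logarithm of \<open>card W ^ (d + 2) / \<delta>\<close> with no further
  constant inside. If this quotient is at least 2, a multiple of the logarithm that depends on
  \<open>d\<close> alone absorbs the number of queries. With one variable and
  \<open>\<delta>\<close> near 1 the logarithm tends to 0, so that case needs an argument that loses
  no factor. Runs are compared by estimated values, so of the total error
  \<open>4 * L * \<eta>\<close> the greedy analysis may spend only half; the rest pays for passing
  from \<open>F\<close> to an estimate and back. Two situations lie outside the rejection argument:
  a \<open>B\<close> with fewer than \<open>d\<close> elements is met by the enumeration, and if no
  element of \<open>B\<close> is rejected, the run from the prefix ends with a superset of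
  \<open>B\<close>.\<close>

definition surely :: "'a timed \<Rightarrow> real \<Rightarrow> ('a \<Rightarrow> bool) \<Rightarrow> bool" where
  "surely m T Q \<longleftrightarrow> (\<forall>(x, t)\<in>set_pmf m. t \<le> T \<and> Q x)"

definition likely :: "'a timed \<Rightarrow> real \<Rightarrow> ('a \<Rightarrow> bool) \<Rightarrow> bool" where
  "likely m \<beta> P \<longleftrightarrow> measure_pmf.prob m {(x, t). \<not> P x} \<le> \<beta>"

lemma surely_ret: "Q x \<Longrightarrow> 0 \<le> T \<Longrightarrow> surely (ret x) T Q"
  by (simp add: surely_def ret_def)

lemma surely_tick: "s \<le> T \<Longrightarrow> surely (tick s) T (\<lambda>_. True)"
  by (simp add: surely_def tick_def)

lemma surely_weaken: "surely m T Q \<Longrightarrow> T \<le> T' \<Longrightarrow> (\<And>x. Q x \<Longrightarrow> Q' x) \<Longrightarrow> surely m T' Q'"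
  unfolding surely_def by fastforce

lemma surely_bind:
  assumes "surely m T Q" "\<And>x. Q x \<Longrightarrow> surely (f x) T' R"
  shows "surely (m \<bind>\<^sub>t f) (T + T') R"
  using assms unfolding surely_def bindt_def by (fastforce intro!: add_mono)

lemma surely_bind_le:
  assumes "surely m T Q" "\<And>x. Q x \<Longrightarrow> surely (f x) T' R" "T + T' \<le> T''"
  shows "surely (m \<bind>\<^sub>t f) T'' R"
  by (rule surely_weaken[OF surely_bind[OF assms(1,2)] assms(3)])

lemma surely_tick_bind:
  assumes "surely m T' R" "s + T' \<le> T"
  shows "surely (tick s \<bind>\<^sub>t (\<lambda>_. m)) T R"
  by (rule surely_bind_le[OF surely_tick[OF order_refl]]) (use assms in auto)

lemma surely_tick_ret: "s \<le> T \<Longrightarrow> Q x \<Longrightarrow> surely (tick s \<bind>\<^sub>t (\<lambda>_. ret x)) T Q"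
  by (rule surely_tick_bind[OF surely_ret[OF _ order_refl]]) auto

lemma surely_mapt:
  assumes "\<And>x. x \<in> set xs \<Longrightarrow> surely (f x) T (\<lambda>_. True)"
  shows "surely (mapt f xs) (real (length xs) * T) (\<lambda>ys. length ys = length xs)"
  using assms
proof (induction xs)
  case Nil
  show ?case by (simp add: surely_ret)
next
  case (Cons x xs)
  have IH: "surely (mapt f xs) (real (length xs) * T) (\<lambda>ys. length ys = length xs)"
    using Cons by simp
  have "surely (f x \<bind>\<^sub>t (\<lambda>y. mapt f xs \<bind>\<^sub>t (\<lambda>ys. ret (y # ys)))) (T + (real (length xs) * T + 0))
     (\<lambda>ys. length ys = length (x # xs))"
    by (rule surely_bind[OF Cons.prems[of x]], simp, rule surely_bind[OF IH])
      (auto intro!: surely_ret)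
  then show ?case by (simp add: algebra_simps)
qed

lemma surely_foldt:
  assumes "\<And>x s. x \<in> set xs \<Longrightarrow> I s \<Longrightarrow> surely (f x s) T I" "I s"
  shows "surely (foldt f xs s) (real (length xs) * T) I"
  using assms
proof (induction xs arbitrary: s)
  case Nil
  then show ?case by (simp add: surely_ret)
next
  case (Cons x xs)
  have "surely (f x s \<bind>\<^sub>t (\<lambda>s'. foldt f xs s')) (T + real (length xs) * T) I"
    by (rule surely_bind[OF Cons.prems(1)]) (use Cons in auto)
  then show ?case by (simp add: algebra_simps)
qed

section \<open>Failure probabilities of adaptive computations\<close>

lemma likely_nonneg: "likely m \<beta> P \<Longrightarrow> 0 \<le> \<beta>"
  unfolding likely_def using measure_nonneg order_trans by blast

lemma likely_ret: "P x \<Longrightarrow> 0 \<le> \<beta> \<Longrightarrow> likely (ret x) \<beta> P"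
  by (simp add: likely_def ret_def)

lemma likely_tick_bind:
  assumes "likely m \<beta> R"
  shows "likely (tick s \<bind>\<^sub>t (\<lambda>_. m)) \<beta> R"
  using assms
  by (simp add: likely_def tick_def bindt_def bind_return_pmf vimage_def case_prod_unfold)

lemma likely_weaken:
  assumes "likely m \<beta> P" "\<beta> \<le> \<beta>'" "\<And>x. P x \<Longrightarrow> P' x"
  shows "likely m \<beta>' P'"
proof -
  have "measure_pmf.prob m {(x, t). \<not> P' x} \<le> measure_pmf.prob m {(x, t). \<not> P x}"
    by (rule measure_pmf.finite_measure_mono) (use assms(3) in auto)
  then show ?thesis using assms unfolding likely_def by linarith
qed

text \<open>Union bound for adaptive computations: the probability of a final failure is averaged
  over the result of \<open>m\<close>, where it counts as 1 if \<open>P\<close> fails and is at most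
  \<open>\<beta>'\<close> otherwise. As \<open>\<beta>'\<close> is uniform in \<open>x\<close>, the
  computation \<open>f x\<close> may choose its queries from \<open>x\<close>.\<close>

lemma likely_bind:
  assumes "likely m \<beta> P" "\<And>x. P x \<Longrightarrow> likely (f x) \<beta>' R" "0 \<le> \<beta>'"
  shows "likely (m \<bind>\<^sub>t f) (\<beta> + \<beta>') R"
proof -
  let ?bad = "{(x, t). \<not> R x}" and ?B = "{(x, t). \<not> P x}"
  let ?g = "\<lambda>(x, s). map_pmf (\<lambda>(y, t). (y, s + t)) (f x)"
  have pre: "(\<lambda>(y, t). (y, s + t)) -` ?bad = ?bad" for s :: real by auto
  have le: "emeasure (?g z) ?bad \<le> indicator ?B z + ennreal \<beta>'" for z
  proof (cases "z \<in> ?B")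
    case True
    have "emeasure (?g z) ?bad \<le> 1"
      using measure_pmf.emeasure_le_1 by (simp add: case_prod_unfold)
    then show ?thesis using True by (simp add: add_increasing2)
  next
    case False
    then have "likely (f (fst z)) \<beta>' R" using assms(2) by auto
    then show ?thesis using False assms(3)
      by (simp add: case_prod_unfold likely_def measure_pmf.emeasure_eq_measure
            ennreal_leI pre[unfolded case_prod_unfold])
  qed
  have "emeasure (m \<bind>\<^sub>t f) ?bad = (\<integral>\<^sup>+z. emeasure (?g z) ?bad \<partial>m)"
    by (simp add: bindt_def)
  also have "\<dots> \<le> (\<integral>\<^sup>+z. (indicator ?B z + ennreal \<beta>') \<partial>m)"
    by (rule nn_integral_mono) (use le in auto)
  also have "\<dots> = emeasure m ?B + ennreal \<beta>'"
    by (simp add: nn_integral_add)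
  also have "\<dots> \<le> ennreal \<beta> + ennreal \<beta>'"
    using assms(1) by (simp add: likely_def measure_pmf.emeasure_eq_measure ennreal_leI add_right_mono)
  also have "\<dots> = ennreal (\<beta> + \<beta>')"
    using likely_nonneg[OF assms(1)] assms(3) by simp
  finally show ?thesis
    using likely_nonneg[OF assms(1)] assms(3)
    by (simp add: likely_def measure_pmf.emeasure_eq_measure del: ennreal_plus)
qed

lemma likely_bind_le:
  assumes "likely m \<beta> P" "\<And>x. P x \<Longrightarrow> likely (f x) \<beta>' R" "0 \<le> \<beta>'" "\<beta> + \<beta>' \<le> \<beta>''"
  shows "likely (m \<bind>\<^sub>t f) \<beta>'' R"
  by (rule likely_weaken[OF likely_bind[OF assms(1-3)] assms(4)])

lemma likely_mapt:
  assumes "\<And>x. x \<in> set xs \<Longrightarrow> likely (f x) \<beta> (P x)" "0 \<le> \<beta>"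
  shows "likely (mapt f xs) (real (length xs) * \<beta>) (list_all2 P xs)"
  using assms(1)
proof (induction xs)
  case Nil
  show ?case by (simp add: likely_ret)
next
  case (Cons x xs)
  have IH: "likely (mapt f xs) (real (length xs) * \<beta>) (list_all2 P xs)"
    using Cons by simp
  have "likely (f x \<bind>\<^sub>t (\<lambda>y. mapt f xs \<bind>\<^sub>t (\<lambda>ys. ret (y # ys)))) (\<beta> + (real (length xs) * \<beta> + 0))
     (list_all2 P (x # xs))"
    using assms(2)
    by (intro likely_bind[OF Cons.prems[of x]] likely_bind[OF IH])
      (auto intro!: likely_ret)
  then show ?case by (simp add: algebra_simps)
qed

text \<open>The loop over starting sets succeeds because of one of them, \<open>x\<^sub>0\<close>:
  before it only the invariant \<open>I\<close> is kept, the pass for \<open>x\<^sub>0\<close>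
  establishes \<open>R\<close>, and later passes preserve \<open>R\<close>. In the application
  \<open>R\<close> is a lower bound on the best estimated value so far, which never
  decreases.\<close>

lemma likely_foldt:
  assumes step: "\<And>x s. x \<in> set xs \<Longrightarrow> I s \<Longrightarrow> likely (f x s) \<beta> I"
    and hit: "\<And>s. x\<^sub>0 \<in> set xs \<Longrightarrow> I s \<Longrightarrow> likely (f x\<^sub>0 s) \<beta> (\<lambda>s'. I s' \<and> R s')"
    and keep: "\<And>x s. x \<in> set xs \<Longrightarrow> I s \<Longrightarrow> R s \<Longrightarrow> likely (f x s) \<beta> (\<lambda>s'. I s' \<and> R s')"
    and "I s" "0 \<le> \<beta>"
  shows "likely (foldt f xs s) (real (length xs) * \<beta>) (\<lambda>s. I s \<and> (x\<^sub>0 \<in> set xs \<longrightarrow> R s))"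
proof -
  have R: "likely (foldt f ys s) (real (length ys) * \<beta>) (\<lambda>s. I s \<and> R s)"
    if "set ys \<subseteq> set xs" "I s" "R s" for ys s
    using that
  proof (induction ys arbitrary: s)
    case Nil
    then show ?case by (simp add: likely_ret)
  next
    case (Cons y ys)
    have "likely (f y s \<bind>\<^sub>t (\<lambda>s'. foldt f ys s')) (\<beta> + real (length ys) * \<beta>) (\<lambda>s. I s \<and> R s)"
      by (rule likely_bind[OF keep]) (use Cons \<open>0 \<le> \<beta>\<close> in auto)
    then show ?case by (simp add: algebra_simps)
  qed
  have "likely (foldt f ys s) (real (length ys) * \<beta>) (\<lambda>s. I s \<and> (x\<^sub>0 \<in> set ys \<longrightarrow> R s))"
    if "set ys \<subseteq> set xs" "I s" for ys s
    using that
  proof (induction ys arbitrary: s)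
    case Nil
    then show ?case by (simp add: likely_ret)
  next
    case (Cons y ys)
    have "likely (f y s \<bind>\<^sub>t (\<lambda>s'. foldt f ys s')) (\<beta> + real (length ys) * \<beta>)
        (\<lambda>s. I s \<and> (x\<^sub>0 \<in> set (y # ys) \<longrightarrow> R s))"
    proof (cases "y = x\<^sub>0")
      case True
      then show ?thesis
        using Cons.prems \<open>0 \<le> \<beta>\<close> R hit
        by (intro likely_bind[where P = "\<lambda>s'. I s' \<and> R s'"])
          (auto intro: likely_weaken)
    next
      case False
      then show ?thesis
        by (intro likely_bind[OF step]) (use Cons False \<open>0 \<le> \<beta>\<close> in auto)
    qed
    then show ?case by (simp add: algebra_simps)
  qed
  then show ?thesis using \<open>I s\<close> by blast
qed

section \<open>Enumeration of feasible sets\<close>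

lemma sublists_of_lengthD:
  assumes "A \<in> set (sublists_of_length k xs)"
  shows "length A = k" "set A \<subseteq> set xs" "distinct xs \<Longrightarrow> distinct A"
proof -
  have "length A = k \<and> set A \<subseteq> set xs \<and> (distinct xs \<longrightarrow> distinct A)"
    using assms
  proof (induction k xs arbitrary: A rule: sublists_of_length.induct)
    case (3 k x xs)
    consider B where "A = x # B" "B \<in> set (sublists_of_length k xs)"
      | "A \<in> set (sublists_of_length (Suc k) xs)"
      using 3(3) by auto
    then show ?case
    proof cases
      case 1
      then show ?thesis using 3(1)[of B] by auto
    next
      case 2
      then show ?thesis using 3(2)[of A] by auto
    qed
  qed auto
  then show "length A = k" "set A \<subseteq> set xs" "distinct xs \<Longrightarrow> distinct A" by auto
qed

lemma sublists_of_length_complete: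
  assumes "distinct xs" "B \<subseteq> set xs" "card B = k"
  shows "\<exists>A\<in>set (sublists_of_length k xs). set A = B"
  using assms
proof (induction k xs arbitrary: B rule: sublists_of_length.induct)
  case (1 xs)
  then have "B = {}" using finite_subset[of B "set xs"] by auto
  then show ?case by simp
next
  case (2 k)
  then show ?case by simp
next
  case (3 k x xs)
  have fin: "finite B" using 3(4) finite_subset by blast
  show ?case
  proof (cases "x \<in> B")
    case True
    have "\<exists>A\<in>set (sublists_of_length k xs). set A = B - {x}"
      by (rule 3) (use 3 True fin in auto)
    then obtain A where "A \<in> set (sublists_of_length k xs)" "set A = B - {x}" by auto
    then show ?thesis using True by (intro bexI[of _ "x # A"]) auto
  next
    case False
    then have "\<exists>A\<in>set (sublists_of_length (Suc k) xs). set A = B"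
      by (intro 3) (use 3 False in auto)
    then show ?thesis by auto
  qed
qed

text \<open>Pascal's recurrence, together with \<open>n ^ k + n ^ Suc k = Suc n * n ^ k\<close> for
  \<open>n = length xs\<close>.\<close>

lemma length_sublists_of_length: "length (sublists_of_length k xs) \<le> length xs ^ k"
proof (induction k xs rule: sublists_of_length.induct)
  case (3 k x xs)
  have "length (sublists_of_length (Suc k) (x # xs)) \<le> length xs ^ k + length xs ^ Suc k"
    using 3 by simp
  also have "\<dots> = Suc (length xs) * length xs ^ k" by simp
  also have "\<dots> \<le> Suc (length xs) * Suc (length xs) ^ k"
    by (intro mult_left_mono power_mono) auto
  finally show ?case by simp
qed auto

lemma length_concat_sublists_of_length:
  assumes "\<And>k. k \<in> set ks \<Longrightarrow> k \<le> d" "xs \<noteq> []"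
  shows "length (concat (map (\<lambda>k. sublists_of_length k xs) ks)) \<le> length ks * length xs ^ d"
  using assms(1)
proof (induction ks)
  case (Cons k ks)
  have "length (sublists_of_length k xs) \<le> length xs ^ k"
    by (rule length_sublists_of_length)
  also have "\<dots> \<le> length xs ^ d"
    using Cons.prems assms(2) by (intro power_increasing) (auto simp: Suc_le_eq)
  finally show ?case using Cons by simp
qed simp

text \<open>The outcome of \<open>feasible_sublists\<close> without its clock. Enumeration is
  deterministic, so both the failure analysis and the time analysis can name this list.\<close>

definition feasible_lists :: "('i \<Rightarrow> nat) \<Rightarrow> real \<Rightarrow> 'i list \<Rightarrow> nat list \<Rightarrow> 'i list list" where
  "feasible_lists c L ws ks =
     filter (\<lambda>A. real (sum c (set A)) \<le> L) (concat (map (\<lambda>k. sublists_of_length k ws) ks))"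

lemma feasible_listsD:
  assumes "A \<in> set (feasible_lists c L ws ks)"
  shows "length A \<in> set ks" "set A \<subseteq> set ws" "distinct ws \<Longrightarrow> distinct A" "real (sum c (set A)) \<le> L"
  using assms by (auto simp: feasible_lists_def dest: sublists_of_lengthD)

lemma feasible_lists_complete:
  assumes "distinct ws" "B \<subseteq> set ws" "card B \<in> set ks" "real (sum c B) \<le> L"
  shows "\<exists>A\<in>set (feasible_lists c L ws ks). set A = B"
  using sublists_of_length_complete[OF assms(1,2) refl] assms by (auto simp: feasible_lists_def)

lemma length_feasible_lists:
  assumes "\<And>k. k \<in> set ks \<Longrightarrow> k \<le> d" "ws \<noteq> []"
  shows "length (feasible_lists c L ws ks) \<le> length ks * length ws ^ d"
  using length_concat_sublists_of_length[OF assms] le_trans[OF length_filter_le]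
  unfolding feasible_lists_def by blast

lemma likely_feasible_sublists:
  assumes "likely (f (feasible_lists c L ws ks)) \<beta> P"
  shows "likely (feasible_sublists c L ws ks \<bind>\<^sub>t f) \<beta> P"
proof -
  have "feasible_sublists c L ws ks \<bind>\<^sub>t f =
      tick (\<Sum>A\<leftarrow>concat (map (\<lambda>k. sublists_of_length k ws) ks). real (length ws + length A + 1))
        \<bind>\<^sub>t (\<lambda>_. f (feasible_lists c L ws ks))"
    by (simp add: feasible_sublists_def Let_def feasible_lists_def tick_def ret_def bindt_def
        bind_return_pmf case_prod_unfold map_pmf_comp)
  then show ?thesis using likely_tick_bind[OF assms] by simp
qed

lemma surely_feasible_sublists:
  assumes "\<And>k. k \<in> set ks \<Longrightarrow> k \<le> d" "ws \<noteq> []"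
  shows "surely (feasible_sublists c L ws ks)
     (real (length ks * length ws ^ d * (length ws + d + 1)))
     (\<lambda>As. As = feasible_lists c L ws ks)"
proof -
  let ?As = "concat (map (\<lambda>k. sublists_of_length k ws) ks)"
  have "(\<Sum>A\<leftarrow>?As. real (length ws + length A + 1)) \<le> (\<Sum>A\<leftarrow>?As. real (length ws + d + 1))"
    by (rule sum_list_mono) (auto dest!: sublists_of_lengthD(1) intro: assms(1))
  also have "\<dots> = real (length ?As * (length ws + d + 1))"
    by (simp add: sum_list_triv algebra_simps)
  also have "\<dots> \<le> real (length ks * length ws ^ d * (length ws + d + 1))"
    unfolding of_nat_le_iff by (rule mult_right_mono[OF length_concat_sublists_of_length[OF assms]]) auto
  finally have le: "(\<Sum>A\<leftarrow>?As. real (length ws + length A + 1))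
      \<le> real (length ks * length ws ^ d * (length ws + d + 1))" .
  show ?thesis
    unfolding feasible_sublists_def Let_def
    by (rule surely_tick_bind[OF surely_ret[OF _ order_refl]])
      (use le in \<open>simp_all add: feasible_lists_def\<close>)
qed


section \<open>Entropies of finitely supported distributions\<close>

text \<open>Probability of the fibre of \<open>f\<close> through \<open>\<omega>\<close>. Entropies
  of all marginals become sums over the support of \<open>p\<close> itself, with logarithms of such
  numbers, and can be compared term by term.\<close>

definition level_prob :: "'a pmf \<Rightarrow> ('a \<Rightarrow> 'b) \<Rightarrow> 'a \<Rightarrow> real" where
  "level_prob p f \<omega> = measure_pmf.prob p {\<omega>'. f \<omega>' = f \<omega>}"

lemma pmf_map_level_prob: "pmf (map_pmf f p) (f \<omega>) = level_prob p f \<omega>"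
  by (simp add: pmf_map level_prob_def vimage_def)

lemma level_prob_pos: "\<omega> \<in> set_pmf p \<Longrightarrow> 0 < level_prob p f \<omega>"
  unfolding level_prob_def by (rule measure_pmf_posI) auto

lemma ln_level_prob_mult:
  assumes "\<omega> \<in> set_pmf p"
  shows "ln (level_prob p f \<omega> * level_prob p g \<omega>) = ln (level_prob p f \<omega>) + ln (level_prob p g \<omega>)"
    and "ln (level_prob p f \<omega> / level_prob p g \<omega>) = ln (level_prob p f \<omega>) - ln (level_prob p g \<omega>)"
  using level_prob_pos[OF assms, of f] level_prob_pos[OF assms, of g] by (simp_all add: ln_mult ln_div)

lemma level_prob_cong:
  assumes "\<And>\<omega>'. \<omega>' \<in> set_pmf p \<Longrightarrow> f \<omega>' = f \<omega> \<longleftrightarrow> g \<omega>' = g \<omega>"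
  shows "level_prob p f \<omega> = level_prob p g \<omega>"
  unfolding level_prob_def
  by (rule measure_pmf.finite_measure_eq_AE) (use assms in \<open>auto simp: AE_measure_pmf_iff\<close>)

lemma sum_map_pmf:
  fixes g :: "'b \<Rightarrow> real"
  assumes "finite (set_pmf p)"
  shows "(\<Sum>y\<in>set_pmf (map_pmf f p). pmf (map_pmf f p) y * g y) = (\<Sum>\<omega>\<in>set_pmf p. pmf p \<omega> * g (f \<omega>))"
proof -
  have "(\<Sum>y\<in>set_pmf (map_pmf f p). pmf (map_pmf f p) y * g y) = measure_pmf.expectation (map_pmf f p) g"
    by (subst integral_measure_pmf_real[of "set_pmf (map_pmf f p)"])
      (use assms in \<open>auto simp: mult.commute\<close>)
  also have "\<dots> = measure_pmf.expectation p (\<lambda>\<omega>. g (f \<omega>))" by simp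
  also have "\<dots> = (\<Sum>\<omega>\<in>set_pmf p. pmf p \<omega> * g (f \<omega>))"
    by (subst integral_measure_pmf_real[of "set_pmf p"]) (use assms in \<open>auto simp: mult.commute\<close>)
  finally show ?thesis .
qed

lemma pmf_entropy_map:
  assumes "finite (set_pmf p)"
  shows "pmf_entropy (map_pmf f p) = - (\<Sum>\<omega>\<in>set_pmf p. pmf p \<omega> * ln (level_prob p f \<omega>))"
  unfolding pmf_entropy_def sum_map_pmf[OF assms, of f "\<lambda>y. ln (pmf (map_pmf f p) y)"]
  by (simp add: pmf_map_level_prob)

text \<open>Entropy depends only on the partition that \<open>f\<close> induces on the support; this
  lets pairs of restrictions be traded for the restriction to a union.\<close>

lemma pmf_entropy_map_cong:
  assumes "finite (set_pmf p)"
    and "\<And>\<omega> \<omega>'. \<omega> \<in> set_pmf p \<Longrightarrow> \<omega>' \<in> set_pmf p \<Longrightarrow> f \<omega>' = f \<omega> \<longleftrightarrow> g \<omega>' = g \<omega>"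
  shows "pmf_entropy (map_pmf f p) = pmf_entropy (map_pmf g p)"
proof -
  have "level_prob p f \<omega> = level_prob p g \<omega>" if "\<omega> \<in> set_pmf p" for \<omega>
    by (rule level_prob_cong) (use assms(2) that in auto)
  then show ?thesis by (simp add: pmf_entropy_map[OF assms(1)])
qed

lemma pmf_entropy_nonneg: "0 \<le> pmf_entropy q"
proof -
  have "pmf q x * ln (pmf q x) \<le> 0" if "x \<in> set_pmf q" for x
    using that by (intro mult_nonneg_nonpos) (auto simp: pmf_le_1 ln_le_zero_iff pmf_positive)
  then show ?thesis by (simp add: pmf_entropy_def sum_nonpos)
qed

text \<open>Gibbs' inequality against the uniform law on \<open>T\<close>:
  \<open>ln t \<le> t - 1\<close> at \<open>t = 1 / (pmf q x * card T)\<close>.\<close>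

lemma pmf_entropy_le_ln_card:
  assumes "finite T" "set_pmf q \<subseteq> T"
  shows "pmf_entropy q \<le> ln (card T)"
proof -
  have fin: "finite (set_pmf q)" using assms finite_subset by blast
  have T: "0 < real (card T)"
    using assms set_pmf_not_empty[of q] by (simp add: card_gt_0_iff) blast
  have one: "(\<Sum>x\<in>set_pmf q. pmf q x) = 1" using fin by (intro sum_pmf_eq_1) auto
  have "pmf_entropy q - ln (card T) = (\<Sum>x\<in>set_pmf q. - (pmf q x * ln (pmf q x)) - pmf q x * ln (card T))"
    using one by (simp add: pmf_entropy_def sum_subtractf sum_negf sum_distrib_right[symmetric])
  also have "\<dots> \<le> (\<Sum>x\<in>set_pmf q. 1 / card T - pmf q x)"
  proof (rule sum_mono)
    fix x assume "x \<in> set_pmf q"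
    then have x: "0 < pmf q x" by (rule pmf_positive)
    have "ln (1 / (pmf q x * card T)) \<le> 1 / (pmf q x * card T) - 1"
      using x T by (intro ln_le_minus_one) simp
    then have "pmf q x * ln (1 / (pmf q x * card T)) \<le> pmf q x * (1 / (pmf q x * card T) - 1)"
      using x by (intro mult_left_mono) auto
    also have "pmf q x * (1 / (pmf q x * card T) - 1) = 1 / card T - pmf q x"
      using x T by (simp add: field_simps)
    also have "ln (1 / (pmf q x * card T)) = - ln (pmf q x) - ln (card T)"
      using x T by (simp add: ln_div ln_mult)
    finally show "- (pmf q x * ln (pmf q x)) - pmf q x * ln (card T) \<le> 1 / card T - pmf q x"
      by (simp add: right_diff_distrib)
  qed
  also have "\<dots> = real (card (set_pmf q)) / card T - 1"
    using one by (simp add: sum_subtractf)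
  also have "\<dots> \<le> 0"
    using T card_mono[OF assms] by simp
  finally show ?thesis by simp
qed

text \<open>Gibbs' inequality for the law of \<open>(f, g, h)\<close> against the one making \<open>f\<close>, \<open>g\<close> independent given \<open>h\<close>.\<close>

lemma pmf_entropy_submodular:
  assumes fin: "finite (set_pmf p)"
  shows "pmf_entropy (map_pmf (\<lambda>\<omega>. (f \<omega>, g \<omega>, h \<omega>)) p) + pmf_entropy (map_pmf h p)
    \<le> pmf_entropy (map_pmf (\<lambda>\<omega>. (f \<omega>, h \<omega>)) p) + pmf_entropy (map_pmf (\<lambda>\<omega>. (g \<omega>, h \<omega>)) p)"
proof -
  define q where "q = map_pmf (\<lambda>\<omega>. (f \<omega>, g \<omega>, h \<omega>)) p"
  define u where "u = map_pmf (\<lambda>\<omega>. (f \<omega>, h \<omega>)) p"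
  define v where "v = map_pmf (\<lambda>\<omega>. (g \<omega>, h \<omega>)) p"
  define w where "w = map_pmf h p"
  have fins: "finite (set_pmf q)" "finite (set_pmf u)" "finite (set_pmf v)"
    using fin by (simp_all add: q_def u_def v_def)
  have v_marginal: "(\<Sum>b\<in>{b. (b, c) \<in> set_pmf v}. pmf v (b, c)) = pmf w c" for c
  proof -
    have "(\<Sum>b\<in>{b. (b, c) \<in> set_pmf v}. pmf v (b, c)) = (\<Sum>y\<in>{y\<in>set_pmf v. snd y = c}. pmf v y)"
      by (rule sum.reindex_bij_witness[of _ fst "\<lambda>b. (b, c)"]) auto
    also have "\<dots> = measure_pmf.prob v {y\<in>set_pmf v. snd y = c}"
      using fins by (simp add: measure_measure_pmf_finite)
    also have "\<dots> = measure_pmf.prob v (snd -` {c})"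
      by (rule measure_pmf.finite_measure_eq_AE) (auto simp: AE_measure_pmf_iff)
    also have "\<dots> = pmf (map_pmf snd v) c" by (simp add: pmf_map)
    also have "map_pmf snd v = w" by (simp add: v_def w_def map_pmf_comp)
    finally show ?thesis .
  qed
  \<comment> \<open>Weights of the law that has the same pair marginals but makes \<open>f\<close>
    and \<open>g\<close> independent given \<open>h\<close>. It suffices that their mass on the
    support of \<open>q\<close> is at most 1.\<close>
  let ?r = "\<lambda>(a, b, c). pmf u (a, c) * pmf v (b, c) / pmf w c"
  let ?S = "SIGMA y:set_pmf u. {b. (b, snd y) \<in> set_pmf v}"
  have finS: "finite {b. (b, c) \<in> set_pmf v}" for c
    by (rule finite_subset[of _ "fst ` set_pmf v"]) (use fins in \<open>auto intro: rev_image_eqI\<close>)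
  \<comment> \<open>Listing triples as \<open>((a, c), b)\<close> and admitting every
    \<open>b\<close> that occurs with \<open>c\<close> lets the sum over \<open>b\<close> collapse
    to \<open>pmf w c\<close>, which cancels.\<close>
  have "(\<Sum>y\<in>set_pmf q. ?r y) = (\<Sum>z\<in>(\<lambda>(a, b, c). ((a, c), b)) ` set_pmf q. ?r (fst (fst z), snd z, snd (fst z)))"
    by (subst sum.reindex) (auto simp: inj_on_def case_prod_unfold)
  also have "\<dots> \<le> (\<Sum>z\<in>?S. ?r (fst (fst z), snd z, snd (fst z)))"
  proof (rule sum_mono2)
    show "finite ?S" using fins finS by (intro finite_SigmaI)
    show "(\<lambda>(a, b, c). ((a, c), b)) ` set_pmf q \<subseteq> ?S" by (auto simp: q_def u_def v_def)
  qed simp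
  also have "\<dots> = (\<Sum>y\<in>set_pmf u. \<Sum>b\<in>{b. (b, snd y) \<in> set_pmf v}. pmf u y * pmf v (b, snd y) / pmf w (snd y))"
    using fins finS by (subst sum.Sigma) (auto simp: case_prod_unfold)
  also have "\<dots> = (\<Sum>y\<in>set_pmf u. pmf u y)"
  proof (rule sum.cong[OF refl])
    fix y assume "y \<in> set_pmf u"
    then have "pmf w (snd y) \<noteq> 0" by (auto simp: u_def w_def pmf_eq_0_set_pmf)
    then show "(\<Sum>b\<in>{b. (b, snd y) \<in> set_pmf v}. pmf u y * pmf v (b, snd y) / pmf w (snd y)) = pmf u y"
      using v_marginal[of "snd y"]
      by (simp add: sum_distrib_left[symmetric] sum_divide_distrib[symmetric])
  qed
  also have "\<dots> = 1" using fins by (intro sum_pmf_eq_1) auto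
  finally have r_le: "(\<Sum>y\<in>set_pmf q. ?r y) \<le> 1" .
  \<comment> \<open>Average of \<open>ln t \<le> t - 1\<close> over \<open>p\<close>, where
    \<open>t\<close> is the weight \<open>?r\<close> divided by the true probability. The left side
    is 1 minus the mass of \<open>?r\<close>, hence nonnegative.\<close>
  have "(\<Sum>\<omega>\<in>set_pmf p. pmf p \<omega> * (1 - (pmf u (f \<omega>, h \<omega>) * pmf v (g \<omega>, h \<omega>)) / (pmf q (f \<omega>, g \<omega>, h \<omega>) * pmf w (h \<omega>))))
    \<le> (\<Sum>\<omega>\<in>set_pmf p. pmf p \<omega> * (ln (pmf q (f \<omega>, g \<omega>, h \<omega>)) + ln (pmf w (h \<omega>))
      - ln (pmf u (f \<omega>, h \<omega>)) - ln (pmf v (g \<omega>, h \<omega>))))"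
  proof (intro sum_mono mult_left_mono)
    fix \<omega> assume \<omega>: "\<omega> \<in> set_pmf p"
    let ?U = "pmf u (f \<omega>, h \<omega>)" and ?V = "pmf v (g \<omega>, h \<omega>)" and ?Q = "pmf q (f \<omega>, g \<omega>, h \<omega>)" and ?W = "pmf w (h \<omega>)"
    have pos: "0 < ?U" "0 < ?V" "0 < ?Q" "0 < ?W"
      using \<omega> by (auto simp: u_def v_def q_def w_def intro!: pmf_positive)
    then have "ln ((?U * ?V) / (?Q * ?W)) \<le> (?U * ?V) / (?Q * ?W) - 1"
      by (intro ln_le_minus_one) simp
    then show "1 - (?U * ?V) / (?Q * ?W) \<le> ln ?Q + ln ?W - ln ?U - ln ?V"
      using pos by (simp add: ln_div ln_mult)
  qed simp
  moreover have "(\<Sum>\<omega>\<in>set_pmf p. pmf p \<omega> * (1 - (pmf u (f \<omega>, h \<omega>) * pmf v (g \<omega>, h \<omega>)) / (pmf q (f \<omega>, g \<omega>, h \<omega>) * pmf w (h \<omega>))))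
    = 1 - (\<Sum>y\<in>set_pmf q. ?r y)"
  proof -
    have "(\<Sum>y\<in>set_pmf q. ?r y) = (\<Sum>y\<in>set_pmf q. pmf q y * (?r y / pmf q y))"
      by (intro sum.cong refl) (auto simp: pmf_eq_0_set_pmf)
    also have "\<dots> = (\<Sum>\<omega>\<in>set_pmf p. pmf p \<omega> * ((pmf u (f \<omega>, h \<omega>) * pmf v (g \<omega>, h \<omega>)) / (pmf q (f \<omega>, g \<omega>, h \<omega>) * pmf w (h \<omega>))))"
      unfolding q_def sum_map_pmf[OF fin] by (simp add: mult.commute)
    finally show ?thesis
      using sum_pmf_eq_1[OF fin order_refl] by (simp add: right_diff_distrib sum_subtractf)
  qed
  moreover have "pmf_entropy q = - (\<Sum>\<omega>\<in>set_pmf p. pmf p \<omega> * ln (pmf q (f \<omega>, g \<omega>, h \<omega>)))"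
    "pmf_entropy u = - (\<Sum>\<omega>\<in>set_pmf p. pmf p \<omega> * ln (pmf u (f \<omega>, h \<omega>)))"
    "pmf_entropy v = - (\<Sum>\<omega>\<in>set_pmf p. pmf p \<omega> * ln (pmf v (g \<omega>, h \<omega>)))"
    "pmf_entropy w = - (\<Sum>\<omega>\<in>set_pmf p. pmf p \<omega> * ln (pmf w (h \<omega>)))"
    unfolding pmf_entropy_def q_def u_def v_def w_def
    by (subst sum_map_pmf[OF fin], rule refl)+
  ultimately show ?thesis
    using r_le unfolding q_def[symmetric] u_def[symmetric] v_def[symmetric] w_def[symmetric]
    by (simp add: algebra_simps sum.distrib sum_subtractf)
qed

lemma restrict_eq_iff: "restrict x A = restrict y A \<longleftrightarrow> (\<forall>i\<in>A. x i = y i)"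
  by (auto simp: restrict_def fun_eq_iff)

text \<open>Here \<open>f\<close> is the value at \<open>X\<close>, \<open>g\<close> the restriction
  to \<open>B\<close> and \<open>h\<close> the restriction to \<open>A\<close>; as
  \<open>A \<subseteq> B\<close>, the pair of \<open>g\<close> and \<open>h\<close> induces the same
  partition as \<open>g\<close>.\<close>

lemma joint_entropy_submodular:
  assumes fin: "finite (set_pmf p)" and "A \<subseteq> B"
  shows "joint_entropy p (insert X B) + joint_entropy p A \<le> joint_entropy p (insert X A) + joint_entropy p B"
proof -
  have "pmf_entropy (map_pmf (\<lambda>\<omega>. (\<omega> X, restrict \<omega> B, restrict \<omega> A)) p) = joint_entropy p (insert X B)"
    "pmf_entropy (map_pmf (\<lambda>\<omega>. (\<omega> X, restrict \<omega> A)) p) = joint_entropy p (insert X A)"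
    "pmf_entropy (map_pmf (\<lambda>\<omega>. (restrict \<omega> B, restrict \<omega> A)) p) = joint_entropy p B"
    unfolding joint_entropy_def marginal_def
    by (rule pmf_entropy_map_cong[OF fin]; use \<open>A \<subseteq> B\<close> in \<open>auto simp: restrict_eq_iff\<close>)+
  then show ?thesis
    using pmf_entropy_submodular[OF fin, of "\<lambda>\<omega>. \<omega> X" "\<lambda>\<omega>. restrict \<omega> B" "\<lambda>\<omega>. restrict \<omega> A"]
    by (simp add: joint_entropy_def marginal_def)
qed

lemma joint_entropy_empty: "joint_entropy p {} = 0"
proof -
  have "marginal p {} = return_pmf (\<lambda>_. undefined)"
    by (simp add: marginal_def restrict_def)
  then show ?thesis by (simp add: joint_entropy_def pmf_entropy_def)
qed

section \<open>Conditioning, the chain rule and the mean of \<open>H(X | b)\<close>\<close>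

lemma prob_cond_pmf:
  assumes "set_pmf p \<inter> E \<noteq> {}"
  shows "measure_pmf.prob (cond_pmf p E) T = measure_pmf.prob p (E \<inter> T) / measure_pmf.prob p E"
  unfolding cond_pmf.rep_eq[OF assms]
  by (rule measure_uniform_measure)
    (auto simp: emeasure_measure_pmf_not_zero[OF assms])

lemma pmf_map_given:
  assumes "\<omega> \<in> set_pmf p"
  shows "pmf (map_pmf f (given p B (restrict \<omega> B))) (f \<omega>)
    = level_prob p (\<lambda>\<omega>. (f \<omega>, restrict \<omega> B)) \<omega> / level_prob p (\<lambda>\<omega>. restrict \<omega> B) \<omega>"
proof -
  have "set_pmf p \<inter> {\<omega>'. restrict \<omega>' B = restrict \<omega> B} \<noteq> {}" using assms by auto
  moreover have "{\<omega>'. restrict \<omega>' B = restrict \<omega> B} \<inter> f -` {f \<omega>}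
      = {\<omega>'. (f \<omega>', restrict \<omega>' B) = (f \<omega>, restrict \<omega> B)}" by auto
  ultimately show ?thesis
    by (simp add: pmf_map given_def prob_cond_pmf level_prob_def)
qed

text \<open>Chain rule: by \<open>pmf_map_given\<close> the logarithm of the conditional probability
  is pointwise a difference of two fibre logarithms.\<close>

lemma cond_entropy_eq:
  assumes fin: "finite (set_pmf p)"
  shows "cond_entropy p A B = joint_entropy p (A \<union> B) - joint_entropy p B"
proof -
  have "cond_entropy p A B = - (\<Sum>y\<in>set_pmf (map_pmf (\<lambda>\<omega>. (restrict \<omega> A, restrict \<omega> B)) p).
      pmf (map_pmf (\<lambda>\<omega>. (restrict \<omega> A, restrict \<omega> B)) p) y * ln (pmf (marginal (given p B (snd y)) A) (fst y)))"
    by (simp add: cond_entropy_def Let_def case_prod_unfold)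
  also have "\<dots> = - (\<Sum>\<omega>\<in>set_pmf p. pmf p \<omega> *
      ln (pmf (map_pmf (\<lambda>\<omega>. restrict \<omega> A) (given p B (restrict \<omega> B))) (restrict \<omega> A)))"
    by (subst sum_map_pmf[OF fin]) (simp add: marginal_def)
  also have "\<dots> = - (\<Sum>\<omega>\<in>set_pmf p. pmf p \<omega> * (ln (level_prob p (\<lambda>\<omega>. restrict \<omega> (A \<union> B)) \<omega>)
       - ln (level_prob p (\<lambda>\<omega>. restrict \<omega> B) \<omega>)))"
  proof (intro arg_cong[where f = uminus] sum.cong refl arg_cong2[where f = "(*)"])
    fix \<omega> assume \<omega>: "\<omega> \<in> set_pmf p"
    have "level_prob p (\<lambda>\<omega>. (restrict \<omega> A, restrict \<omega> B)) \<omega> = level_prob p (\<lambda>\<omega>. restrict \<omega> (A \<union> B)) \<omega>"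
      by (rule level_prob_cong) (auto simp: restrict_eq_iff)
    then show "ln (pmf (map_pmf (\<lambda>\<omega>. restrict \<omega> A) (given p B (restrict \<omega> B))) (restrict \<omega> A))
       = ln (level_prob p (\<lambda>\<omega>. restrict \<omega> (A \<union> B)) \<omega>) - ln (level_prob p (\<lambda>\<omega>. restrict \<omega> B) \<omega>)"
      by (simp add: pmf_map_given[OF \<omega>, of "\<lambda>\<omega>. restrict \<omega> A"] ln_level_prob_mult[OF \<omega>])
  qed
  also have "\<dots> = joint_entropy p (A \<union> B) - joint_entropy p B"
    by (simp add: joint_entropy_def marginal_def pmf_entropy_map[OF fin] right_diff_distrib sum_subtractf)
  finally show ?thesis .
qed

text \<open>Multiplying by the probability of \<open>b\<close> cancels the normalisation of
  \<open>given p B b\<close> and leaves a sum over one fibre, so that summing over \<open>b\<close>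
  only reassembles the support.\<close>

lemma entropy_at_eq:
  assumes fin: "finite (set_pmf p)" and b: "b \<in> set_pmf (marginal p B)"
  shows "pmf (marginal p B) b * entropy_at p X B b = - (\<Sum>\<omega>\<in>{\<omega>\<in>set_pmf p. restrict \<omega> B = b}.
     pmf p \<omega> * (ln (level_prob p (\<lambda>\<omega>. restrict \<omega> (insert X B)) \<omega>) - ln (level_prob p (\<lambda>\<omega>. restrict \<omega> B) \<omega>)))"
proof -
  let ?E = "{\<omega>. restrict \<omega> B = b}"
  have ne: "set_pmf p \<inter> ?E \<noteq> {}" using b by (auto simp: marginal_def)
  have P: "pmf (marginal p B) b = measure_pmf.prob p ?E" "measure_pmf.prob p ?E > 0"
    using b ne by (auto simp: marginal_def pmf_map vimage_def intro!: measure_pmf_posI)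
  have set: "set_pmf (given p B b) = {\<omega>\<in>set_pmf p. restrict \<omega> B = b}"
    using ne by (auto simp: given_def)
  have "entropy_at p X B b = - (\<Sum>\<omega>\<in>{\<omega>\<in>set_pmf p. restrict \<omega> B = b}.
      pmf (given p B b) \<omega> * ln (pmf (map_pmf (\<lambda>\<omega>. \<omega> X) (given p B b)) (\<omega> X)))"
    unfolding entropy_at_def using fin set
    by (subst pmf_entropy_map) (simp_all add: pmf_map_level_prob[of "\<lambda>\<omega>. \<omega> X"])
  also have "\<dots> = - (\<Sum>\<omega>\<in>{\<omega>\<in>set_pmf p. restrict \<omega> B = b}. pmf p \<omega> / measure_pmf.prob p ?E *
      (ln (level_prob p (\<lambda>\<omega>. restrict \<omega> (insert X B)) \<omega>) - ln (level_prob p (\<lambda>\<omega>. restrict \<omega> B) \<omega>)))"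
  proof (intro arg_cong[where f = uminus] sum.cong refl arg_cong2[where f = "(*)"])
    fix \<omega> assume "\<omega> \<in> {\<omega>\<in>set_pmf p. restrict \<omega> B = b}"
    then have \<omega>: "\<omega> \<in> set_pmf p" and b: "b = restrict \<omega> B" by auto
    show "pmf (given p B b) \<omega> = pmf p \<omega> / measure_pmf.prob p ?E"
      using ne b by (simp add: given_def pmf_cond)
    have "level_prob p (\<lambda>\<omega>. (\<omega> X, restrict \<omega> B)) \<omega> = level_prob p (\<lambda>\<omega>. restrict \<omega> (insert X B)) \<omega>"
      by (rule level_prob_cong) (auto simp: restrict_eq_iff)
    then show "ln (pmf (map_pmf (\<lambda>\<omega>. \<omega> X) (given p B b)) (\<omega> X)) =
        ln (level_prob p (\<lambda>\<omega>. restrict \<omega> (insert X B)) \<omega>) - ln (level_prob p (\<lambda>\<omega>. restrict \<omega> B) \<omega>)"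
      unfolding b by (simp add: pmf_map_given[OF \<omega>, of "\<lambda>\<omega>. \<omega> X"] ln_level_prob_mult[OF \<omega>])
  qed
  finally show ?thesis using P by (simp add: sum_distrib_left)
qed

text \<open>Unbiasedness of the sampling estimator: the fibres of the restriction to
  \<open>B\<close> partition the support, and the right side is \<open>H(X | B)\<close> by the chain
  rule.\<close>

lemma expectation_entropy_at:
  assumes fin: "finite (set_pmf p)"
  shows "measure_pmf.expectation (marginal p B) (entropy_at p X B)
    = joint_entropy p (insert X B) - joint_entropy p B"
proof -
  let ?g = "\<lambda>\<omega>. pmf p \<omega> * (ln (level_prob p (\<lambda>\<omega>. restrict \<omega> (insert X B)) \<omega>) - ln (level_prob p (\<lambda>\<omega>. restrict \<omega> B) \<omega>))"
  have set: "set_pmf (marginal p B) = (\<lambda>\<omega>. restrict \<omega> B) ` set_pmf p" by (simp add: marginal_def)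
  have "measure_pmf.expectation (marginal p B) (entropy_at p X B)
      = (\<Sum>b\<in>set_pmf (marginal p B). pmf (marginal p B) b * entropy_at p X B b)"
    by (subst integral_measure_pmf_real[of "set_pmf (marginal p B)"])
      (use fin set in \<open>auto simp: mult.commute\<close>)
  also have "\<dots> = - (\<Sum>b\<in>set_pmf (marginal p B). \<Sum>\<omega>\<in>{\<omega>\<in>set_pmf p. restrict \<omega> B = b}. ?g \<omega>)"
    using entropy_at_eq[OF fin] by (simp add: sum_negf)
  also have "\<dots> = - sum ?g (set_pmf p)"
    unfolding set using sum.image_gen[OF fin, of ?g "\<lambda>\<omega>. restrict \<omega> B"] by simp
  also have "\<dots> = joint_entropy p (insert X B) - joint_entropy p B"
    by (simp add: joint_entropy_def marginal_def pmf_entropy_map[OF fin] right_diff_distrib sum_subtractf)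
  finally show ?thesis .
qed

lemma entropy_at_bounds:
  assumes "set_pmf p \<subseteq> Pi\<^sub>E V vals" "X \<in> V" "finite (vals X)" "b \<in> set_pmf (marginal p B)"
  shows "0 \<le> entropy_at p X B b" "entropy_at p X B b \<le> ln (card (vals X))"
proof -
  show "0 \<le> entropy_at p X B b" by (simp add: entropy_at_def pmf_entropy_nonneg)
  have "set_pmf p \<inter> {\<omega>. restrict \<omega> B = b} \<noteq> {}" using assms(4) by (auto simp: marginal_def)
  then have "set_pmf (map_pmf (\<lambda>\<omega>. \<omega> X) (given p B b)) \<subseteq> vals X"
    using assms(1,2) by (auto simp: given_def)
  then show "entropy_at p X B b \<le> ln (card (vals X))"
    unfolding entropy_at_def using assms(3) by (rule pmf_entropy_le_ln_card[rotated])
qed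

lemma joint_entropy_insert_mono:
  assumes "finite (set_pmf p)"
  shows "joint_entropy p B \<le> joint_entropy p (insert X B)"
proof -
  have "0 \<le> measure_pmf.expectation (marginal p B) (entropy_at p X B)"
    by (rule Bochner_Integration.integral_nonneg) (simp add: entropy_at_def pmf_entropy_nonneg)
  then show ?thesis using expectation_entropy_at[OF assms] by simp
qed

section \<open>Conditional independence and the information gain\<close>

text \<open>Given the value of \<open>U\<close>, the factor of \<open>X\<close> splits off the
  product that independence yields for \<open>insert X T\<close>. The equation holds at every
  \<open>\<omega>\<close> of the support, so logarithms can be taken before averaging.\<close>

lemma level_prob_conditionally_independent:
  assumes ind: "independent_given p S U" and S: "finite S" "insert X T \<subseteq> S" "X \<notin> T"
    and \<omega>: "\<omega> \<in> set_pmf p"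
  shows "level_prob p (\<lambda>\<omega>. restrict \<omega> (insert X (T \<union> U))) \<omega> * level_prob p (\<lambda>\<omega>. restrict \<omega> U) \<omega>
    = level_prob p (\<lambda>\<omega>. restrict \<omega> (insert X U)) \<omega> * level_prob p (\<lambda>\<omega>. restrict \<omega> (T \<union> U)) \<omega>"
proof (cases "T = {}")
  \<comment> \<open>The product rule for independent sets concerns nonempty index sets; for empty
    \<open>T\<close> both sides coincide.\<close>
  case False
  let ?E = "{\<omega>'. restrict \<omega>' U = restrict \<omega> U}"
  define M where "M = given p U (restrict \<omega> U)"
  have ne: "set_pmf p \<inter> ?E \<noteq> {}" using \<omega> by auto
  have "prob_space.indep_vars (measure_pmf M) (\<lambda>_. count_space UNIV) (\<lambda>X \<omega>. \<omega> X) S"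
    using ind \<omega> by (auto simp: independent_given_def marginal_def M_def)
  then have ind': "prob_space.indep_sets (measure_pmf M)
      (\<lambda>i. {(\<lambda>\<omega>. \<omega> i) -` A \<inter> space (measure_pmf M) |A. A \<in> sets (count_space UNIV)}) S"
    by (simp add: prob_space.indep_vars_def2[OF prob_space_measure_pmf])
  have prod: "measure_pmf.prob M {\<omega>'. \<forall>Y\<in>J. \<omega>' Y = \<omega> Y} = (\<Prod>Y\<in>J. measure_pmf.prob M {\<omega>'. \<omega>' Y = \<omega> Y})"
    if J: "J \<subseteq> S" "J \<noteq> {}" for J
  proof -
    have "measure_pmf.prob M (\<Inter>Y\<in>J. {\<omega>'. \<omega>' Y = \<omega> Y}) = (\<Prod>Y\<in>J. measure_pmf.prob M {\<omega>'. \<omega>' Y = \<omega> Y})"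
    proof (rule prob_space.indep_setsD[OF prob_space_measure_pmf ind'])
      show "\<forall>Y\<in>J. {\<omega>'. \<omega>' Y = \<omega> Y} \<in> {(\<lambda>\<omega>. \<omega> Y) -` A \<inter> space (measure_pmf M) |A. A \<in> sets (count_space UNIV)}"
        by (auto intro!: exI[of _ "{\<omega> _}"])
    qed (use J S finite_subset in auto)
    also have "(\<Inter>Y\<in>J. {\<omega>'. \<omega>' Y = \<omega> Y}) = {\<omega>'. \<forall>Y\<in>J. \<omega>' Y = \<omega> Y}" by auto
    finally show ?thesis .
  qed
  have M: "measure_pmf.prob M {\<omega>'. \<forall>Y\<in>J. \<omega>' Y = \<omega> Y}
      = level_prob p (\<lambda>\<omega>. restrict \<omega> (J \<union> U)) \<omega> / level_prob p (\<lambda>\<omega>. restrict \<omega> U) \<omega>" for J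
  proof -
    have "?E \<inter> {\<omega>'. \<forall>Y\<in>J. \<omega>' Y = \<omega> Y} = {\<omega>'. restrict \<omega>' (J \<union> U) = restrict \<omega> (J \<union> U)}"
      by (auto simp: restrict_eq_iff)
    then show ?thesis by (simp add: M_def given_def prob_cond_pmf[OF ne] level_prob_def)
  qed
  have "finite T" using S by (auto intro: finite_subset)
  then have "measure_pmf.prob M {\<omega>'. \<forall>Y\<in>insert X T. \<omega>' Y = \<omega> Y}
    = measure_pmf.prob M {\<omega>'. \<forall>Y\<in>{X}. \<omega>' Y = \<omega> Y} * measure_pmf.prob M {\<omega>'. \<forall>Y\<in>T. \<omega>' Y = \<omega> Y}"
    using S False by (simp only: prod insert_not_empty empty_subsetI insert_subset simp_thms prod.insert
        prod.empty mult_1_right finite.emptyI empty_iff)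
  then show ?thesis
    unfolding M using level_prob_pos[OF \<omega>, of "\<lambda>\<omega>. restrict \<omega> U"] by (simp add: field_simps)
qed simp

lemma joint_entropy_conditionally_independent:
  assumes fin: "finite (set_pmf p)" and ind: "independent_given p S U"
    and S: "finite S" "insert X T \<subseteq> S" "X \<notin> T"
  shows "joint_entropy p (insert X (T \<union> U)) - joint_entropy p (T \<union> U)
    = joint_entropy p (insert X U) - joint_entropy p U"
proof -
  let ?l = "\<lambda>A \<omega>. level_prob p (\<lambda>\<omega>. restrict \<omega> A) \<omega>"
  have "ln (?l (insert X (T \<union> U)) \<omega>) - ln (?l (T \<union> U) \<omega>) = ln (?l (insert X U) \<omega>) - ln (?l U \<omega>)"
    if \<omega>: "\<omega> \<in> set_pmf p" for \<omega>
  proof -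
    have "ln (?l (insert X (T \<union> U)) \<omega> * ?l U \<omega>) = ln (?l (insert X U) \<omega> * ?l (T \<union> U) \<omega>)"
      using level_prob_conditionally_independent[OF ind S \<omega>] by simp
    then show ?thesis by (simp only: ln_level_prob_mult[OF \<omega>])
  qed
  then have "(\<Sum>\<omega>\<in>set_pmf p. pmf p \<omega> * (ln (?l (insert X (T \<union> U)) \<omega>) - ln (?l (T \<union> U) \<omega>)))
      = (\<Sum>\<omega>\<in>set_pmf p. pmf p \<omega> * (ln (?l (insert X U) \<omega>) - ln (?l U \<omega>)))"
    by (intro sum.cong) auto
  then show ?thesis
    by (simp add: joint_entropy_def marginal_def pmf_entropy_map[OF fin] right_diff_distrib sum_subtractf)
qed

text \<open>So \<open>F A\<close> is the mutual information of the joint values of \<open>U\<close>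
  and \<open>A\<close>, also when the two sets overlap.\<close>

lemma info_gain_eq:
  assumes "finite (set_pmf p)"
  shows "info_gain p U A = joint_entropy p U - joint_entropy p (A \<union> U) + joint_entropy p A"
proof -
  have "U - A \<union> A = A \<union> U" by auto
  then show ?thesis by (simp add: info_gain_def cond_entropy_eq[OF assms])
qed

text \<open>For \<open>X \<in> S\<close> conditional independence turns
  \<open>H(X | G \<union> U)\<close> into \<open>H(X | U)\<close>; for \<open>X \<in> U\<close> the
  set \<open>G \<union> U\<close> already contains \<open>X\<close>. The right side is the quantity
  that \<open>sample_increase\<close> estimates.\<close>

lemma info_gain_insert:
  assumes fin: "finite (set_pmf p)" and ind: "independent_given p S U"
    and S: "finite S" "G \<subseteq> S \<union> U" "X \<in> S \<union> U" "X \<notin> G" "S \<inter> U = {}"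
  shows "info_gain p U (insert X G) - info_gain p U G =
    joint_entropy p (insert X G) - joint_entropy p G -
      (if X \<in> S then joint_entropy p (insert X U) - joint_entropy p U else 0)"
proof (cases "X \<in> S")
  case True
  have "(G - U) \<union> U = G \<union> U" by auto
  then have "joint_entropy p (insert X (G \<union> U)) - joint_entropy p (G \<union> U) = joint_entropy p (insert X U) - joint_entropy p U"
    using joint_entropy_conditionally_independent[OF fin ind S(1), of X "G - U"] True S by auto
  then show ?thesis using True by (simp add: info_gain_eq[OF fin])
next
  case False
  then have "insert X G \<union> U = G \<union> U" using S by auto
  then show ?thesis using False by (simp add: info_gain_eq[OF fin])
qed

text \<open>The correction \<open>H(X | U)\<close> in \<open>info_gain_insert\<close> does not
  depend on \<open>G\<close>, so diminishing returns are those of joint entropy. Monotonicity comes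
  from \<open>H(X | A \<union> U) \<le> H(X | A)\<close>, the same inequality for \<open>A\<close>
  and \<open>A \<union> U\<close>.\<close>

lemma submodular_budget_info_gain:
  assumes fin: "finite (set_pmf p)" and ind: "independent_given p S U"
    and S: "finite S" "S \<inter> U = {}" "W \<subseteq> S \<union> U" "finite W" "\<And>X. X \<in> W \<Longrightarrow> 0 < c X"
  shows "info_gain p U {} = 0"
    and "A \<subseteq> W \<Longrightarrow> X \<in> W \<Longrightarrow> info_gain p U A \<le> info_gain p U (insert X A)"
    and "A \<subseteq> B \<Longrightarrow> B \<subseteq> W \<Longrightarrow> X \<in> W \<Longrightarrow> X \<notin> B \<Longrightarrow>
       info_gain p U (insert X B) - info_gain p U B \<le> info_gain p U (insert X A) - info_gain p U A"
proof -
  note insert = info_gain_insert[OF fin ind S(1) _ _ _ S(2)]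
  show "info_gain p U {} = 0" by (simp add: info_gain_eq[OF fin] joint_entropy_empty)
  show "info_gain p U A \<le> info_gain p U (insert X A)" if "A \<subseteq> W" "X \<in> W"
  proof (cases "X \<in> A")
    case False
    have "joint_entropy p (insert X (A \<union> U)) - joint_entropy p (A \<union> U)
        \<le> joint_entropy p (insert X A) - joint_entropy p A"
      using joint_entropy_submodular[OF fin, of A "A \<union> U" X] by simp
    moreover have "joint_entropy p (A \<union> U) \<le> joint_entropy p (insert X (A \<union> U))"
      by (rule joint_entropy_insert_mono[OF fin])
    ultimately show ?thesis by (simp add: info_gain_eq[OF fin])
  qed (simp add: insert_absorb)
  show "info_gain p U (insert X B) - info_gain p U B \<le> info_gain p U (insert X A) - info_gain p U A"
    if "A \<subseteq> B" "B \<subseteq> W" "X \<in> W" "X \<notin> B"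
  proof -
    have "info_gain p U (insert X B) - info_gain p U B = joint_entropy p (insert X B) - joint_entropy p B -
      (if X \<in> S then joint_entropy p (insert X U) - joint_entropy p U else 0)"
      by (rule insert) (use that S in auto)
    moreover have "info_gain p U (insert X A) - info_gain p U A = joint_entropy p (insert X A) - joint_entropy p A -
      (if X \<in> S then joint_entropy p (insert X U) - joint_entropy p U else 0)"
      by (rule insert) (use that S in auto)
    ultimately show ?thesis using joint_entropy_submodular[OF fin \<open>A \<subseteq> B\<close>, of X] by simp
  qed
qed


section \<open>Concentration of the sampling estimators\<close>

text \<open>Exponential moments of independent samples multiply. Nonnegative integrals keep
  integrability out of the argument.\<close>

lemma replicate_pmf_Chernoff:
  fixes g :: "'a \<Rightarrow> real"
  shows "(\<integral>\<^sup>+xs. ennreal (exp (l * (\<Sum>x\<leftarrow>xs. g x))) \<partial>replicate_pmf n q)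
    = (\<integral>\<^sup>+x. ennreal (exp (l * g x)) \<partial>q) ^ n"
proof (induction n)
  case (Suc n)
  have "(\<integral>\<^sup>+xs. ennreal (exp (l * (\<Sum>x\<leftarrow>xs. g x))) \<partial>replicate_pmf (Suc n) q)
    = (\<integral>\<^sup>+x. (\<integral>\<^sup>+xs. ennreal (exp (l * g x)) * ennreal (exp (l * (\<Sum>x\<leftarrow>xs. g x))) \<partial>replicate_pmf n q) \<partial>q)"
    by (simp add: distrib_left exp_add ennreal_mult)
  also have "\<dots> = (\<integral>\<^sup>+x. ennreal (exp (l * g x)) \<partial>q) * (\<integral>\<^sup>+x. ennreal (exp (l * g x)) \<partial>q) ^ n"
    by (simp add: nn_integral_cmult nn_integral_multc Suc)
  finally show ?case by simp
qed simp

lemma replicate_pmf_Hoeffding: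
  fixes g :: "'a \<Rightarrow> real"
  assumes g: "\<And>x. x \<in> set_pmf q \<Longrightarrow> g x \<in> {a..b}" and "a < b" "0 < \<tau>"
  shows "measure_pmf.prob (replicate_pmf n q)
      {xs. real n * (measure_pmf.expectation q g + \<tau>) \<le> (\<Sum>x\<leftarrow>xs. g x)}
    \<le> exp (- 2 * real n * \<tau>\<^sup>2 / (b - a)\<^sup>2)"
proof -
  interpret interval_bounded_random_variable "measure_pmf q" g a b
    by unfold_locales (use g in \<open>auto simp: AE_measure_pmf_iff\<close>)
  define \<mu> where "\<mu> = measure_pmf.expectation q g"
  \<comment> \<open>Minimiser of the exponent
    \<open>- l * \<tau> + l\<^sup>2 * (b - a)\<^sup>2 / 8\<close>.\<close>
  define l where "l = 4 * \<tau> / (b - a)\<^sup>2"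
  have l: "0 < l" using assms by (simp add: l_def)
  let ?R = "replicate_pmf n q" and ?h = "\<lambda>xs. \<Sum>x\<leftarrow>xs. g x - \<mu>"
  have sum: "?h xs = (\<Sum>x\<leftarrow>xs. g x) - real (length xs) * \<mu>" for xs
    by (simp add: sum_list_subtractf sum_list_triv)
  have "measure_pmf.prob ?R {xs. real n * (\<mu> + \<tau>) \<le> (\<Sum>x\<leftarrow>xs. g x)}
      = measure_pmf.prob ?R {xs. real n * \<tau> \<le> ?h xs}"
    by (rule measure_pmf.finite_measure_eq_AE)
      (auto simp: AE_measure_pmf_iff set_replicate_pmf sum algebra_simps)
  also have "ennreal \<dots> = (\<integral>\<^sup>+xs. indicator {xs. real n * \<tau> \<le> ?h xs} xs \<partial>?R)"
    by (simp add: measure_pmf.emeasure_eq_measure)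
  \<comment> \<open>Markov's inequality for the exponential of \<open>l * ?h xs\<close>.\<close>
  also have "\<dots> \<le> (\<integral>\<^sup>+xs. ennreal (exp (- l * (real n * \<tau>))) * ennreal (exp (l * ?h xs)) \<partial>?R)"
  proof (rule nn_integral_mono)
    fix xs
    show "(indicator {xs. real n * \<tau> \<le> ?h xs} xs :: ennreal)
      \<le> ennreal (exp (- l * (real n * \<tau>))) * ennreal (exp (l * ?h xs))"
    proof (cases "real n * \<tau> \<le> ?h xs")
      case True
      then have "0 \<le> l * (?h xs - real n * \<tau>)" using l by simp
      then have "1 \<le> exp (- l * (real n * \<tau>)) * exp (l * ?h xs)"
        by (simp add: exp_add[symmetric] right_diff_distrib)
      then show ?thesis using True by (simp add: ennreal_mult'[symmetric])
    qed simp
  qed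
  also have "\<dots> = ennreal (exp (- l * (real n * \<tau>))) * (\<integral>\<^sup>+x. ennreal (exp (l * (g x - \<mu>))) \<partial>q) ^ n"
    by (simp add: nn_integral_cmult replicate_pmf_Chernoff)
  also have "\<dots> \<le> ennreal (exp (- l * (real n * \<tau>))) * ennreal (exp (l\<^sup>2 * (b - a)\<^sup>2 / 8)) ^ n"
    using Hoeffdings_lemma_nn_integral[OF l] by (intro mult_left_mono power_mono) (auto simp: \<mu>_def)
  also have "\<dots> = ennreal (exp (- l * (real n * \<tau>) + real n * (l\<^sup>2 * (b - a)\<^sup>2 / 8)))"
    by (simp only: ennreal_power exp_ge_zero ennreal_mult'[symmetric] exp_of_nat_mult[symmetric] exp_add[symmetric])
  also have "- l * (real n * \<tau>) + real n * (l\<^sup>2 * (b - a)\<^sup>2 / 8) = - 2 * real n * \<tau>\<^sup>2 / (b - a)\<^sup>2"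
  proof -
    define D where "D = (b - a)\<^sup>2"
    have "D \<noteq> 0" using \<open>a < b\<close> by (simp add: D_def)
    then show ?thesis
      unfolding l_def D_def[symmetric] by (simp add: field_simps power2_eq_square)
  qed
  finally show ?thesis by (simp add: \<mu>_def)
qed

lemma prob_map_pmf_fst: "measure_pmf.prob (map_pmf (\<lambda>x. (f x, t)) q) {(x, t). \<not> P x} = measure_pmf.prob q {x. \<not> P (f x)}"
  by (simp add: vimage_def)

context
  fixes p :: "('i \<Rightarrow> 'v) pmf" and B :: "'i set" and X :: 'i and b :: real
  assumes bounds: "\<And>\<beta>. \<beta> \<in> set_pmf (marginal p B) \<Longrightarrow> 0 \<le> entropy_at p X B \<beta> \<and> entropy_at p X B \<beta> \<le> b"
begin

private abbreviation (input) "\<mu> \<equiv> measure_pmf.expectation (marginal p B) (entropy_at p X B)"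

text \<open>A single tail without the factor 2, and a strict conclusion, as required for showing
  that an estimated increment is positive.\<close>

lemma likely_sample_cond_entropy_less:
  assumes "0 < b" "0 < \<tau>" "0 < N"
  shows "likely (sample_cond_entropy c_inf N p X B) (exp (- 2 * real N * \<tau>\<^sup>2 / b\<^sup>2)) (\<lambda>h. h < \<mu> + \<tau>)"
proof -
  have "{bs. \<not> (\<Sum>\<beta>\<leftarrow>bs. entropy_at p X B \<beta>) / real N < \<mu> + \<tau>}
      = {bs. real N * (\<mu> + \<tau>) \<le> (\<Sum>\<beta>\<leftarrow>bs. entropy_at p X B \<beta>)}"
    using \<open>0 < N\<close> by (auto simp: field_simps)
  then show ?thesis
    using replicate_pmf_Hoeffding[of "marginal p B" "entropy_at p X B" 0 b \<tau> N] bounds assms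
    by (simp add: likely_def sample_cond_entropy_def prob_map_pmf_fst)
qed

lemma likely_sample_cond_entropy:
  assumes "0 < b" "0 < \<tau>" "0 < N"
  shows "likely (sample_cond_entropy c_inf N p X B) (2 * exp (- 2 * real N * \<tau>\<^sup>2 / b\<^sup>2)) (\<lambda>h. \<bar>h - \<mu>\<bar> \<le> \<tau>)"
proof -
  let ?R = "replicate_pmf N (marginal p B)" and ?s = "\<lambda>bs. \<Sum>\<beta>\<leftarrow>bs. entropy_at p X B \<beta>"
  let ?A = "{bs. real N * (\<mu> + \<tau>) \<le> ?s bs}"
  \<comment> \<open>The lower tail is the upper tail of the negated summands, which range over
    \<open>{- b..0}\<close>.\<close>
  let ?A' = "{bs. real N * (measure_pmf.expectation (marginal p B) (\<lambda>\<beta>. - entropy_at p X B \<beta>) + \<tau>)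
    \<le> (\<Sum>\<beta>\<leftarrow>bs. - entropy_at p X B \<beta>)}"
  have neg: "(\<Sum>\<beta>\<leftarrow>bs. - entropy_at p X B \<beta>) = - ?s bs" for bs
    by (induction bs) auto
  have "{bs. \<not> \<bar>?s bs / real N - \<mu>\<bar> \<le> \<tau>} \<subseteq> ?A \<union> ?A'"
    unfolding neg using \<open>0 < N\<close> by (auto simp: field_simps abs_if split: if_splits)
  then have "measure_pmf.prob ?R {bs. \<not> \<bar>?s bs / real N - \<mu>\<bar> \<le> \<tau>} \<le> measure_pmf.prob ?R (?A \<union> ?A')"
    by (rule measure_pmf.finite_measure_mono) simp
  also have "\<dots> \<le> measure_pmf.prob ?R ?A + measure_pmf.prob ?R ?A'"
    by (rule measure_Un_le) auto
  also have "\<dots> \<le> exp (- 2 * real N * \<tau>\<^sup>2 / (b - 0)\<^sup>2) + exp (- 2 * real N * \<tau>\<^sup>2 / (0 - (- b))\<^sup>2)"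
    using bounds assms by (intro add_mono replicate_pmf_Hoeffding) auto
  finally show ?thesis
    by (simp add: likely_def sample_cond_entropy_def prob_map_pmf_fst)
qed

end

text \<open>Without variation the average is exact. Two cases matter: all entropies vanish if
  \<open>ln K = 0\<close>, and for \<open>B = {}\<close> there is only one joint value to
  draw.\<close>

lemma likely_sample_cond_entropy_const:
  assumes const: "\<And>\<beta>. \<beta> \<in> set_pmf (marginal p B) \<Longrightarrow> entropy_at p X B \<beta> = a" and "0 < N"
  shows "likely (sample_cond_entropy c_inf N p X B) 0
    (\<lambda>h. h = measure_pmf.expectation (marginal p B) (entropy_at p X B))"
proof -
  have "measure_pmf.expectation (marginal p B) (entropy_at p X B) = (\<integral>\<beta>. a \<partial>marginal p B)"
    by (rule integral_cong_AE) (use const in \<open>auto simp: AE_measure_pmf_iff\<close>)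
  then have \<mu>: "measure_pmf.expectation (marginal p B) (entropy_at p X B) = a" by simp
  have "(\<Sum>\<beta>\<leftarrow>bs. entropy_at p X B \<beta>) = real N * a" if bs: "bs \<in> set_pmf (replicate_pmf N (marginal p B))" for bs
  proof -
    have "map (entropy_at p X B) bs = map (\<lambda>_. a) bs"
      using bs const by (auto simp: set_replicate_pmf in_lists_conv_set)
    then have "(\<Sum>\<beta>\<leftarrow>bs. entropy_at p X B \<beta>) = (\<Sum>\<beta>\<leftarrow>bs. a)" by (simp only:)
    then show ?thesis using bs by (simp add: sum_list_triv set_replicate_pmf)
  qed
  then have "measure_pmf.prob (replicate_pmf N (marginal p B))
      {bs. \<not> (\<Sum>\<beta>\<leftarrow>bs. entropy_at p X B \<beta>) / real N = a} = 0"
    using \<open>0 < N\<close> by (subst measure_pmf.prob_eq_0) (auto simp: AE_measure_pmf_iff)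
  then show ?thesis
    by (simp add: likely_def sample_cond_entropy_def prob_map_pmf_fst \<mu>)
qed

section \<open>Accuracy and cost of estimated increments\<close>

lemma likely_sample_increase:
  assumes est: "\<And>B. likely (sample_cond_entropy c_inf N p X B) \<beta> (\<lambda>h. \<bar>h - CE B\<bar> \<le> \<tau>)"
    and "0 \<le> \<beta>" "0 \<le> \<tau>"
  shows "likely (sample_increase c_inf N p S U X G) (2 * \<beta>)
    (\<lambda>x. \<bar>x - (CE G - (if X \<in> S then CE U else 0))\<bar> \<le> 2 * \<tau>)"
proof (cases "X \<in> S")
  case True
  have "likely (sample_cond_entropy c_inf N p X G \<bind>\<^sub>t (\<lambda>h. sample_cond_entropy c_inf N p X U \<bind>\<^sub>t (\<lambda>h'.
         tick 1 \<bind>\<^sub>t (\<lambda>_. ret (h - h'))))) (\<beta> + (\<beta> + 0)) (\<lambda>x. \<bar>x - (CE G - CE U)\<bar> \<le> 2 * \<tau>)"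
  proof (rule likely_bind[OF est])
    fix h assume h: "\<bar>h - CE G\<bar> \<le> \<tau>"
    show "likely (sample_cond_entropy c_inf N p X U \<bind>\<^sub>t (\<lambda>h'. tick 1 \<bind>\<^sub>t (\<lambda>_. ret (h - h')))) (\<beta> + 0)
      (\<lambda>x. \<bar>x - (CE G - CE U)\<bar> \<le> 2 * \<tau>)"
      by (rule likely_bind[OF est], rule likely_tick_bind, rule likely_ret) (use h in auto)
  qed (use \<open>0 \<le> \<beta>\<close> in simp)
  then show ?thesis using True unfolding sample_increase_def by (intro likely_tick_bind) simp
next
  case False
  have "likely (sample_cond_entropy c_inf N p X G) (2 * \<beta>) (\<lambda>x. \<bar>x - CE G\<bar> \<le> 2 * \<tau>)"
    by (rule likely_weaken[OF est]) (use assms(2,3) in auto)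
  then show ?thesis using False unfolding sample_increase_def by (intro likely_tick_bind) simp
qed

text \<open>With \<open>H(X | G)\<close> exact, only an overestimate of \<open>H(X | U)\<close> can
  push the difference down to 0, so the one-sided failure bound is inherited unchanged.\<close>

lemma likely_sample_increase_pos:
  assumes exact: "likely (sample_cond_entropy c_inf N p X G) 0 (\<lambda>h. h = CE G)"
    and less: "likely (sample_cond_entropy c_inf N p X U) \<beta> (\<lambda>h. h < CE G)"
    and "X \<notin> S \<Longrightarrow> 0 < CE G"
  shows "likely (sample_increase c_inf N p S U X G) \<beta> (\<lambda>x. 0 < x)"
proof (cases "X \<in> S")
  case True
  note \<beta> = likely_nonneg[OF less]
  have "likely (sample_cond_entropy c_inf N p X G \<bind>\<^sub>t (\<lambda>h. sample_cond_entropy c_inf N p X U \<bind>\<^sub>t (\<lambda>h'.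
         tick 1 \<bind>\<^sub>t (\<lambda>_. ret (h - h'))))) (0 + (\<beta> + 0)) (\<lambda>x. 0 < x)"
  proof (rule likely_bind[OF exact])
    fix h assume h: "h = CE G"
    show "likely (sample_cond_entropy c_inf N p X U \<bind>\<^sub>t (\<lambda>h'. tick 1 \<bind>\<^sub>t (\<lambda>_. ret (h - h')))) (\<beta> + 0) (\<lambda>x. 0 < x)"
      by (rule likely_bind[OF less], rule likely_tick_bind, rule likely_ret) (use h in auto)
  qed (use \<beta> in simp)
  then show ?thesis using True unfolding sample_increase_def by (intro likely_tick_bind) simp
next
  case False
  have "likely (sample_cond_entropy c_inf N p X G) \<beta> (\<lambda>x. 0 < x)"
    by (rule likely_weaken[OF exact]) (use False assms(3) likely_nonneg[OF less] in auto)
  then show ?thesis using False unfolding sample_increase_def by (intro likely_tick_bind) simp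
qed

lemma surely_sample_cond_entropy:
  "surely (sample_cond_entropy c_inf N p X B) (real N * (c_inf + 1) + 1) (\<lambda>_. True)"
  by (auto simp: surely_def sample_cond_entropy_def)

lemma surely_sample_increase:
  assumes "1 \<le> c_inf" "0 < N"
  shows "surely (sample_increase c_inf N p S U X G) (8 * real N * c_inf) (\<lambda>_. True)"
proof -
  let ?T = "real N * (c_inf + 1) + 1"
  have "1 \<le> real N" using assms by simp
  moreover have "real N * 1 \<le> real N * c_inf" using assms by (intro mult_left_mono) auto
  moreover have "?T = real N * c_inf + real N + 1" "8 * real N * c_inf = 8 * (real N * c_inf)"
    by (simp_all add: distrib_left)
  \<comment> \<open>Two estimates and two ticks take \<open>2 * N * c_inf + 2 * N + 4\<close> steps.
    As \<open>N\<close> and \<open>c_inf\<close> are at least 1, this is at most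
    \<open>(2 + 2 + 4) * N * c_inf\<close>.\<close>
  ultimately have T: "1 + (?T + (?T + 1)) \<le> 8 * real N * c_inf" and T': "0 \<le> ?T"
    by linarith+
  show ?thesis
    unfolding sample_increase_def
  proof (rule surely_tick_bind[OF _ T])
    show "surely (if X \<in> S then sample_cond_entropy c_inf N p X G \<bind>\<^sub>t
          (\<lambda>h. sample_cond_entropy c_inf N p X U \<bind>\<^sub>t (\<lambda>h'. tick 1 \<bind>\<^sub>t (\<lambda>_. ret (h - h'))))
       else sample_cond_entropy c_inf N p X G) (?T + (?T + 1)) (\<lambda>_. True)"
    proof (cases "X \<in> S")
      case True
      have "surely (sample_cond_entropy c_inf N p X G \<bind>\<^sub>t
          (\<lambda>h. sample_cond_entropy c_inf N p X U \<bind>\<^sub>t (\<lambda>h'. tick 1 \<bind>\<^sub>t (\<lambda>_. ret (h - h')))))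
          (?T + (?T + 1)) (\<lambda>_. True)"
        by (intro surely_bind[OF surely_sample_cond_entropy] surely_tick_ret) auto
      then show ?thesis using True by simp
    next
      case False
      have "surely (sample_cond_entropy c_inf N p X G) (?T + (?T + 1)) (\<lambda>_. True)"
        by (rule surely_weaken[OF surely_sample_cond_entropy]) (use T' in auto)
      then show ?thesis using False by simp
    qed
  qed
qed


section \<open>Greedy maximisation of a submodular function from noisy increments\<close>

locale submodular_budget =
  fixes W :: "'i set" and F :: "'i set \<Rightarrow> real" and c :: "'i \<Rightarrow> nat" and L :: real
  assumes fin_W: "finite W"
    and F_empty: "F {} = 0"
    and F_insert_mono: "\<And>X A. A \<subseteq> W \<Longrightarrow> X \<in> W \<Longrightarrow> F A \<le> F (insert X A)"
    and F_submodular: "\<And>X A B. A \<subseteq> B \<Longrightarrow> B \<subseteq> W \<Longrightarrow> X \<in> W \<Longrightarrow> X \<notin> B \<Longrightarrow>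
       F (insert X B) - F B \<le> F (insert X A) - F A"
    and c_pos: "\<And>X. X \<in> W \<Longrightarrow> 0 < c X"
begin

abbreviation cost :: "'i set \<Rightarrow> real" where
  "cost A \<equiv> real (sum c A)"

text \<open>Insert the elements of \<open>B - A\<close> one by one; by submodularity each
  contributes at most its increment at \<open>A\<close>.\<close>

lemma F_union_le:
  assumes "A \<subseteq> W" "B \<subseteq> W"
  shows "F (A \<union> B) - F A \<le> (\<Sum>Y\<in>B - A. F (insert Y A) - F A)"
proof -
  have "F (A \<union> D) - F A \<le> (\<Sum>Y\<in>D. F (insert Y A) - F A)" if "finite D" "D \<subseteq> W - A" for D
    using that
  proof (induction D)
    case (insert Y D)
    have "F (insert Y (A \<union> D)) - F (A \<union> D) \<le> F (insert Y A) - F A"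
      by (rule F_submodular) (use insert assms in auto)
    then show ?case using insert by simp
  qed simp
  from this[of "B - A"] show ?thesis
    using assms fin_W by (simp add: Un_Diff_cancel finite_subset Diff_mono)
qed

lemma F_mono:
  assumes "A \<subseteq> B" "B \<subseteq> W"
  shows "F A \<le> F B"
proof -
  have "F A \<le> F (A \<union> D)" if "finite D" "D \<subseteq> W" for D
    using that
  proof (induction D)
    case (insert Y D)
    have "F (A \<union> D) \<le> F (insert Y (A \<union> D))"
      by (rule F_insert_mono) (use insert assms in auto)
    then show ?case using insert by simp
  qed simp
  from this[of B] show ?thesis
    using assms fin_W by (simp add: finite_subset Un_absorb1)
qed

lemma F_nonneg: "A \<subseteq> W \<Longrightarrow> 0 \<le> F A"
  using F_mono[of "{}" A] F_empty by simp

lemma card_le_cost: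
  assumes "A \<subseteq> W"
  shows "real (card A) \<le> cost A"
proof -
  have "card A = (\<Sum>X\<in>A. 1)" by simp
  also have "\<dots> \<le> sum c A"
    by (rule sum_mono) (use assms c_pos in \<open>force simp: Suc_le_eq\<close>)
  finally show ?thesis by (rule of_nat_mono)
qed

lemma cost_mono: "A \<subseteq> B \<Longrightarrow> B \<subseteq> W \<Longrightarrow> cost A \<le> cost B"
  using fin_W by (intro of_nat_mono sum_mono2) (auto intro: finite_subset)

lemma cost_insert: "G \<subseteq> W \<Longrightarrow> X \<notin> G \<Longrightarrow> cost (insert X G) = cost G + real (c X)"
  using fin_W by (simp add: finite_subset)

text \<open>The prefix consists of the first \<open>k\<close> elements chosen greedily, without costs, from \<open>B\<close>.\<close>

lemma greedy_prefix:
  assumes "B \<subseteq> W" "k \<le> card B"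
  shows "\<exists>G\<^sub>0\<subseteq>B. card G\<^sub>0 = k \<and>
    (\<forall>Y\<in>B. \<forall>G. G\<^sub>0 \<subseteq> G \<and> G \<subseteq> W \<and> Y \<notin> G \<longrightarrow> real k * (F (insert Y G) - F G) \<le> F G\<^sub>0)"
  using assms(2)
proof (induction k)
  case 0
  show ?case using F_nonneg F_empty by (intro exI[of _ "{}"]) auto
next
  case (Suc k)
  then obtain G\<^sub>0 where G: "G\<^sub>0 \<subseteq> B" "card G\<^sub>0 = k"
    and le: "\<And>Y G. Y \<in> B \<Longrightarrow> G\<^sub>0 \<subseteq> G \<Longrightarrow> G \<subseteq> W \<Longrightarrow> Y \<notin> G \<Longrightarrow>
      real k * (F (insert Y G) - F G) \<le> F G\<^sub>0"
    by (metis Suc_leD)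
  have fin: "finite B" using assms(1) fin_W finite_subset by blast
  have "B - G\<^sub>0 \<noteq> {}" using G Suc.prems card_mono[OF finite_subset[OF G(1) fin], of B] by fastforce
  then obtain Z where Z: "Z \<in> B - G\<^sub>0" and max: "\<And>Y. Y \<in> B - G\<^sub>0 \<Longrightarrow> F (insert Y G\<^sub>0) \<le> F (insert Z G\<^sub>0)"
    using Max_in[of "(\<lambda>Y. F (insert Y G\<^sub>0)) ` (B - G\<^sub>0)"] Max_ge[of "(\<lambda>Y. F (insert Y G\<^sub>0)) ` (B - G\<^sub>0)"] fin
    by fastforce
  show ?case
  proof (intro exI[of _ "insert Z G\<^sub>0"] conjI ballI allI impI)
    show "insert Z G\<^sub>0 \<subseteq> B" using Z G by auto
    show "card (insert Z G\<^sub>0) = Suc k"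
      using Z G finite_subset[OF G(1) fin] by simp
    fix Y G'
    assume Y: "Y \<in> B" and H: "insert Z G\<^sub>0 \<subseteq> G' \<and> G' \<subseteq> W \<and> Y \<notin> G'"
    \<comment> \<open>The gain of \<open>Y\<close> at \<open>G'\<close> is paid \<open>k\<close>
      times by \<open>F G\<^sub>0\<close> and once more by the gain of \<open>Z\<close>, which was
      maximal at \<open>G\<^sub>0\<close>.\<close>
    have "real k * (F (insert Y G') - F G') \<le> F G\<^sub>0"
      using le[of Y G'] Y H by auto
    moreover have "F (insert Y G') - F G' \<le> F (insert Y G\<^sub>0) - F G\<^sub>0"
      by (rule F_submodular) (use Y H assms(1) in auto)
    moreover have "F (insert Y G\<^sub>0) \<le> F (insert Z G\<^sub>0)"
      by (rule max) (use Y H in auto)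
    ultimately show "real (Suc k) * (F (insert Y G') - F G') \<le> F (insert Z G\<^sub>0)"
      by (simp add: algebra_simps)
  qed
qed

text \<open>
  The exponential bounds the product of the factors \<open>1 - c X / (L - cost G\<^sub>0)\<close> by which the gap
  shrinks, and \<open>k\<close> counts the elements added to \<open>G\<^sub>0\<close>, each of which may lose another \<open>\<eta>\<close>.
\<close>

definition gap_bound :: "real \<Rightarrow> 'i set \<Rightarrow> 'i set \<Rightarrow> real \<Rightarrow> 'i set \<Rightarrow> bool" where
  "gap_bound \<eta> B G\<^sub>0 k G \<longleftrightarrow>
     F B - F G \<le> exp (- (cost G - cost G\<^sub>0) / (L - cost G\<^sub>0)) * (F B - F G\<^sub>0) + (k + L) * \<eta>"

text \<open>Up to errors no element of \<open>B - G\<close> has a better ratio than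
  \<open>X\<close>, and their costs sum to at most \<open>L - cost G\<^sub>0\<close>; so the gain of
  \<open>X\<close> is at least the fraction \<open>x\<close> of the gap. By
  \<open>1 - x \<le> exp (- x)\<close> the factors become costs added in the exponent.
  \<open>X\<close> is only required to fit beside \<open>G\<^sub>0\<close>, because the step is also
  applied to the element whose rejection ends the analysis.\<close>

lemma gap_step:
  assumes B: "B \<subseteq> W" "cost B \<le> L" "G\<^sub>0 \<subseteq> B"
    and G: "G\<^sub>0 \<subseteq> G" "G \<subseteq> W" "X \<in> W" "X \<notin> G" "real (c X) \<le> L - cost G\<^sub>0"
    and best: "\<And>Y. Y \<in> B - G \<Longrightarrow>
      (F (insert Y G) - F G - \<eta>) / real (c Y) \<le> (F (insert X G) - F G + \<eta>) / real (c X)"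
    and gap: "gap_bound \<eta> B G\<^sub>0 k G" and "0 \<le> k" "0 \<le> \<eta>"
  shows "gap_bound \<eta> B G\<^sub>0 (k + 1) (insert X G)"
proof -
  define L' where "L' = L - cost G\<^sub>0"
  define x where "x = real (c X) / L'"
  define D where "D Y = F (insert Y G) - F G" for Y
  define E where "E = exp (- (cost G - cost G\<^sub>0) / L') * (F B - F G\<^sub>0)"
  have cX: "0 < real (c X)" using c_pos G by simp
  then have L': "0 < L'" "real (c X) \<le> L'" using G(5) by (auto simp: L'_def)
  then have x: "0 < x" "x \<le> 1" using cX by (auto simp: x_def)
  have DX: "0 \<le> D X" using F_insert_mono G by (simp add: D_def)
  have E: "0 \<le> E" using F_mono[OF B(3) B(1)] by (simp add: E_def)
  have finB: "finite B" using B(1) fin_W finite_subset by blast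
  have "F B \<le> F (G \<union> B)" by (rule F_mono) (use B G in auto)
  moreover have "F (G \<union> B) - F G \<le> (\<Sum>Y\<in>B - G. D Y)"
    unfolding D_def by (rule F_union_le) (use B G in auto)
  moreover have "(\<Sum>Y\<in>B - G. D Y) \<le> (\<Sum>Y\<in>B - G. real (c Y) * ((D X + \<eta>) / real (c X)) + \<eta>)"
  proof (rule sum_mono)
    fix Y assume Y: "Y \<in> B - G"
    have "0 < real (c Y)" using c_pos Y B by auto
    moreover have "(D Y - \<eta>) / real (c Y) \<le> (D X + \<eta>) / real (c X)"
      using best[OF Y] by (simp add: D_def)
    ultimately show "D Y \<le> real (c Y) * ((D X + \<eta>) / real (c X)) + \<eta>"
      by (simp add: pos_divide_le_eq mult.commute)
  qed
  moreover have "(\<Sum>Y\<in>B - G. real (c Y) * ((D X + \<eta>) / real (c X)) + \<eta>)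
      = cost (B - G) * ((D X + \<eta>) / real (c X)) + real (card (B - G)) * \<eta>"
    by (simp add: sum.distrib sum_distrib_right[symmetric] sum_divide_distrib[symmetric])
  moreover have "cost (B - G) * ((D X + \<eta>) / real (c X)) \<le> L' * ((D X + \<eta>) / real (c X))"
  proof (rule mult_right_mono)
    have "cost (B - G) \<le> cost (B - G\<^sub>0)"
      by (rule cost_mono) (use B G in auto)
    also have "\<dots> = cost B - cost G\<^sub>0"
      using sum_diff[OF finB B(3), of "\<lambda>X. real (c X)"] by simp
    finally show "cost (B - G) \<le> L'" using B by (simp add: L'_def)
  qed (use DX cX \<open>0 \<le> \<eta>\<close> in auto)
  moreover have "real (card (B - G)) * \<eta> \<le> L * \<eta>"
  proof (rule mult_right_mono)
    show "real (card (B - G)) \<le> L"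
      using card_le_cost[of "B - G"] cost_mono[of "B - G" B] B by force
  qed fact
  ultimately have *: "F B - F G \<le> L' * ((D X + \<eta>) / real (c X)) + L * \<eta>" by linarith
  then have "x * (F B - F G) \<le> x * (L' * ((D X + \<eta>) / real (c X)) + L * \<eta>)"
    using x by simp
  also have "\<dots> = D X + \<eta> + x * L * \<eta>"
    using cX L' by (simp add: x_def field_simps)
  finally have DX_ge: "x * (F B - F G) \<le> D X + \<eta> + x * L * \<eta>" .
  have "F B - F (insert X G) = (F B - F G) - D X" by (simp add: D_def)
  also have "\<dots> \<le> (1 - x) * (F B - F G) + \<eta> + x * L * \<eta>"
    using DX_ge by (simp add: algebra_simps)
  \<comment> \<open>The term \<open>L * \<eta>\<close> is a fixed point: shrunk by
    \<open>1 - x\<close>, it is refilled by \<open>x * L * \<eta>\<close>, which stems from the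
    errors on \<open>B - G\<close>. Only the \<open>\<eta>\<close> of \<open>X\<close> itself
    accumulates in \<open>k\<close>.\<close>
  also have "\<dots> \<le> (1 - x) * (E + (k + L) * \<eta>) + \<eta> + x * L * \<eta>"
    using gap x by (simp add: gap_bound_def E_def L'_def mult_left_mono)
  also have "\<dots> = (1 - x) * E + (k + 1 + L) * \<eta> - x * (k * \<eta>)"
    by (simp add: algebra_simps)
  also have "\<dots> \<le> exp (- x) * E + (k + 1 + L) * \<eta>"
  proof -
    have "(1 - x) * E \<le> exp (- x) * E"
      using exp_ge_add_one_self[of "- x"] E by (intro mult_right_mono) auto
    moreover have "0 \<le> x * (k * \<eta>)" using x \<open>0 \<le> k\<close> \<open>0 \<le> \<eta>\<close> by simp
    ultimately show ?thesis by linarith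
  qed
  also have "exp (- x) * E = exp (- (cost (insert X G) - cost G\<^sub>0) / L') * (F B - F G\<^sub>0)"
    unfolding E_def cost_insert[OF G(2,4)] x_def
    by (simp add: mult_exp_exp[symmetric] mult.assoc[symmetric] diff_divide_distrib add_divide_distrib
        exp_add[symmetric] algebra_simps)
  finally show ?thesis by (simp add: gap_bound_def L'_def)
qed

text \<open>The factor \<open>3 \<le> d\<close> enters through \<open>1 / d \<le> 1 / 3 \<le> 1 / e\<close>.\<close>

lemma gap_end:
  assumes B: "B \<subseteq> W" "cost B \<le> L" "G\<^sub>0 \<subseteq> B" "3 \<le> card G\<^sub>0"
    and G: "G\<^sub>0 \<subseteq> G" "G \<subseteq> W" "cost G \<le> L" "X \<in> B" "X \<notin> G" "L < cost G + real (c X)"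
    and prefix: "real (card G\<^sub>0) * (F (insert X G) - F G) \<le> F G\<^sub>0"
    and gap: "gap_bound \<eta> B G\<^sub>0 (real (card G) - real (card G\<^sub>0) + 1) (insert X G)" and "0 \<le> \<eta>"
  shows "(1 - 1 / exp 1) * F B - 2 * L * \<eta> \<le> F G"
proof -
  define L' where "L' = L - cost G\<^sub>0"
  define g where "g = F B - F G\<^sub>0"
  have X: "X \<in> W" using B G by auto
  have "cost (insert X G\<^sub>0) \<le> cost B" by (rule cost_mono) (use B G in auto)
  moreover have "cost (insert X G\<^sub>0) = cost G\<^sub>0 + real (c X)"
    by (rule cost_insert) (use B G in auto)
  ultimately have "0 < L'" using c_pos[OF X] B by (simp add: L'_def)
  \<comment> \<open>The overflowing \<open>X\<close> raises the cost added to the prefix to at least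
    \<open>L'\<close>, so the exponent is at most -1.\<close>
  moreover have "L' \<le> cost (insert X G) - cost G\<^sub>0"
    using G cost_insert[OF G(2,5)] by (simp add: L'_def)
  ultimately have "exp (- (cost (insert X G) - cost G\<^sub>0) / L') \<le> exp (- 1)"
    by (simp add: field_simps)
  moreover have g: "0 \<le> g" using F_mono[OF B(3,1)] by (simp add: g_def)
  ultimately have "exp (- (cost (insert X G) - cost G\<^sub>0) / L') * g \<le> exp (- 1) * g"
    by (rule mult_right_mono)
  \<comment> \<open>Since \<open>card G \<le> L\<close> and the prefix is nonempty, the number of
    added elements including \<open>X\<close> does not exceed \<open>L\<close>.\<close>
  moreover have "(real (card G) - real (card G\<^sub>0) + 1 + L) * \<eta> \<le> (2 * L) * \<eta>"
    using card_le_cost[OF G(2)] G(3) B(4) \<open>0 \<le> \<eta>\<close> by (intro mult_right_mono) auto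
  ultimately have 1: "F B - F (insert X G) \<le> exp (- 1) * g + 2 * L * \<eta>"
    using gap by (simp add: gap_bound_def L'_def g_def)
  have "3 * (F (insert X G) - F G) \<le> real (card G\<^sub>0) * (F (insert X G) - F G)"
    using B(4) F_insert_mono[OF G(2) X] by (intro mult_right_mono) auto
  then have 2: "3 * (F (insert X G) - F G) \<le> F G\<^sub>0" using prefix by linarith
  \<comment> \<open>The gap bound is relative to \<open>F B - F G\<^sub>0\<close> and so leaves
    \<open>exp (- 1) * F G\<^sub>0\<close> over; this covers the loss of at most
    \<open>F G\<^sub>0 / 3\<close> from removing \<open>X\<close> again.\<close>
  have "1 / 3 \<le> exp (- 1 :: real)" using exp_le by (simp add: exp_minus field_simps)
  then have "1 / 3 * F G\<^sub>0 \<le> exp (- 1) * F G\<^sub>0"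
    using F_nonneg B by (intro mult_right_mono) auto
  then have "(1 - exp (- 1)) * F B - 2 * L * \<eta> \<le> F G"
    using 1 2 by (simp add: g_def algebra_simps)
  then show ?thesis by (simp add: exp_minus inverse_eq_divide)
qed


text \<open>\<open>V\<close> is the set of elements not yet examined; \<open>B - G \<subseteq> V\<close> says that none of \<open>B\<close> was rejected.\<close>

definition on_track :: "real \<Rightarrow> 'i set \<Rightarrow> 'i set \<Rightarrow> 'i set \<Rightarrow> 'i set \<Rightarrow> bool" where
  "on_track \<eta> B G\<^sub>0 G V \<longleftrightarrow>
     B \<subseteq> W \<and> cost B \<le> L \<and> G\<^sub>0 \<subseteq> B \<and> 3 \<le> card G\<^sub>0 \<and>
     (\<forall>Y\<in>B. \<forall>G. G\<^sub>0 \<subseteq> G \<and> G \<subseteq> W \<and> Y \<notin> G \<longrightarrow>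
        real (card G\<^sub>0) * (F (insert Y G) - F G) \<le> F G\<^sub>0) \<and>
     G\<^sub>0 \<subseteq> G \<and> B - G \<subseteq> V \<and> gap_bound \<eta> B G\<^sub>0 (real (card G) - real (card G\<^sub>0)) G"

lemma on_track_done:
  assumes "on_track \<eta> B G\<^sub>0 G {}" "G \<subseteq> W"
  shows "F B \<le> F G"
  using assms by (intro F_mono) (auto simp: on_track_def)

text \<open>Three outcomes: an accepted \<open>X\<close> shrinks the gap; a rejected
  \<open>X\<close> outside \<open>B\<close> leaves the invariant intact; a rejected
  \<open>X \<in> B\<close> triggers \<open>gap_end\<close>, which bounds the current
  \<open>G\<close> and not \<open>insert X G\<close>.\<close>

lemma on_track_step:
  assumes track: "on_track \<eta> B G\<^sub>0 G V" and G: "G \<subseteq> W" "cost G \<le> L" "X \<in> W" "X \<notin> G"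
    and best: "\<And>Y. Y \<in> V \<Longrightarrow>
      (F (insert Y G) - F G - \<eta>) / real (c Y) \<le> (F (insert X G) - F G + \<eta>) / real (c X)"
    and "0 \<le> \<eta>"
  shows "cost G + real (c X) \<le> L \<Longrightarrow> on_track \<eta> B G\<^sub>0 (insert X G) (V - {X})"
    and "L < cost G + real (c X) \<Longrightarrow>
      on_track \<eta> B G\<^sub>0 G (V - {X}) \<or> (1 - 1 / exp 1) * F B - 2 * L * \<eta> \<le> F G"
proof -
  note t = track[unfolded on_track_def]
  have finG: "finite G" using G(1) fin_W finite_subset by blast
  have card_le: "card G\<^sub>0 \<le> card G" using t finG by (simp add: card_mono)
  have gap: "gap_bound \<eta> B G\<^sub>0 (real (card G) - real (card G\<^sub>0) + 1) (insert X G)"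
    if "real (c X) \<le> L - cost G\<^sub>0"
    using t G that best card_le \<open>0 \<le> \<eta>\<close> by (intro gap_step) auto
  show "on_track \<eta> B G\<^sub>0 (insert X G) (V - {X})" if le: "cost G + real (c X) \<le> L"
  proof -
    have "cost G\<^sub>0 \<le> cost G" using t G by (intro cost_mono) auto
    then have "gap_bound \<eta> B G\<^sub>0 (real (card (insert X G)) - real (card G\<^sub>0)) (insert X G)"
      using gap le finG G by (simp add: algebra_simps)
    then show ?thesis using t unfolding on_track_def by blast
  qed
  show "on_track \<eta> B G\<^sub>0 G (V - {X}) \<or> (1 - 1 / exp 1) * F B - 2 * L * \<eta> \<le> F G"
    if gt: "L < cost G + real (c X)"
  proof (cases "X \<in> B")
    case False
    then have "on_track \<eta> B G\<^sub>0 G (V - {X})" using t unfolding on_track_def by blast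
    then show ?thesis ..
  next
    case True
    \<comment> \<open>\<open>insert X G\<^sub>0\<close> is part of the feasible set
      \<open>B\<close>, so \<open>X\<close> fits beside the prefix although it does not fit beside
      \<open>G\<close>.\<close>
    have "cost (insert X G\<^sub>0) \<le> cost B" by (rule cost_mono) (use t True in auto)
    moreover have "cost (insert X G\<^sub>0) = cost G\<^sub>0 + real (c X)"
      by (rule cost_insert) (use t G in auto)
    ultimately have "real (c X) \<le> L - cost G\<^sub>0" using t by linarith
    then have "gap_bound \<eta> B G\<^sub>0 (real (card G) - real (card G\<^sub>0) + 1) (insert X G)" by (rule gap)
    then have "(1 - 1 / exp 1) * F B - 2 * L * \<eta> \<le> F G"
      using t G True gt \<open>0 \<le> \<eta>\<close> by (intro gap_end) auto
    then show ?thesis ..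
  qed
qed

end

lemma remove_nth:
  assumes "i < length xs"
  shows "length (take i xs @ drop (Suc i) xs) = length xs - 1"
    and "distinct xs \<Longrightarrow> set (take i xs @ drop (Suc i) xs) = set xs - {xs ! i}"
    and "distinct xs \<Longrightarrow> distinct (take i xs @ drop (Suc i) xs)"
    and "set (take i xs @ drop (Suc i) xs) \<subseteq> set xs"
proof -
  note split = id_take_nth_drop[OF assms]
  show "length (take i xs @ drop (Suc i) xs) = length xs - 1" using assms by simp
  show "set (take i xs @ drop (Suc i) xs) \<subseteq> set xs"
    using set_take_subset[of i xs] set_drop_subset[of "Suc i" xs] by auto
  assume d: "distinct xs"
  then have "distinct (take i xs @ xs ! i # drop (Suc i) xs)" using split by simp
  moreover have "set xs = set (take i xs @ xs ! i # drop (Suc i) xs)" using split by simp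
  ultimately show "set (take i xs @ drop (Suc i) xs) = set xs - {xs ! i}"
    "distinct (take i xs @ drop (Suc i) xs)" by auto
qed

locale noisy_greedy = submodular_budget W F c L
  for W :: "'i set" and F c L +
  fixes \<Delta> :: "'i \<Rightarrow> 'i set \<Rightarrow> real timed" and \<eta> \<beta> :: real
    and pick :: "real list \<Rightarrow> nat" and ws :: "'i list"
  assumes \<Delta>_likely: "\<And>X G. G \<subseteq> W \<Longrightarrow> X \<in> W \<Longrightarrow> X \<notin> G \<Longrightarrow>
       likely (\<Delta> X G) \<beta> (\<lambda>x. \<bar>x - (F (insert X G) - F G)\<bar> \<le> \<eta>)"
    and eta: "0 \<le> \<eta>" and beta: "0 \<le> \<beta>" and L_pos: "0 < L"
    and pick: "maximum_rule pick"
    and ws: "distinct ws" "set ws = W" "ws \<noteq> []"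
begin

lemma pick_less: "rs \<noteq> [] \<Longrightarrow> pick rs < length rs"
  using pick by (simp add: maximum_rule_def)

lemma pick_max: "r \<in> set rs \<Longrightarrow> r \<le> rs ! pick rs"
  using pick by (cases "rs = []") (auto simp: maximum_rule_def)

lemma likely_eval_increases:
  assumes "distinct xs" "set xs \<subseteq> W" "set xs \<inter> G = {}" "G \<subseteq> W"
  shows "likely (eval_increases \<Delta> xs G) (real (length xs) * \<beta>)
    (\<lambda>v. \<bar>v - (F (G \<union> set xs) - F G)\<bar> \<le> real (length xs) * \<eta>)"
  using assms
proof (induction xs arbitrary: G)
  case Nil
  then show ?case by (simp add: likely_ret)
next
  case (Cons X xs)
  have IH: "likely (eval_increases \<Delta> xs (insert X G)) (real (length xs) * \<beta>)
    (\<lambda>v. \<bar>v - (F (insert X G \<union> set xs) - F (insert X G))\<bar> \<le> real (length xs) * \<eta>)"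
    by (rule Cons.IH) (use Cons.prems in auto)
  have "likely (eval_increases \<Delta> (X # xs) G) (\<beta> + (real (length xs) * \<beta> + 0))
    (\<lambda>v. \<bar>v - (F (G \<union> set (X # xs)) - F G)\<bar> \<le> real (length (X # xs)) * \<eta>)"
    unfolding eval_increases.simps
  proof (rule likely_bind[OF \<Delta>_likely])
    fix x assume "\<bar>x - (F (insert X G) - F G)\<bar> \<le> \<eta>"
    then show "likely (eval_increases \<Delta> xs (insert X G) \<bind>\<^sub>t (\<lambda>v. tick 2 \<bind>\<^sub>t (\<lambda>_. ret (x + v))))
        (real (length xs) * \<beta> + 0) (\<lambda>v. \<bar>v - (F (G \<union> set (X # xs)) - F G)\<bar> \<le> real (length (X # xs)) * \<eta>)"
      by (intro likely_bind[OF IH] likely_tick_bind likely_ret) (auto simp: algebra_simps)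
  qed (use Cons.prems beta in auto)
  then show ?case by (simp add: algebra_simps)
qed

lemma likely_eval_from_empty:
  assumes "distinct A" "set A \<subseteq> W" "cost (set A) \<le> L"
  shows "likely (eval_increases \<Delta> A {}) (real (length A) * \<beta>) (\<lambda>v. \<bar>v - F (set A)\<bar> \<le> real (card (set A)) * \<eta>)"
  using likely_eval_increases[OF assms(1,2), of "{}"] assms(1) F_empty by (simp add: distinct_card)

lemma card_error:
  assumes "A \<subseteq> W" "cost A \<le> L" "\<bar>v - F A\<bar> \<le> real (card A) * \<eta>"
  shows "\<bar>v - F A\<bar> \<le> L * \<eta>"
proof -
  have "real (card A) * \<eta> \<le> L * \<eta>"
    using card_le_cost[OF assms(1)] assms(2) eta by (intro mult_right_mono) auto
  then show ?thesis using assms(3) by linarith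
qed

text \<open>A value is a sum with one estimate per element, so its error is at most the cardinality
  times \<open>\<eta>\<close>; feasibility converts this into the uniform
  \<open>L * \<eta>\<close>.\<close>

definition estimated :: "'i set \<times> real \<Rightarrow> bool" where
  "estimated Av \<longleftrightarrow> fst Av \<subseteq> W \<and> cost (fst Av) \<le> L \<and> \<bar>snd Av - F (fst Av)\<bar> \<le> L * \<eta>"

text \<open>The chosen estimate is at least the one for the list representing \<open>B\<close>. The
  conclusion keeps the estimate \<open>snd Av\<close>, since the two phases are later compared by
  estimates.\<close>

lemma likely_best_small_set:
  assumes "0 < d"
  shows "likely (best_small_set \<Delta> c L pick d ws) (real (d * length ws ^ d) * (real d * \<beta>))
    (\<lambda>Av. estimated Av \<and> (\<forall>B\<subseteq>W. card B < d \<and> cost B \<le> L \<longrightarrow> F B \<le> snd Av + L * \<eta>))"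
    (is "likely _ _ ?Q")
proof -
  let ?As = "feasible_lists c L ws [0..<d]"
  let ?P = "\<lambda>A v. \<bar>v - F (set A)\<bar> \<le> L * \<eta>"
  have A: "length A < d" "set A \<subseteq> W" "distinct A" "cost (set A) \<le> L" if "A \<in> set ?As" for A
    using feasible_listsD[OF that] ws by auto
  have len: "length ?As \<le> d * length ws ^ d"
    using length_feasible_lists[of "[0..<d]" d ws c L] ws by simp
  have "?As \<noteq> []"
    using feasible_lists_complete[of ws "{}" "[0..<d]" c L] ws L_pos \<open>0 < d\<close> by auto
  have 1: "likely (mapt (\<lambda>A. eval_increases \<Delta> A {}) ?As) (real (length ?As) * (real d * \<beta>)) (list_all2 ?P ?As)"
  proof (rule likely_mapt)
    fix A assume "A \<in> set ?As"
    note A = A[OF this]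
    show "likely (eval_increases \<Delta> A {}) (real d * \<beta>) (?P A)"
    proof (rule likely_weaken[OF likely_eval_from_empty])
      show "real (length A) * \<beta> \<le> real d * \<beta>"
        using A beta by (intro mult_right_mono) auto
    qed (use A card_error in auto)
  qed (use beta in simp)
  have 2: "?Q (set (?As ! pick vs), vs ! pick vs)" if vs: "list_all2 ?P ?As vs" for vs
  proof -
    have "length vs = length ?As" using vs list_all2_lengthD by fastforce
    then have "pick vs < length ?As" using pick_less[of vs] \<open>?As \<noteq> []\<close> by (metis length_0_conv)
    then have est: "estimated (set (?As ! pick vs), vs ! pick vs)"
      using A[OF nth_mem] list_all2_nthD[OF vs] by (simp add: estimated_def)
    moreover have "F B \<le> vs ! pick vs + L * \<eta>" if B: "B \<subseteq> W" "card B < d" "cost B \<le> L" for B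
    proof -
      obtain A where "A \<in> set ?As" "set A = B"
        using feasible_lists_complete[of ws B "[0..<d]" c L] B ws by auto
      then obtain j where j: "j < length ?As" "set (?As ! j) = B"
        by (metis in_set_conv_nth)
      then have "\<bar>vs ! j - F B\<bar> \<le> L * \<eta>" using list_all2_nthD[OF vs, of j] by simp
      moreover have "vs ! j \<le> vs ! pick vs"
        using j \<open>length vs = length ?As\<close> by (intro pick_max) auto
      ultimately show ?thesis by linarith
    qed
    ultimately show ?thesis by auto
  qed
  show ?thesis
    unfolding best_small_set_def
  proof (rule likely_feasible_sublists, rule likely_bind_le[OF 1, where \<beta>' = 0])
    show "likely (tick (real (length vs)) \<bind>\<^sub>t (\<lambda>_. ret (set (?As ! pick vs), vs ! pick vs))) 0 ?Q"
      if "list_all2 ?P ?As vs" for vs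
      by (rule likely_tick_bind, rule likely_ret, rule 2[OF that]) simp
    show "real (length ?As) * (real d * \<beta>) + 0 \<le> real (d * length ws ^ d) * (real d * \<beta>)"
      using len beta by (simp only: add_0_right) (intro mult_right_mono of_nat_mono; simp)
  qed simp
qed

text \<open>Either the target \<open>t\<close> is reached, which monotonicity of \<open>F\<close>
  preserves, or the run is still on track. A free \<open>t\<close> allows the use with
  \<open>t = 0\<close> for starting sets unrelated to \<open>B\<close>. The failure bound counts
  \<open>k\<close> passes with at most \<open>k\<close> queries each.\<close>

lemma likely_greedy_loop:
  assumes "length W' = k" "distinct W'" "set W' \<subseteq> W" "set W' \<inter> G = {}"
    and "G \<subseteq> W" "cost G \<le> L" "\<bar>v - F G\<bar> \<le> real (card G) * \<eta>"
    and "t \<le> F G \<or> t \<le> (1 - 1 / exp 1) * F B - 2 * L * \<eta> \<and> on_track \<eta> B G\<^sub>0 G (set W')"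
  shows "likely (greedy_loop \<Delta> c L pick k W' (G, v)) (real k * real k * \<beta>)
    (\<lambda>Gv. estimated Gv \<and> t \<le> F (fst Gv))"
  using assms
proof (induction k arbitrary: W' G v)
  case 0
  \<comment> \<open>With nothing left to examine, being on track means
    \<open>B \<subseteq> G\<close>.\<close>
  have "t \<le> F G"
  proof (cases "t \<le> F G")
    case False
    then have B: "t \<le> (1 - 1 / exp 1) * F B - 2 * L * \<eta>" "on_track \<eta> B G\<^sub>0 G {}" using 0 by auto
    moreover have "F B \<le> F G" by (rule on_track_done) (use B 0 in auto)
    moreover have "0 \<le> F B" using B by (intro F_nonneg) (simp add: on_track_def)
    moreover have "0 \<le> 1 / exp 1 * F B" "0 \<le> 2 * L * \<eta>" using \<open>0 \<le> F B\<close> eta L_pos by auto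
    ultimately show ?thesis by (simp only: left_diff_distrib mult_1)
  qed
  then show ?case using 0 card_error by (auto intro!: likely_ret simp: estimated_def)
next
  case (Suc k)
  note W' = Suc.prems(1-4) and G = Suc.prems(5-7)
  let ?P = "\<lambda>X x. \<bar>x - (F (insert X G) - F G)\<bar> \<le> \<eta>"
  have 1: "likely (mapt (\<lambda>X. \<Delta> X G) W') (real (length W') * \<beta>) (list_all2 ?P W')"
    by (rule likely_mapt[OF \<Delta>_likely]) (use W' G beta in auto)
  have 2: "likely (let i = pick (map2 (\<lambda>\<delta> X. \<delta> / real (c X)) \<delta>s W'); X = W' ! i;
            Gv' = if real (sum c G + c X) \<le> L then (insert X G, v + \<delta>s ! i) else (G, v)
        in greedy_loop \<Delta> c L pick k (take i W' @ drop (Suc i) W') Gv')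
      (real k * real k * \<beta>) (\<lambda>Gv. estimated Gv \<and> t \<le> F (fst Gv))"
    if \<delta>s: "list_all2 ?P W' \<delta>s" for \<delta>s
  proof -
    let ?rs = "map2 (\<lambda>\<delta> X. \<delta> / real (c X)) \<delta>s W'"
    define i where "i = pick ?rs"
    define X where "X = W' ! i"
    define W'' where "W'' = take i W' @ drop (Suc i) W'"
    have len: "length \<delta>s = length W'" using \<delta>s list_all2_lengthD by fastforce
    have i: "i < length W'" using pick_less[of ?rs] len W'(1) by (force simp: i_def)
    then have "X \<in> set W'" by (simp add: X_def)
    then have X: "X \<in> W" "X \<notin> G" using W' by blast+
    have W'': "length W'' = k" "set W'' = set W' - {X}" "distinct W''"
      using remove_nth[OF i] W' by (simp_all add: W''_def X_def)
    have \<delta>X: "?P X (\<delta>s ! i)" using list_all2_nthD[OF \<delta>s i] by (simp add: X_def)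
    \<comment> \<open>True and estimated increments differ by at most \<open>\<eta>\<close> at both
      \<open>Y\<close> and \<open>X\<close>; between the two estimated ratios \<open>pick\<close>
      decides.\<close>
    have best: "(F (insert Y G) - F G - \<eta>) / real (c Y) \<le> (F (insert X G) - F G + \<eta>) / real (c X)"
      if "Y \<in> set W'" for Y
    proof -
      obtain j where j: "j < length W'" "Y = W' ! j"
        using \<open>Y \<in> set W'\<close> by (metis in_set_conv_nth)
      have "?P Y (\<delta>s ! j)" using list_all2_nthD[OF \<delta>s j(1)] j by simp
      then have "(F (insert Y G) - F G - \<eta>) / real (c Y) \<le> \<delta>s ! j / real (c Y)"
        by (intro divide_right_mono) auto
      also have "\<dots> = ?rs ! j" using j len by simp
      also have "\<dots> \<le> ?rs ! i"
        unfolding i_def by (rule pick_max, rule nth_mem) (use j len in simp)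
      also have "\<dots> = \<delta>s ! i / real (c X)" using i len by (simp add: X_def)
      also have "\<dots> \<le> (F (insert X G) - F G + \<eta>) / real (c X)"
        using \<delta>X by (intro divide_right_mono) auto
      finally show ?thesis .
    qed
    have finG: "finite G" using G(1) fin_W finite_subset by blast
    have "likely (greedy_loop \<Delta> c L pick k W''
        (if cost G + real (c X) \<le> L then (insert X G, v + \<delta>s ! i) else (G, v)))
      (real k * real k * \<beta>) (\<lambda>Gv. estimated Gv \<and> t \<le> F (fst Gv))"
    proof (cases "cost G + real (c X) \<le> L")
      case True
      have "t \<le> F (insert X G) \<or>
        t \<le> (1 - 1 / exp 1) * F B - 2 * L * \<eta> \<and> on_track \<eta> B G\<^sub>0 (insert X G) (set W'')"
        using Suc.prems(8) F_insert_mono[OF G(1) X(1)]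
          on_track_step(1)[OF _ G(1,2) X best eta True, of B G\<^sub>0 "set W'", folded W''(2)]
        by (meson order_trans)
      moreover have "\<bar>v + \<delta>s ! i - F (insert X G)\<bar> \<le> real (card (insert X G)) * \<eta>"
        using G(3) \<delta>X finG X by (simp add: algebra_simps)
      moreover have "cost (insert X G) \<le> L" using True cost_insert[OF G(1) X(2)] by simp
      ultimately show ?thesis
        using True W'' W' G(1) X by (simp only: if_True, intro Suc.IH) auto
    next
      case False
      then have "t \<le> F G \<or>
        t \<le> (1 - 1 / exp 1) * F B - 2 * L * \<eta> \<and> on_track \<eta> B G\<^sub>0 G (set W'')"
        using Suc.prems(8) on_track_step(2)[OF _ G(1,2) X best eta, of B G\<^sub>0 "set W'", folded W''(2)]
        by (meson not_le order_trans)
      then show ?thesis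
        using False W'' W' G by (simp only: if_False, intro Suc.IH) auto
    qed
    then show ?thesis unfolding Let_def i_def X_def W''_def of_nat_add .
  qed
  show ?case
    unfolding greedy_loop.simps Let_def[of "(G, v)"] prod.case
  proof (rule likely_bind_le[OF 1])
    show "real (length W') * \<beta> + real k * real k * \<beta> \<le> real (Suc k) * real (Suc k) * \<beta>"
      using W'(1) beta by (simp add: algebra_simps)
  qed (use 2 beta in \<open>auto intro: likely_tick_bind\<close>)
qed

lemma likely_greedy_from:
  assumes "distinct A" "set A \<subseteq> W" "cost (set A) \<le> L"
    and "t \<le> F (set A) \<or>
      t \<le> (1 - 1 / exp 1) * F B - 2 * L * \<eta> \<and> on_track \<eta> B (set A) (set A) (W - set A)"
  shows "likely (greedy_from \<Delta> c L pick ws A) (real (length A + length ws * length ws) * \<beta>)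
    (\<lambda>Gv. estimated Gv \<and> t \<le> F (fst Gv))"
proof -
  let ?W' = "filter (\<lambda>X. X \<notin> set A) ws"
  have len: "real (length ?W') \<le> real (length ws)" by simp
  show ?thesis
    unfolding greedy_from_def Let_def
  proof (rule likely_tick_bind, rule likely_bind_le[OF likely_eval_from_empty[OF assms(1-3)],
        where \<beta>' = "real (length ?W') * real (length ?W') * \<beta>"])
    fix v assume v: "\<bar>v - F (set A)\<bar> \<le> real (card (set A)) * \<eta>"
    have "set ?W' = W - set A" using ws by auto
    then show "likely (greedy_loop \<Delta> c L pick (length ?W') ?W' (set A, v))
       (real (length ?W') * real (length ?W') * \<beta>) (\<lambda>Gv. estimated Gv \<and> t \<le> F (fst Gv))"
      using ws v assms by (intro likely_greedy_loop[where B = B and G\<^sub>0 = "set A"]) auto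
  next
    have "real (length ?W') * real (length ?W') * \<beta> \<le> real (length ws) * real (length ws) * \<beta>"
      using len beta by (intro mult_right_mono mult_mono) auto
    then show "real (length A) * \<beta> + real (length ?W') * real (length ?W') * \<beta>
        \<le> real (length A + length ws * length ws) * \<beta>"
      by (simp add: algebra_simps)
  qed (use beta in simp)
qed

text \<open>Error account: \<open>2 * L * \<eta>\<close> from the greedy run,
  \<open>L * \<eta>\<close> in its estimated value, \<open>L * \<eta>\<close> when the larger
  estimate is turned back into \<open>F\<close>. Failure account, with \<open>n = length ws\<close>:
  at most \<open>d * n ^ d\<close> small sets with at most \<open>d\<close> queries each, and at
  most \<open>n ^ d\<close> runs with at most \<open>d + n * n\<close> queries each.\<close>

lemma likely_partial_enumeration_greedy:
  assumes d: "3 \<le> d" and B: "B \<subseteq> W" "cost B \<le> L"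
  shows "likely (partial_enumeration_greedy \<Delta> c L pick d ws)
    (real (d * length ws ^ d) * (real d * \<beta>) +
      real (length ws ^ d) * (real (d + length ws * length ws) * \<beta>))
    (\<lambda>A. (1 - 1 / exp 1) * F B - 4 * L * \<eta> \<le> F A)"
proof -
  let ?Gs = "feasible_lists c L ws [d]"
  let ?t = "(1 - 1 / exp 1) * F B - 2 * L * \<eta>"
  let ?step = "\<lambda>G (A\<^sub>2, v\<^sub>2). greedy_from \<Delta> c L pick ws G \<bind>\<^sub>t (\<lambda>(G', v).
          tick 2 \<bind>\<^sub>t (\<lambda>_. ret (if v > v\<^sub>2 then (G', v) else (A\<^sub>2, v\<^sub>2))))"
  let ?R = "\<lambda>Av. ?t - L * \<eta> \<le> snd Av"
  let ?b = "real (d + length ws * length ws) * \<beta>"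
  have A: "length A = d" "set A \<subseteq> W" "distinct A" "cost (set A) \<le> L" if "A \<in> set ?Gs" for A
    using feasible_listsD[OF that] ws by auto
  have len: "length ?Gs \<le> length ws ^ d"
    using length_feasible_lists[of "[d]" d ws c L] ws by simp
  \<comment> \<open>Used with \<open>t = 0\<close> for arbitrary starting sets, where the point is
    that the recorded value never drops, and with \<open>t = ?t\<close> for the prefix of
    \<open>B\<close>.\<close>
  have step: "likely (?step G s) ?b (\<lambda>s'. estimated s' \<and> snd s \<le> snd s' \<and> t - L * \<eta> \<le> snd s')"
    if G: "G \<in> set ?Gs" and s: "estimated s" and t: "t \<le> 0 \<or>
      t \<le> ?t \<and> on_track \<eta> B (set G) (set G) (W - set G)" for G s t
  proof -
    have t': "t \<le> F (set G) \<or> t \<le> ?t \<and> on_track \<eta> B (set G) (set G) (W - set G)"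
      using t F_nonneg[OF A(2)[OF G]] by linarith
    have lk: "likely (greedy_from \<Delta> c L pick ws G) ?b (\<lambda>Gv. estimated Gv \<and> t \<le> F (fst Gv))"
      using likely_greedy_from[OF A(3,2,4)[OF G] t'] A(1)[OF G] by simp
    show ?thesis
      unfolding case_prod_unfold
      by (rule likely_bind_le[OF lk, where \<beta>' = 0], rule likely_tick_bind, rule likely_ret)
        (use s in \<open>auto simp: estimated_def\<close>)
  qed
  have est0: "estimated ({}, 0)" using F_empty L_pos eta by (simp add: estimated_def)
  obtain G\<^sub>0 where G0: "d \<le> card B \<Longrightarrow> G\<^sub>0 \<in> set ?Gs \<and> on_track \<eta> B (set G\<^sub>0) (set G\<^sub>0) (W - set G\<^sub>0)"
  proof (cases "d \<le> card B")
    case True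
    obtain G where G: "G \<subseteq> B" "card G = d" and pre:
      "\<forall>Y\<in>B. \<forall>G'. G \<subseteq> G' \<and> G' \<subseteq> W \<and> Y \<notin> G' \<longrightarrow> real d * (F (insert Y G') - F G') \<le> F G"
      using greedy_prefix[OF B(1) True] by metis
    have "cost G \<le> cost B" by (rule cost_mono) (use G B in auto)
    then obtain G\<^sub>0 where "G\<^sub>0 \<in> set ?Gs" "set G\<^sub>0 = G"
      using feasible_lists_complete[of ws G "[d]" c L] G B ws by auto
    \<comment> \<open>At the start both the exponent and the count are 0, which leaves the slack
      \<open>L * \<eta>\<close>.\<close>
    moreover have "gap_bound \<eta> B G 0 G" using L_pos eta by (simp add: gap_bound_def)
    then have "on_track \<eta> B G G (W - G)"
      using G pre B d by (auto simp: on_track_def)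
    ultimately show ?thesis using that by metis
  qed (use that in blast)
  have fold: "likely (foldt ?step ?Gs ({}, 0)) (real (length ?Gs) * ?b)
    (\<lambda>s. estimated s \<and> (d \<le> card B \<longrightarrow> ?R s))"
  proof (cases "d \<le> card B")
    case True
    have "likely (foldt ?step ?Gs ({}, 0)) (real (length ?Gs) * ?b)
      (\<lambda>s. estimated s \<and> (G\<^sub>0 \<in> set ?Gs \<longrightarrow> ?R s))"
    proof (rule likely_foldt)
      show "likely (?step G s) ?b estimated" if "G \<in> set ?Gs" "estimated s" for G s
        by (rule likely_weaken[OF step[OF that, of 0]]) auto
      show "likely (?step G\<^sub>0 s) ?b (\<lambda>s'. estimated s' \<and> ?R s')" if "G\<^sub>0 \<in> set ?Gs" "estimated s" for s
        by (rule likely_weaken[OF step[OF that, of ?t]]) (use G0 True in auto)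
      show "likely (?step G s) ?b (\<lambda>s'. estimated s' \<and> ?R s')"
        if "G \<in> set ?Gs" "estimated s" "?R s" for G s
        by (rule likely_weaken[OF step[OF that(1,2), of 0]]) (use that in auto)
    qed (use est0 beta in auto)
    then show ?thesis using G0 True by simp
  next
    \<comment> \<open>For a small \<open>B\<close> the second phase only has to return a correctly
      estimated set, so the tracked property is the invariant itself.\<close>
    case False
    have "likely (foldt ?step ?Gs ({}, 0)) (real (length ?Gs) * ?b)
      (\<lambda>s. estimated s \<and> (G\<^sub>0 \<in> set ?Gs \<longrightarrow> estimated s))"
    proof (rule likely_foldt)
      show "likely (?step G s) ?b estimated" if "G \<in> set ?Gs" "estimated s" for G s
        by (rule likely_weaken[OF step[OF that, of 0]]) auto
      show "likely (?step G\<^sub>0 s) ?b (\<lambda>s. estimated s \<and> estimated s)" if "G\<^sub>0 \<in> set ?Gs" "estimated s" for s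
        by (rule likely_weaken[OF step[OF that, of 0]]) auto
      show "likely (?step G s) ?b (\<lambda>s. estimated s \<and> estimated s)" if "G \<in> set ?Gs" "estimated s" for G s
        by (rule likely_weaken[OF step[OF that, of 0]]) auto
    qed (use est0 beta in auto)
    then show ?thesis by (rule likely_weaken) (use False in auto)
  qed
  have final: "(1 - 1 / exp 1) * F B - 4 * L * \<eta> \<le> F (if pick [v\<^sub>1, v\<^sub>2] = 0 then A\<^sub>1 else A\<^sub>2)"
    if 1: "estimated (A\<^sub>1, v\<^sub>1)" "\<forall>B\<subseteq>W. card B < d \<and> cost B \<le> L \<longrightarrow> F B \<le> v\<^sub>1 + L * \<eta>"
      and 2: "estimated (A\<^sub>2, v\<^sub>2)" "d \<le> card B \<longrightarrow> ?t - L * \<eta> \<le> v\<^sub>2" for A\<^sub>1 v\<^sub>1 A\<^sub>2 v\<^sub>2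
  proof -
    have "L * \<eta> \<ge> 0" using L_pos eta by simp
    have "?t - L * \<eta> \<le> v\<^sub>1 \<or> ?t - L * \<eta> \<le> v\<^sub>2"
    proof (cases "d \<le> card B")
      case False
      then have "F B \<le> v\<^sub>1 + L * \<eta>" using 1(2) B by simp
      moreover have "(1 - 1 / exp 1) * F B \<le> 1 * F B"
        using F_nonneg[OF B(1)] by (intro mult_right_mono) auto
      moreover have "2 * L * \<eta> = 2 * (L * \<eta>)" by simp
      ultimately show ?thesis using \<open>L * \<eta> \<ge> 0\<close> by linarith
    qed (use 2(2) in simp)
    moreover have "v\<^sub>1 \<le> [v\<^sub>1, v\<^sub>2] ! pick [v\<^sub>1, v\<^sub>2]" "v\<^sub>2 \<le> [v\<^sub>1, v\<^sub>2] ! pick [v\<^sub>1, v\<^sub>2]"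
      by (rule pick_max; simp)+
    moreover have "pick [v\<^sub>1, v\<^sub>2] < 2" using pick_less[of "[v\<^sub>1, v\<^sub>2]"] by simp
    ultimately show ?thesis
      using 1(1) 2(1) by (auto simp: estimated_def less_2_cases_iff)
  qed
  show ?thesis
    unfolding partial_enumeration_greedy_def
  proof (rule likely_bind[OF likely_best_small_set])
    fix Av assume Av: "estimated Av \<and> (\<forall>B\<subseteq>W. card B < d \<and> cost B \<le> L \<longrightarrow> F B \<le> snd Av + L * \<eta>)"
    obtain A\<^sub>1 v\<^sub>1 where [simp]: "Av = (A\<^sub>1, v\<^sub>1)" by (cases Av)
    show "likely (case Av of (A\<^sub>1, v\<^sub>1) \<Rightarrow> feasible_sublists c L ws [d] \<bind>\<^sub>t (\<lambda>Gs. foldt ?step Gs ({}, 0) \<bind>\<^sub>t (\<lambda>(A\<^sub>2, v\<^sub>2).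
       tick 1 \<bind>\<^sub>t (\<lambda>_. ret (if pick [v\<^sub>1, v\<^sub>2] = 0 then A\<^sub>1 else A\<^sub>2)))))
      (real (length ws ^ d) * ?b) (\<lambda>A. (1 - 1 / exp 1) * F B - 4 * L * \<eta> \<le> F A)"
      unfolding \<open>Av = _\<close> prod.case
    proof (rule likely_feasible_sublists, rule likely_bind_le[OF fold, where \<beta>' = 0])
      fix s assume s: "estimated s \<and> (d \<le> card B \<longrightarrow> ?R s)"
      obtain A\<^sub>2 v\<^sub>2 where s_eq: "s = (A\<^sub>2, v\<^sub>2)" by (cases s)
      show "likely (case s of (A\<^sub>2, v\<^sub>2) \<Rightarrow> tick 1 \<bind>\<^sub>t (\<lambda>_. ret (if pick [v\<^sub>1, v\<^sub>2] = 0 then A\<^sub>1 else A\<^sub>2))) 0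
        (\<lambda>A. (1 - 1 / exp 1) * F B - 4 * L * \<eta> \<le> F A)"
        unfolding s_eq prod.case
        by (intro likely_tick_bind likely_ret final order_refl) (use Av s s_eq in simp_all)
    next
      show "real (length ?Gs) * ?b + 0 \<le> real (length ws ^ d) * ?b"
        using len beta by (simp only: add_0_right) (intro mult_right_mono of_nat_mono; simp)
    qed simp
  qed (use d beta in auto)
qed

end


section \<open>Running time\<close>

locale timed_greedy =
  fixes \<Delta> :: "'i \<Rightarrow> 'i set \<Rightarrow> real timed" and T :: real
    and c :: "'i \<Rightarrow> nat" and L :: real and pick :: "real list \<Rightarrow> nat" and ws :: "'i list"
  assumes \<Delta>_surely: "\<And>X G. surely (\<Delta> X G) T (\<lambda>_. True)"
    and T: "1 \<le> T" and L_nonneg: "0 \<le> L" and pick_rule: "maximum_rule pick"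
    and ws_distinct: "distinct ws" and ws_ne: "ws \<noteq> []"
begin

abbreviation feasible :: "'i set \<times> real \<Rightarrow> bool" where
  "feasible Av \<equiv> fst Av \<subseteq> set ws \<and> real (sum c (fst Av)) \<le> L"

lemma pick_less: "rs \<noteq> [] \<Longrightarrow> pick rs < length rs"
  using pick_rule by (simp add: maximum_rule_def)

lemma surely_eval_increases:
  "surely (eval_increases \<Delta> xs G) (real (length xs) * (T + 2)) (\<lambda>_. True)"
proof (induction xs arbitrary: G)
  case Nil
  show ?case by (simp add: surely_ret)
next
  case (Cons X xs)
  have "surely (eval_increases \<Delta> (X # xs) G) (T + (real (length xs) * (T + 2) + 2)) (\<lambda>_. True)"
    unfolding eval_increases.simps
    by (intro surely_bind[OF \<Delta>_surely] surely_bind[OF Cons] surely_tick_ret) auto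
  then show ?case by (simp add: algebra_simps)
qed

lemma surely_best_small_set:
  assumes "0 < d"
  shows "surely (best_small_set \<Delta> c L pick d ws)
    (real (d * length ws ^ d * (length ws + d + 1)) + (real (d * length ws ^ d) * (real d * (T + 2)) + real (d * length ws ^ d)))
    feasible"
proof -
  let ?As = "feasible_lists c L ws [0..<d]"
  have len: "length ?As \<le> d * length ws ^ d"
    using length_feasible_lists[of "[0..<d]" d ws c L] ws_ne by simp
  have ne: "?As \<noteq> []"
    using feasible_lists_complete[of ws "{}" "[0..<d]" c L] ws_distinct L_nonneg \<open>0 < d\<close> by auto
  have 1: "surely (mapt (\<lambda>A. eval_increases \<Delta> A {}) ?As) (real (length ?As) * (real d * (T + 2)))
      (\<lambda>vs. length vs = length ?As)"
  proof (rule surely_mapt, rule surely_weaken[OF surely_eval_increases])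
    fix A assume "A \<in> set ?As"
    then have "length A < d" using feasible_listsD(1) by fastforce
    then show "real (length A) * (T + 2) \<le> real d * (T + 2)"
      using T by (intro mult_right_mono) auto
  qed simp
  have 2: "surely (mapt (\<lambda>A. eval_increases \<Delta> A {}) As \<bind>\<^sub>t (\<lambda>vs.
      tick (real (length vs)) \<bind>\<^sub>t (\<lambda>_. ret (set (As ! pick vs), vs ! pick vs))))
     (real (d * length ws ^ d) * (real d * (T + 2)) + real (d * length ws ^ d)) feasible" if As: "As = ?As" for As
    unfolding As
  proof (rule surely_bind_le[OF 1])
    fix vs :: "real list" assume vs: "length vs = length ?As"
    then have "pick vs < length ?As" using pick_less[of vs] ne by (metis length_0_conv)
    then have "feasible (set (?As ! pick vs), vs ! pick vs)"
      using feasible_listsD[OF nth_mem] by fastforce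
    then show "surely (tick (real (length vs)) \<bind>\<^sub>t (\<lambda>_. ret (set (?As ! pick vs), vs ! pick vs)))
        (real (length ?As)) feasible"
      using vs by (intro surely_tick_ret) auto
  next
    have "real (length ?As) \<le> real (d * length ws ^ d)" using len by (rule of_nat_mono)
    moreover from this have "real (length ?As) * (real d * (T + 2)) \<le> real (d * length ws ^ d) * (real d * (T + 2))"
      using T by (intro mult_right_mono) auto
    ultimately show "real (length ?As) * (real d * (T + 2)) + real (length ?As)
      \<le> real (d * length ws ^ d) * (real d * (T + 2)) + real (d * length ws ^ d)" by linarith
  qed
  have "surely (feasible_sublists c L ws [0..<d]) (real (d * length ws ^ d * (length ws + d + 1))) (\<lambda>As. As = ?As)"
    using surely_feasible_sublists[of "[0..<d]" d ws c L] ws_ne by simp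
  then show ?thesis
    unfolding best_small_set_def by (rule surely_bind) (rule 2)
qed

text \<open>The invariant also serves the time bound: it gives
  \<open>card G \<le> length ws\<close>, so that \<open>3 * length W' + card G + 4\<close> is at
  most \<open>4 * length ws + 4\<close>.\<close>

lemma surely_greedy_loop:
  assumes "length W' = k" "k \<le> length ws" "set W' \<subseteq> set ws" "feasible Gv"
  shows "surely (greedy_loop \<Delta> c L pick k W' Gv)
    (real k * (real (length ws) * T + real (4 * length ws + 4))) feasible"
  using assms
proof (induction k arbitrary: W' Gv)
  case 0
  then show ?case by (simp add: surely_ret)
next
  case (Suc k)
  obtain G v where Gv: "Gv = (G, v)" by (cases Gv)
  let ?n = "length ws"
  have G: "G \<subseteq> set ws" "real (sum c G) \<le> L" using Suc.prems Gv by auto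
  have "card G \<le> ?n" using G(1) ws_distinct by (metis card_mono distinct_card List.finite_set)
  have 1: "surely (mapt (\<lambda>X. \<Delta> X G) W') (real (length W') * T) (\<lambda>\<delta>s. length \<delta>s = length W')"
    by (rule surely_mapt[OF \<Delta>_surely])
  have 2: "surely (let i = pick (map2 (\<lambda>\<delta> X. \<delta> / real (c X)) \<delta>s W'); X = W' ! i;
            Gv' = if real (sum c G + c X) \<le> L then (insert X G, v + \<delta>s ! i) else (G, v)
        in greedy_loop \<Delta> c L pick k (take i W' @ drop (Suc i) W') Gv')
      (real k * (real ?n * T + real (4 * ?n + 4))) feasible"
    if len: "length \<delta>s = length W'" for \<delta>s
  proof -
    define i where "i = pick (map2 (\<lambda>\<delta> X. \<delta> / real (c X)) \<delta>s W')"
    have "map2 (\<lambda>\<delta> X. \<delta> / real (c X)) \<delta>s W' \<noteq> []" using len Suc.prems(1) by auto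
    then have i: "i < length W'"
      using pick_less[of "map2 (\<lambda>\<delta> X. \<delta> / real (c X)) \<delta>s W'"] len by (simp add: i_def)
    have X: "W' ! i \<in> set ws" using i Suc.prems(3) by auto
    \<comment> \<open>Only an inequality, since disjointness of \<open>W'\<close> and
      \<open>G\<close> is not tracked here.\<close>
    have "real (sum c (insert (W' ! i) G)) \<le> real (sum c G + c (W' ! i))"
      using G(1) by (cases "W' ! i \<in> G") (auto simp: insert_absorb dest: finite_subset)
    then have "feasible (if real (sum c G + c (W' ! i)) \<le> L then (insert (W' ! i) G, v + \<delta>s ! i) else (G, v))"
      using G X by auto
    then have "surely (greedy_loop \<Delta> c L pick k (take i W' @ drop (Suc i) W')
        (if real (sum c G + c (W' ! i)) \<le> L then (insert (W' ! i) G, v + \<delta>s ! i) else (G, v)))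
      (real k * (real ?n * T + real (4 * ?n + 4))) feasible"
      using remove_nth(1,4)[OF i] Suc.prems by (intro Suc.IH) auto
    then show ?thesis unfolding Let_def i_def .
  qed
  show ?case
    unfolding greedy_loop.simps Gv Let_def[of "(G, v)"] prod.case
  proof (rule surely_bind_le[OF 1], rule surely_tick_bind[OF 2 order_refl])
    have "real (length W') * T \<le> real ?n * T" using Suc.prems T by (intro mult_right_mono) auto
    moreover have "real (3 * length W' + card G + 4) \<le> real (4 * ?n + 4)"
      using Suc.prems \<open>card G \<le> ?n\<close> by (intro of_nat_mono) auto
    ultimately show "real (length W') * T + (real (3 * length W' + card G + 4) +
        real k * (real ?n * T + real (4 * ?n + 4)))
      \<le> real (Suc k) * (real ?n * T + real (4 * ?n + 4))"
      by (simp add: distrib_right)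
  qed
qed

lemma surely_greedy_from:
  assumes "length A = d" "set A \<subseteq> set ws" "real (sum c (set A)) \<le> L"
  shows "surely (greedy_from \<Delta> c L pick ws A)
    (real (length ws * d + 1) + (real d * (T + 2) + real (length ws) * (real (length ws) * T + real (4 * length ws + 4))))
    feasible"
proof -
  let ?W' = "filter (\<lambda>X. X \<notin> set A) ws" and ?n = "length ws"
  show ?thesis
    unfolding greedy_from_def Let_def
  proof (rule surely_tick_bind, rule surely_bind_le[OF surely_eval_increases])
    show "surely (greedy_loop \<Delta> c L pick (length ?W') ?W' (set A, v))
      (real ?n * (real ?n * T + real (4 * ?n + 4))) feasible" for v
    proof (rule surely_weaken[OF surely_greedy_loop])
      have "real (length ?W') \<le> real ?n" by simp
      then show "real (length ?W') * (real ?n * T + real (4 * ?n + 4)) \<le> real ?n * (real ?n * T + real (4 * ?n + 4))"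
        using T by (intro mult_right_mono) auto
    qed (use assms in auto)
  qed (use assms in auto)
qed

text \<open>With \<open>n = length ws\<close>, every term is a multiple of 1 or of
  \<open>n ^ d\<close> times one of 1, \<open>n\<close>, \<open>n * n\<close>, \<open>T\<close>,
  \<open>T * (n * n)\<close>, hence of something at most \<open>M\<close>; the last stands for
  \<open>n\<close> passes over \<open>n\<close> candidates for each starting set. The constant is
  the sum of the coefficients in \<open>e1\<close> to \<open>e5\<close>, plus 1 for the final
  tick.\<close>

lemma surely_partial_enumeration_greedy:
  assumes "0 < d"
  shows "surely (partial_enumeration_greedy \<Delta> c L pick d ws)
    (real (4 * d\<^sup>2 + 8 * d + 15) * (T * real (length ws) ^ (d + 2)))
    (\<lambda>A. A \<subseteq> set ws \<and> real (sum c A) \<le> L)"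
proof -
  let ?n = "length ws"
  let ?Gs = "feasible_lists c L ws [d]"
  let ?t = "real (?n * d + 1) + (real d * (T + 2) + real ?n * (real ?n * T + real (4 * ?n + 4)))"
  let ?step = "\<lambda>G (A\<^sub>2, v\<^sub>2). greedy_from \<Delta> c L pick ws G \<bind>\<^sub>t (\<lambda>(G', v).
          tick 2 \<bind>\<^sub>t (\<lambda>_. ret (if v > v\<^sub>2 then (G', v) else (A\<^sub>2, v\<^sub>2))))"
  define M where "M = T * real ?n ^ (d + 2)"
  have n: "1 \<le> real ?n" using ws_ne by (simp add: Suc_le_eq)
  have len: "length ?Gs \<le> ?n ^ d"
    using length_feasible_lists[of "[d]" d ws c L] ws_ne by simp
  have step: "surely (?step G s) (?t + 2) feasible" if G: "G \<in> set ?Gs" and s: "feasible s" for G s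
  proof -
    have "surely (greedy_from \<Delta> c L pick ws G) ?t feasible"
      by (rule surely_greedy_from) (use feasible_listsD[OF G] in auto)
    then show ?thesis
      unfolding case_prod_unfold
      by (rule surely_bind, intro surely_tick_ret) (use s in auto)
  qed
  have fold: "surely (foldt ?step ?Gs ({}, 0)) (real (?n ^ d) * (?t + 2)) feasible"
  proof (rule surely_weaken)
    show "surely (foldt ?step ?Gs ({}, 0)) (real (length ?Gs) * (?t + 2)) feasible"
      by (rule surely_foldt[OF step]) (use L_nonneg in auto)
    show "real (length ?Gs) * (?t + 2) \<le> real (?n ^ d) * (?t + 2)"
      using T len by (intro mult_right_mono of_nat_mono) auto
  qed
  have rest: "surely (feasible_sublists c L ws [d] \<bind>\<^sub>t (\<lambda>Gs. foldt ?step Gs ({}, 0) \<bind>\<^sub>t (\<lambda>(A\<^sub>2, v\<^sub>2).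
       tick 1 \<bind>\<^sub>t (\<lambda>_. ret (if pick [v\<^sub>1, v\<^sub>2] = 0 then A\<^sub>1 else A\<^sub>2)))))
     (real (?n ^ d * (?n + d + 1)) + (real (?n ^ d) * (?t + 2) + 1))
     (\<lambda>A. A \<subseteq> set ws \<and> real (sum c A) \<le> L)" if "feasible (A\<^sub>1, v\<^sub>1)" for A\<^sub>1 v\<^sub>1
  proof (rule surely_bind)
    show "surely (feasible_sublists c L ws [d]) (real (?n ^ d * (?n + d + 1))) (\<lambda>Gs. Gs = ?Gs)"
      using surely_feasible_sublists[of "[d]" d ws c L] ws_ne by simp
    show "surely (foldt ?step Gs ({}, 0) \<bind>\<^sub>t (\<lambda>(A\<^sub>2, v\<^sub>2). tick 1 \<bind>\<^sub>t (\<lambda>_. ret (if pick [v\<^sub>1, v\<^sub>2] = 0 then A\<^sub>1 else A\<^sub>2))))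
      (real (?n ^ d) * (?t + 2) + 1) (\<lambda>A. A \<subseteq> set ws \<and> real (sum c A) \<le> L)" if "Gs = ?Gs" for Gs
      unfolding that
    proof (rule surely_bind[OF fold])
      fix s assume "feasible s"
      then show "surely (case s of (A\<^sub>2, v\<^sub>2) \<Rightarrow> tick 1 \<bind>\<^sub>t (\<lambda>_. ret (if pick [v\<^sub>1, v\<^sub>2] = 0 then A\<^sub>1 else A\<^sub>2))) 1
        (\<lambda>A. A \<subseteq> set ws \<and> real (sum c A) \<le> L)"
        unfolding case_prod_unfold using \<open>feasible (A\<^sub>1, v\<^sub>1)\<close>
        by (intro surely_tick_ret) auto
    qed
  qed
  have le: "real a * x \<le> real b * M" if "a \<le> b" "x \<le> M" "0 \<le> x" for a b x
    using that by (intro mult_mono) auto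
  have pow: "real ?n ^ d * y \<le> M" if "0 \<le> y" "y \<le> T * (real ?n * real ?n)" for y
  proof -
    have "real ?n ^ d * y \<le> real ?n ^ d * (T * (real ?n * real ?n))"
      using that by (intro mult_left_mono) auto
    then show ?thesis by (simp add: M_def power_add power2_eq_square ac_simps)
  qed
  have nn: "real ?n \<le> real ?n * real ?n" "1 \<le> real ?n * real ?n"
    using n mult_left_mono[OF n, of "real ?n"] by auto
  have Tn: "real ?n * real ?n \<le> T * (real ?n * real ?n)" "T \<le> T * (real ?n * real ?n)"
    using T nn mult_right_mono[OF T, of "real ?n * real ?n"] mult_left_mono[OF nn(2), of T] by auto
  have p1: "real ?n ^ d \<le> M" using pow[of 1] Tn nn by simp
  have pn: "real ?n ^ d * real ?n \<le> M" using pow[of "real ?n"] Tn nn by simp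
  have pnn: "real ?n ^ d * (real ?n * real ?n) \<le> M" using pow[of "real ?n * real ?n"] Tn nn by simp
  have pT: "real ?n ^ d * T \<le> M" using pow[of T] Tn T by simp
  have pT2: "real ?n ^ d * (T * (real ?n * real ?n)) = M"
    by (simp add: M_def power_add power2_eq_square ac_simps)
  have "real ?n ^ d \<ge> 1" using n by simp
  then have M1: "1 \<le> M" using p1 by linarith
  have mono: "real k * z \<le> real k * M" if "z \<le> M" for k z using that by (intro mult_left_mono) auto
  have e1: "real (d * ?n ^ d * (?n + d + 1)) \<le> real (d * (d + 2)) * M"
    using mono[OF pn, of d] mono[OF p1, of "d * (d + 1)"] by (simp add: algebra_simps)
  have e2: "real (d * ?n ^ d) * (real d * (T + 2)) \<le> real (3 * d * d) * M"
    using mono[OF pT, of "d * d"] mono[OF p1, of "2 * d * d"] by (simp add: algebra_simps)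
  have e3: "real (d * ?n ^ d) \<le> real d * M"
    using mono[OF p1, of d] by simp
  have e4: "real (?n ^ d * (?n + d + 1)) \<le> real (d + 2) * M"
    using pn mono[OF p1, of "d + 1"] by (simp add: algebra_simps)
  have e5: "real (?n ^ d) * (?t + 2) \<le> real (4 * d + 12) * M"
    using mono[OF pn, of "d + 4"] mono[OF p1, of "2 * d + 3"] mono[OF pT, of d] mono[OF pnn, of 4] pT2
    by (simp add: algebra_simps)
  have "real (4 * d\<^sup>2 + 8 * d + 15) * M = real (d * (d + 2)) * M + (real (3 * d * d) * M + real d * M)
      + (real (d + 2) * M + (real (4 * d + 12) * M + M))"
    by (simp add: algebra_simps power2_eq_square)
  then have total: "(real (d * ?n ^ d * (?n + d + 1)) + (real (d * ?n ^ d) * (real d * (T + 2)) + real (d * ?n ^ d)))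
      + (real (?n ^ d * (?n + d + 1)) + (real (?n ^ d) * (?t + 2) + 1)) \<le> real (4 * d\<^sup>2 + 8 * d + 15) * M"
    using e1 e2 e3 e4 e5 M1 by linarith
  show ?thesis
    unfolding partial_enumeration_greedy_def M_def[symmetric]
    by (rule surely_bind_le[OF surely_best_small_set[OF assms] _ total]) (use rest in auto)
qed

end

section \<open>A single variable\<close>

lemma sublists_of_length_beyond: "length xs < k \<Longrightarrow> sublists_of_length k xs = []"
  by (induction k xs rule: sublists_of_length.induct) auto

lemma feasible_lists_singleton:
  assumes "real (c X) \<le> L" "2 \<le> d"
  shows "feasible_lists c L [X] [0..<d] = [[], [X]]" "feasible_lists c L [X] [d] = []"
proof -
  have "0 \<le> L" using assms(1) by (meson of_nat_0_le_iff order_trans)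
  have "[0..<d] = 0 # Suc 0 # [2..<d]"
    using assms(2) by (simp add: upt_conv_Cons numeral_2_eq_2)
  moreover have "concat (map (\<lambda>k. sublists_of_length k [X]) [2..<d]) = []"
    by (auto simp: sublists_of_length_beyond)
  ultimately show "feasible_lists c L [X] [0..<d] = [[], [X]]"
    using assms(1) \<open>0 \<le> L\<close> by (simp add: feasible_lists_def)
  show "feasible_lists c L [X] [d] = []"
    using assms(2) by (simp add: feasible_lists_def sublists_of_length_beyond)
qed

text \<open>The candidates are \<open>{}\<close> with value exactly 0 and \<open>{X}\<close>; the
  second phase has no starting set of size \<open>d\<close> and keeps the value 0. Strict positivity
  of one estimate therefore decides both comparisons, whatever \<open>pick\<close> does with
  ties.\<close>

lemma likely_partial_enumeration_greedy_singleton: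
  fixes \<Delta> :: "'i \<Rightarrow> 'i set \<Rightarrow> real timed"
  assumes pick: "maximum_rule pick" and "real (c X) \<le> L" "2 \<le> d"
    and \<Delta>: "likely (\<Delta> X {}) \<beta> (\<lambda>x. 0 < x)"
  shows "likely (partial_enumeration_greedy \<Delta> c L pick d [X]) \<beta> (\<lambda>A. A = {X})"
proof -
  note \<beta> = likely_nonneg[OF \<Delta>]
  note lists = feasible_lists_singleton[of c X L d, OF assms(2,3)]
  have pick0: "pick [v, 0] = 0" and pick1: "pick [0, v] = 1" if "0 < v" for v
  proof -
    have rule: "pick rs < length rs \<and> (\<forall>r\<in>set rs. r \<le> rs ! pick rs)" if "rs \<noteq> []" for rs
      using pick that by (simp add: maximum_rule_def)
    have "pick [v, 0] < 2" "v \<le> [v, 0] ! pick [v, 0]" "pick [0, v] < 2" "v \<le> [0, v] ! pick [0, v]"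
      using rule[of "[v, 0]"] rule[of "[0, v]"] by simp_all
    then show "pick [v, 0] = 0" "pick [0, v] = 1" using that by (auto simp: less_2_cases_iff)
  qed
  have "likely (eval_increases \<Delta> [X] {}) (\<beta> + (0 + 0)) (\<lambda>v. 0 < v)"
    unfolding eval_increases.simps
  proof (rule likely_bind[OF \<Delta>])
    fix x :: real assume x: "0 < x"
    have "likely (ret 0) 0 (\<lambda>v::real. v = 0)" by (simp add: likely_ret)
    then show "likely (ret 0 \<bind>\<^sub>t (\<lambda>v. tick 2 \<bind>\<^sub>t (\<lambda>_. ret (x + v)))) (0 + 0) (\<lambda>v. 0 < v)"
      by (rule likely_bind) (use x in \<open>auto intro!: likely_ret likely_tick_bind\<close>)
  qed simp
  then have X: "likely (eval_increases \<Delta> [X] {}) \<beta> (\<lambda>v. 0 < v)" by simp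
  have nil: "likely (eval_increases \<Delta> [] {}) 0 (\<lambda>v. v = 0)" by (simp add: likely_ret)
  have "likely (mapt (\<lambda>A. eval_increases \<Delta> A {}) []) 0 (\<lambda>vs. vs = [])" by (simp add: likely_ret)
  then have "likely (mapt (\<lambda>A. eval_increases \<Delta> A {}) [[X]]) (\<beta> + (0 + 0)) (\<lambda>vs. \<exists>v>0. vs = [v])"
    unfolding mapt.simps(2) by (intro likely_bind[OF X] likely_bind) (auto intro!: likely_ret)
  then have single: "likely (mapt (\<lambda>A. eval_increases \<Delta> A {}) [[X]]) \<beta> (\<lambda>vs. \<exists>v>0. vs = [v])" by simp
  have "likely (mapt (\<lambda>A. eval_increases \<Delta> A {}) [[], [X]]) (0 + (\<beta> + 0)) (\<lambda>vs. \<exists>v>0. vs = [0, v])"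
    unfolding mapt.simps(2)[of _ "[]"]
  proof (rule likely_bind[OF nil])
    fix v :: real assume "v = 0"
    then show "likely (mapt (\<lambda>A. eval_increases \<Delta> A {}) [[X]] \<bind>\<^sub>t (\<lambda>vs. ret (v # vs))) (\<beta> + 0) (\<lambda>vs. \<exists>v>0. vs = [0, v])"
      by (intro likely_bind[OF single]) (auto intro!: likely_ret)
  qed (use \<beta> in simp)
  then have mapt: "likely (mapt (\<lambda>A. eval_increases \<Delta> A {}) [[], [X]]) \<beta> (\<lambda>vs. \<exists>v>0. vs = [0, v])"
    by simp
  have best: "likely (best_small_set \<Delta> c L pick d [X]) (\<beta> + 0) (\<lambda>Av. fst Av = {X} \<and> 0 < snd Av)"
    unfolding best_small_set_def
    by (rule likely_feasible_sublists, unfold lists, rule likely_bind[OF mapt])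
      (auto intro!: likely_tick_bind likely_ret simp: pick1)
  have "likely (partial_enumeration_greedy \<Delta> c L pick d [X]) ((\<beta> + 0) + (0 + 0)) (\<lambda>A. A = {X})"
    unfolding partial_enumeration_greedy_def
  proof (rule likely_bind[OF best])
    fix Av :: "'i set \<times> real" assume "fst Av = {X} \<and> 0 < snd Av"
    then obtain v where v: "Av = ({X}, v)" "0 < v" by (cases Av) auto
    show "likely (case Av of (A\<^sub>1, v\<^sub>1) \<Rightarrow> feasible_sublists c L [X] [d] \<bind>\<^sub>t (\<lambda>Gs. foldt
         (\<lambda>G (A\<^sub>2, v\<^sub>2). greedy_from \<Delta> c L pick [X] G \<bind>\<^sub>t (\<lambda>(G', v).
            tick 2 \<bind>\<^sub>t (\<lambda>_. ret (if v > v\<^sub>2 then (G', v) else (A\<^sub>2, v\<^sub>2))))) Gs ({}, 0) \<bind>\<^sub>t (\<lambda>(A\<^sub>2, v\<^sub>2).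
       tick 1 \<bind>\<^sub>t (\<lambda>_. ret (if pick [v\<^sub>1, v\<^sub>2] = 0 then A\<^sub>1 else A\<^sub>2))))) (0 + 0) (\<lambda>A. A = {X})"
      unfolding v(1) prod.case
      by (rule likely_feasible_sublists, unfold lists foldt.simps, rule likely_bind[where P = "\<lambda>s. s = ({}, 0)"])
        (auto intro!: likely_ret likely_tick_bind simp: pick0[OF v(2)])
  qed simp
  then show ?thesis by simp
qed


section \<open>The sampled algorithm\<close>

lemma surely_likely: "surely m t Q \<Longrightarrow> likely m 0 Q"
  unfolding surely_def likely_def
  by (rule eq_refl, subst measure_pmf.prob_eq_0) (auto simp: AE_measure_pmf_iff)

text \<open>Here \<open>q * x\<close> bounds the number of queries, and 4 stands for two estimates
  with two tails each. As \<open>x / \<delta> \<ge> 2\<close>, the multiple \<open>4 * q\<close> of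
  the logarithm supplies \<open>2 ^ (4 * q) \<ge> 4 * q\<close>, and the remaining one supplies
  \<open>\<delta> / x\<close>; thus all constants stay outside the logarithm.\<close>

lemma exp_union_bound:
  fixes x \<delta> r :: real and q :: nat
  assumes "0 < \<delta>" "\<delta> < 1" "2 \<le> x" "real (4 * q + 1) * ln (x / \<delta>) \<le> r"
  shows "real q * x * (4 * exp (- r)) \<le> \<delta>"
proof -
  have "exp (- r) \<le> exp (- (real (4 * q + 1) * ln (x / \<delta>)))" using assms by simp
  also have "\<dots> = exp (real (4 * q + 1) * ln (\<delta> / x))" using assms by (simp add: ln_div algebra_simps)
  also have "\<dots> = exp (ln (\<delta> / x)) ^ (4 * q + 1)" by (rule exp_of_nat_mult)
  also have "\<dots> = (\<delta> / x) ^ (4 * q) * (\<delta> / x)" using assms by simp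
  also have "\<dots> \<le> (1 / 2) ^ (4 * q) * (\<delta> / x)"
  proof (intro mult_right_mono power_mono)
    show "\<delta> / x \<le> 1 / 2" using assms by (simp add: field_simps)
  qed (use assms in auto)
  finally have "real q * x * (4 * exp (- r)) \<le> real q * x * (4 * ((1 / 2) ^ (4 * q) * (\<delta> / x)))"
    using assms by (intro mult_left_mono) auto
  also have "\<dots> = (real (4 * q) / 2 ^ (4 * q)) * \<delta>"
    using assms by (simp add: power_one_over field_simps)
  also have "\<dots> \<le> 1 * \<delta>"
  proof (rule mult_right_mono)
    have "real (4 * q) \<le> real (2 ^ (4 * q))"
      unfolding of_nat_le_iff by (rule less_imp_le[OF less_exp])
    then show "real (4 * q) / 2 ^ (4 * q) \<le> 1" by simp
  qed (use assms in simp)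
  finally show ?thesis by simp
qed

locale sampled_greedy =
  fixes p :: "('i \<Rightarrow> 'v) pmf" and vals :: "'i \<Rightarrow> 'v set" and S U W :: "'i set"
    and c :: "'i \<Rightarrow> nat" and L c_inf :: real and N K :: nat and ws :: "'i list"
    and pick :: "real list \<Rightarrow> nat"
  assumes fin_p: "finite (set_pmf p)" and support: "set_pmf p \<subseteq> Pi\<^sub>E (S \<union> U) vals"
    and fin_vals: "\<And>X. X \<in> S \<union> U \<Longrightarrow> finite (vals X)"
    and fin_S: "finite S" and S_U: "S \<inter> U = {}" and ind: "independent_given p S U"
    and W_subset: "W \<subseteq> S \<union> U" and card_vals: "\<And>X. X \<in> W \<Longrightarrow> card (vals X) \<le> K"
    and c_pos': "\<And>X. X \<in> W \<Longrightarrow> 0 < c X" and L: "0 < L" and N: "0 < N" and c_inf: "1 \<le> c_inf"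
    and ws': "distinct ws" "set ws = W" "ws \<noteq> []" and rule: "maximum_rule pick"
begin

abbreviation "F \<equiv> info_gain p U"
abbreviation "\<Delta> \<equiv> sample_increase c_inf N p S U"
abbreviation "alg d \<equiv> partial_enumeration_greedy \<Delta> c L pick d ws"

sublocale submodular_budget W F c L
  using submodular_budget_info_gain[OF fin_p ind fin_S S_U W_subset, of c] c_pos' ws'(2)
  by unfold_locales auto

sublocale timed_greedy \<Delta> "8 * real N * c_inf" c L pick ws
proof
  show "surely (\<Delta> X G) (8 * real N * c_inf) (\<lambda>_. True)" for X G
    using surely_sample_increase[OF c_inf N] .
  have "1 * 1 \<le> real N * c_inf" using N c_inf by (intro mult_mono) auto
  then show "1 \<le> 8 * real N * c_inf" by simp
qed (use L ws' rule in auto)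

definition CE :: "'i \<Rightarrow> 'i set \<Rightarrow> real" where
  "CE X B = joint_entropy p (insert X B) - joint_entropy p B"

lemma expectation_entropy_at_CE:
  "measure_pmf.expectation (marginal p B) (entropy_at p X B) = CE X B"
  by (simp add: CE_def expectation_entropy_at[OF fin_p])

lemma entropy_at_le_ln_K:
  assumes "X \<in> W" "b \<in> set_pmf (marginal p B)"
  shows "0 \<le> entropy_at p X B b \<and> entropy_at p X B b \<le> ln (real K)"
proof -
  have X: "X \<in> S \<union> U" "finite (vals X)" using assms(1) W_subset fin_vals by auto
  have "vals X \<noteq> {}" using support set_pmf_not_empty[of p] X by (auto simp: PiE_def Pi_def)
  then have "0 < card (vals X)" using X by (simp add: card_gt_0_iff)
  then have "ln (real (card (vals X))) \<le> ln (real K)" using card_vals[OF assms(1)] by simp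
  then show ?thesis
    using entropy_at_bounds[OF support X assms(2)] by linarith
qed

lemma ln_K_nonneg: "0 \<le> ln (real K)"
proof -
  obtain X where "X \<in> W" using ws' by fastforce
  moreover obtain b where "b \<in> set_pmf (marginal p {})" using set_pmf_not_empty by fastforce
  ultimately show ?thesis using entropy_at_le_ln_K by fastforce
qed

text \<open>For \<open>ln K = 0\<close> the quotient would evaluate to 0 and the bound to 2, whereas
  all entropies vanish and the estimator is exact.\<close>

definition failure :: "real \<Rightarrow> real" where
  "failure \<tau> = (if ln (real K) = 0 then 0 else 2 * exp (- 2 * real N * \<tau>\<^sup>2 / (ln (real K))\<^sup>2))"

lemma failure_nonneg: "0 \<le> failure \<tau>"
  by (simp add: failure_def)

lemma likely_sample:
  assumes "X \<in> W" "0 < \<tau>"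
  shows "likely (sample_cond_entropy c_inf N p X B) (failure \<tau>) (\<lambda>h. \<bar>h - CE X B\<bar> \<le> \<tau>)"
proof (cases "ln (real K) = 0")
  case True
  have "entropy_at p X B b = 0" if "b \<in> set_pmf (marginal p B)" for b
    using entropy_at_le_ln_K[OF assms(1) that] True by simp
  then have "likely (sample_cond_entropy c_inf N p X B) 0 (\<lambda>h. h = CE X B)"
    using likely_sample_cond_entropy_const[of p B X 0 N c_inf] N by (simp add: expectation_entropy_at_CE)
  then show ?thesis by (rule likely_weaken) (use assms True in \<open>auto simp: failure_def\<close>)
next
  case False
  then have "0 < ln (real K)" using ln_K_nonneg by simp
  then show ?thesis
    using likely_sample_cond_entropy[OF entropy_at_le_ln_K[OF assms(1)], of B \<tau> N c_inf] assms N False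
    by (simp add: expectation_entropy_at_CE failure_def)
qed

lemma likely_increase:
  assumes "X \<in> W" "G \<subseteq> W" "X \<notin> G" "0 < \<tau>"
  shows "likely (\<Delta> X G) (2 * failure \<tau>) (\<lambda>x. \<bar>x - (F (insert X G) - F G)\<bar> \<le> 2 * \<tau>)"
proof -
  have "F (insert X G) - F G = CE X G - (if X \<in> S then CE X U else 0)"
    unfolding CE_def by (rule info_gain_insert[OF fin_p ind fin_S]) (use assms W_subset S_U in auto)
  then show ?thesis
    using likely_sample_increase[OF likely_sample[OF assms(1,4)], of S U G] assms failure_nonneg by simp
qed

text \<open>An increment uses two estimates, so \<open>\<eta> = 2 * \<tau>\<close> and
  \<open>4 * L * \<eta>\<close> becomes \<open>8 * L * \<tau>\<close>. The number of queries is
  simplified by raising every power of \<open>card W\<close> to \<open>d + 2\<close>.\<close>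

lemma likely_alg:
  assumes "3 \<le> d" "B \<subseteq> W" "cost B \<le> L" "0 < \<tau>"
  shows "likely (alg d) (real (d\<^sup>2 + d + 1) * real (card W) ^ (d + 2) * (2 * failure \<tau>))
    (\<lambda>A. (1 - 1 / exp 1) * F B - 8 * L * \<tau> \<le> F A)"
proof -
  interpret noisy_greedy W F c L \<Delta> "2 * \<tau>" "2 * failure \<tau>" pick ws
    by unfold_locales (use likely_increase assms failure_nonneg L rule ws' in auto)
  let ?n = "length ws"
  have n: "?n = card W" using ws' distinct_card by fastforce
  have "1 \<le> ?n" using ws' by (simp add: Suc_le_eq)
  then have nn: "?n ^ d \<le> ?n ^ (d + 2)" by (intro power_increasing) auto
  have "d * ?n ^ d * d + ?n ^ d * (d + ?n * ?n) = (d\<^sup>2 + d) * ?n ^ d + ?n ^ (d + 2)"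
    by (simp add: algebra_simps power2_eq_square power_add)
  also have "\<dots> \<le> (d\<^sup>2 + d + 1) * ?n ^ (d + 2)"
    using mult_left_mono[OF nn, of "d\<^sup>2 + d"] by simp
  finally have "real (d * ?n ^ d * d + ?n ^ d * (d + ?n * ?n)) \<le> real ((d\<^sup>2 + d + 1) * ?n ^ (d + 2))"
    by (rule of_nat_mono)
  then have "real (d * ?n ^ d * d + ?n ^ d * (d + ?n * ?n)) * (2 * failure \<tau>)
      \<le> real ((d\<^sup>2 + d + 1) * ?n ^ (d + 2)) * (2 * failure \<tau>)"
    using failure_nonneg by (intro mult_right_mono) auto
  then have le: "real (d * ?n ^ d) * (real d * (2 * failure \<tau>)) + real (?n ^ d) * (real (d + ?n * ?n) * (2 * failure \<tau>))
      \<le> real (d\<^sup>2 + d + 1) * real (card W) ^ (d + 2) * (2 * failure \<tau>)"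
    unfolding n[symmetric] by (simp add: algebra_simps)
  show ?thesis
    by (rule likely_weaken[OF likely_partial_enumeration_greedy[OF assms(1-3)] le]) simp
qed

text \<open>
  With a single variable only \<open>H(X | U)\<close> is estimated with an error, and only an overestimate can
  do harm, so one Hoeffding tail suffices; for \<open>\<delta>\<close> close to 1 the factor 2 of the two-sided bound
  would not be affordable.
\<close>

lemma likely_alg_singleton:
  assumes "ws = [X]" "real (c X) \<le> L" "0 < F {X}" "2 \<le> d"
  shows "likely (alg d) (exp (- 2 * real N * (F {X})\<^sup>2 / (ln (real K))\<^sup>2)) (\<lambda>A. A = {X})"
    and "F {X} \<le> ln (real K)"
proof -
  have X: "X \<in> W" using assms ws' by auto
  have gain: "F {X} = CE X {} - (if X \<in> S then CE X U else 0)"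
    using info_gain_insert[OF fin_p ind fin_S, of "{}" X] X W_subset S_U F_empty by (auto simp: CE_def)
  \<comment> \<open>Without a condition there is only one joint value, so \<open>H(X)\<close> is
    computed exactly.\<close>
  have "marginal p {} = return_pmf (\<lambda>_. undefined)" by (simp add: marginal_def restrict_def)
  then have single: "entropy_at p X {} b = entropy_at p X {} (\<lambda>_. undefined)"
    if "b \<in> set_pmf (marginal p {})" for b
    using that by simp
  have CE_ge: "0 \<le> CE X B" for B
    using joint_entropy_insert_mono[OF fin_p] by (simp add: CE_def)
  have "CE X {} \<le> ln (real K)"
    unfolding expectation_entropy_at_CE[symmetric]
    using entropy_at_le_ln_K[OF X, of _ "{}"] \<open>marginal p {} = _\<close> by simp
  then show "F {X} \<le> ln (real K)" using gain CE_ge[of U] by (simp split: if_splits)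
  then have K: "0 < ln (real K)" using assms(3) by linarith
  have exact: "likely (sample_cond_entropy c_inf N p X {}) 0 (\<lambda>h. h = CE X {})"
    using likely_sample_cond_entropy_const[OF single N] by (simp add: expectation_entropy_at_CE)
  have less: "likely (sample_cond_entropy c_inf N p X U) (exp (- 2 * real N * (F {X})\<^sup>2 / (ln (real K))\<^sup>2))
      (\<lambda>h. h < CE X U + F {X})"
    using likely_sample_cond_entropy_less[OF entropy_at_le_ln_K[OF X] K assms(3) N]
    by (simp add: expectation_entropy_at_CE)
  have "likely (\<Delta> X {}) (exp (- 2 * real N * (F {X})\<^sup>2 / (ln (real K))\<^sup>2)) (\<lambda>x. 0 < x)"
  proof (cases "X \<in> S")
    case True
    \<comment> \<open>The increment stays positive as long as the overestimate is below
      \<open>F {X}\<close>; hence this deviation in \<open>less\<close>.\<close>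
    then have "CE X {} = CE X U + F {X}" using gain by simp
    then show ?thesis using likely_sample_increase_pos[of c_inf N p X "{}" "CE X" U _ S] exact less True by simp
  next
    case False
    have "likely (sample_cond_entropy c_inf N p X {}) (exp (- 2 * real N * (F {X})\<^sup>2 / (ln (real K))\<^sup>2)) (\<lambda>h. 0 < h)"
      by (rule likely_weaken[OF exact]) (use gain False assms(3) in auto)
    then show ?thesis
      using False unfolding sample_increase_def by (intro likely_tick_bind) simp
  qed
  then show "likely (alg d) (exp (- 2 * real N * (F {X})\<^sup>2 / (ln (real K))\<^sup>2)) (\<lambda>A. A = {X})"
    unfolding assms(1) by (intro likely_partial_enumeration_greedy_singleton rule assms(2,4))
qed

text \<open>The cases differ in what \<open>ln (card W ^ (d + 2) / \<delta>)\<close> can pay for: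
  nothing has to be paid if \<open>\<delta> \<ge> 1\<close>, one variable affords a single tail, and
  from two variables on the whole union bound fits.\<close>

lemma alg_accuracy:
  assumes d: "3 \<le> d" and B: "B \<subseteq> W" "cost B \<le> L" and pos: "0 < \<epsilon>" "0 < \<delta>"
    and samples: "real (32 * (4 * (d\<^sup>2 + d + 1) + 1)) *
      ((L * ln (real K) / \<epsilon>)\<^sup>2 * ln (real (card W) ^ (d + 2) / \<delta>)) \<le> real N"
  shows "likely (alg d) \<delta> (\<lambda>A. (1 - 1 / exp 1) * F B - \<epsilon> \<le> F A)"
proof -
  define b where "b = ln (real K)"
  define x where "x = real (card W) ^ (d + 2)"
  define q where "q = d\<^sup>2 + d + 1"
  define Z where "Z = (L * b / \<epsilon>)\<^sup>2"
  have samples': "real (32 * (4 * q + 1)) * (Z * ln (x / \<delta>)) \<le> real N"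
    using samples by (simp add: b_def x_def q_def Z_def)
  have surely_F: "likely (alg d) 0 (\<lambda>A. 0 \<le> F A)"
    by (rule likely_weaken[OF surely_likely[OF surely_partial_enumeration_greedy]])
      (use d ws'(2) F_nonneg in auto)
  have card1: "1 \<le> card W" using ws' by (metis One_nat_def Suc_leI card_gt_0_iff fin_W set_empty)
  consider "1 \<le> \<delta>" | "\<delta> < 1" "card W = 1" | "\<delta> < 1" "2 \<le> card W" using card1 by linarith
  then show ?thesis
  proof cases
    case 1
    then show ?thesis
      unfolding likely_def using measure_pmf.prob_le_1 order_trans by blast
  next
    case 2
    show ?thesis
    \<comment> \<open>If \<open>F B \<le> \<epsilon>\<close>, the target is at most 0 and any
      returned set meets it. This includes the situation that \<open>X\<close> exceeds the budget,
      where \<open>B\<close> is empty.\<close>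
    proof (cases "F B \<le> \<epsilon>")
      case True
      have "(1 - 1 / exp 1) * F B \<le> 1 * F B" using F_nonneg[OF B(1)] by (intro mult_right_mono) auto
      then show ?thesis
        using True by (intro likely_weaken[OF surely_F]) (use pos in auto)
    next
      case False
      have "length ws = 1" using 2 ws' distinct_card by fastforce
      then obtain X where X: "ws = [X]" by (auto simp: length_Suc_conv)
      then have W: "W = {X}" using ws' by auto
      have "B \<noteq> {}" using False F_empty pos by auto
      then have BX: "B = {X}" using B W by auto
      have "real (c X) \<le> L" using B BX by simp
      moreover have "1 \<le> c X" using c_pos' W by (simp add: Suc_le_eq)
      ultimately have L1: "1 \<le> L" by linarith
      have D: "0 < F {X}" using False BX pos by simp
      have D': "\<epsilon> < F {X}" using False BX by simp
      have "2 \<le> d" using d by simp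
      note single = likely_alg_singleton[OF X \<open>real (c X) \<le> L\<close> D this]
      have b: "0 < b" using single(2) D by (simp add: b_def)
      have Z: "0 < Z" using b L pos by (simp add: Z_def)
      have ln: "0 < ln (x / \<delta>)" "x = 1" using 2 pos by (simp_all add: x_def)
      have "1 * (Z * ln (x / \<delta>)) \<le> real (32 * (4 * q + 1)) * (Z * ln (x / \<delta>))"
        using Z ln by (intro mult_right_mono) auto
      then have N_ge: "Z * ln (x / \<delta>) \<le> real N" using samples' by linarith
      \<comment> \<open>The tolerated deviation \<open>F {X}\<close> exceeds
        \<open>\<epsilon>\<close>, hence also \<open>\<epsilon> / L\<close> because
        \<open>L \<ge> 1\<close>; so \<open>Z * ln (x / \<delta>)\<close> samples already
        suffice.\<close>
      have "\<epsilon> * 1 \<le> F {X} * L" using D' L1 pos by (intro mult_mono) auto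
      then have "\<epsilon>\<^sup>2 \<le> (F {X} * L)\<^sup>2" using pos by (intro power_mono) auto
      then have "1 \<le> Z * ((F {X})\<^sup>2 / b\<^sup>2)"
        using b pos by (simp add: Z_def field_simps)
      then have "ln (x / \<delta>) * 1 \<le> ln (x / \<delta>) * (Z * ((F {X})\<^sup>2 / b\<^sup>2))"
        using ln by (intro mult_left_mono) auto
      also have "\<dots> \<le> real N * ((F {X})\<^sup>2 / b\<^sup>2)"
        using mult_right_mono[OF N_ge, of "(F {X})\<^sup>2 / b\<^sup>2"] by (simp add: algebra_simps)
      also have "\<dots> \<le> 2 * (real N * ((F {X})\<^sup>2 / b\<^sup>2))" by (simp only: mult_2 le_add_same_cancel1) simp
      also have "\<dots> = 2 * real N * (F {X})\<^sup>2 / b\<^sup>2" by simp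
      finally have "exp (- 2 * real N * (F {X})\<^sup>2 / b\<^sup>2) \<le> exp (- ln (x / \<delta>))" by simp
      also have "\<dots> = \<delta>" using pos ln by (simp add: exp_minus)
      finally have le: "exp (- 2 * real N * (F {X})\<^sup>2 / (ln (real K))\<^sup>2) \<le> \<delta>" by (simp add: b_def)
      have "(1 - 1 / exp 1) * F B \<le> 1 * F B" using F_nonneg[OF B(1)] by (intro mult_right_mono) auto
      then show ?thesis
        using BX pos by (intro likely_weaken[OF single(1) le]) auto
    qed
  next
    case 3
    define \<tau> where "\<tau> = \<epsilon> / (8 * L)"
    have \<tau>: "0 < \<tau>" "8 * L * \<tau> = \<epsilon>" using pos L by (auto simp: \<tau>_def)
    have "2 ^ 1 \<le> (2::real) ^ (d + 2)" by (intro power_increasing) auto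
    also have "\<dots> \<le> x" using 3 unfolding x_def by (intro power_mono) auto
    finally have x: "2 \<le> x" by simp
    have "real q * x * (2 * failure \<tau>) \<le> \<delta>"
    proof (cases "b = 0")
      case True
      then show ?thesis using pos by (simp add: failure_def b_def)
    next
      case False
      then have "0 < Z" using L pos by (simp add: Z_def)
      \<comment> \<open>Origin of 32: with \<open>\<tau> = \<epsilon> / (8 * L)\<close> the
        Hoeffding exponent per sample is
        \<open>2 * \<tau>\<^sup>2 / b\<^sup>2 = 1 / (32 * Z)\<close>.\<close>
      then have "real (4 * q + 1) * ln (x / \<delta>) = real (32 * (4 * q + 1)) * (Z * ln (x / \<delta>)) / (32 * Z)"
        by simp
      also have "\<dots> \<le> real N / (32 * Z)"
        using samples' \<open>0 < Z\<close> by (intro divide_right_mono) auto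
      also have "\<dots> = 2 * real N * \<tau>\<^sup>2 / b\<^sup>2"
        using L pos False by (simp add: Z_def \<tau>_def field_simps power2_eq_square)
      finally have "real q * x * (4 * exp (- (2 * real N * \<tau>\<^sup>2 / b\<^sup>2))) \<le> \<delta>"
        by (intro exp_union_bound pos 3 x)
      then show ?thesis using False by (simp add: failure_def b_def)
    qed
    then show ?thesis
      using likely_alg[OF d B \<tau>(1)] unfolding \<tau>(2) q_def x_def
      by (intro likely_weaken[OF likely_alg[OF d B \<tau>(1), unfolded \<tau>(2)]]) auto
  qed
qed

end

theorem theorem12:
  fixes d :: nat
  assumes "d \<ge> 3"
  shows "\<exists>C > 0. \<exists>samples :: real \<Rightarrow> real \<Rightarrow> real \<Rightarrow> nat \<Rightarrow> nat \<Rightarrow> nat.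
    \<forall>(p :: ('i \<Rightarrow> 'v) pmf) vals Cs \<psi> S U W (c :: 'i \<Rightarrow> nat) (L :: real) \<epsilon> \<delta> c_inf ws pick.
      finite S \<and> finite U \<and> S \<inter> U = {} \<and>
      graphical_model (S \<union> U) vals Cs \<psi> p \<and>
      independent_given p S U \<and>
      W \<subseteq> S \<union> U \<and> W \<noteq> {} \<and>
      (\<forall>X\<in>W. c X > 0) \<and> L > 0 \<and> \<epsilon> > 0 \<and> \<delta> > 0 \<and>
      c_inf \<ge> 1 \<and> distinct ws \<and> set ws = W \<and> maximum_rule pick
      \<longrightarrow>
      (let F = info_gain p U;
           OPT = Max (F ` {A. A \<subseteq> W \<and> real (sum c A) \<le> L});
           K = Max ((\<lambda>X. card (vals X)) ` W);
           N = samples \<epsilon> \<delta> L (card W) K;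
           alg = partial_enumeration_greedy (sample_increase c_inf N p S U) c L pick d ws
       in measure_pmf.prob alg {(A, t). F A \<ge> (1 - 1 / exp 1) * OPT - \<epsilon>} \<ge> 1 - \<delta> \<and>
          (\<forall>(A, t) \<in> set_pmf alg.
             A \<subseteq> W \<and> real (sum c A) \<le> L \<and>
             t \<le> C * (c_inf * real (card W) ^ (d + 2) *
                   max 1 (real_of_int
                     \<lceil>(L * ln (real K) / \<epsilon>)\<^sup>2 * ln (real (card W) ^ (d + 2) / \<delta>)\<rceil>))))"
proof -
  define a where "a = 32 * (4 * (d\<^sup>2 + d + 1) + 1)"
  \<comment> \<open>The ceiling is 0 if \<open>K = 1\<close> and may be negative for large
    \<open>\<delta>\<close>; the maximum with 1 guarantees that samples are drawn at all.\<close>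
  define samples :: "real \<Rightarrow> real \<Rightarrow> real \<Rightarrow> nat \<Rightarrow> nat \<Rightarrow> nat" where
    "samples \<epsilon> \<delta> L n K =
      a * nat (max 1 \<lceil>(L * ln (real K) / \<epsilon>)\<^sup>2 * ln (real n ^ (d + 2) / \<delta>)\<rceil>)" for \<epsilon> \<delta> L n K
  \<comment> \<open>The constant of the algorithm's time bound, times 8 from the time of one
    estimated increment, times the factor \<open>a\<close> contained in \<open>N\<close>; all three
    depend on \<open>d\<close> at most.\<close>
  define C where "C = real ((4 * d\<^sup>2 + 8 * d + 15) * 8 * a)"
  have a: "0 < a" by (simp add: a_def)
  have "0 < C" unfolding C_def of_nat_0_less_iff using a by simp
  show ?thesis
  proof (rule exI[of _ C], rule conjI[OF \<open>0 < C\<close>], rule exI[of _ samples], intro allI impI, elim conjE)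
    fix p :: "('i \<Rightarrow> 'v) pmf" and vals Cs \<psi> S U W and c :: "'i \<Rightarrow> nat" and L \<epsilon> \<delta> c_inf :: real and ws pick
    assume model: "finite S" "finite U" "S \<inter> U = {}" "graphical_model (S \<union> U) vals Cs \<psi> p"
      "independent_given p S U" "W \<subseteq> S \<union> U" "W \<noteq> {}" "\<forall>X\<in>W. 0 < c X"
      and pos: "0 < L" "0 < \<epsilon>" "0 < \<delta>" "1 \<le> c_inf"
      and ws: "distinct ws" "set ws = W" and rule: "maximum_rule pick"
    define K where "K = Max ((\<lambda>X. card (vals X)) ` W)"
    define N where "N = samples \<epsilon> \<delta> L (card W) K"
    define y where "y = (L * ln (real K) / \<epsilon>)\<^sup>2 * ln (real (card W) ^ (d + 2) / \<delta>)"
    define m where "m = max 1 (real_of_int \<lceil>y\<rceil>)"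
    have N_eq: "real N = real a * m"
      by (simp add: N_def samples_def m_def y_def of_nat_nat max_def)
    have "y \<le> m" unfolding m_def by linarith
    have "0 < m" by (simp add: m_def)
    then have "0 < N" using N_eq a by (metis mult_pos_pos of_nat_0_less_iff)
    have finW: "finite W" using ws by auto
    have gm: "\<And>X. X \<in> S \<union> U \<Longrightarrow> finite (vals X)" "set_pmf p \<subseteq> Pi\<^sub>E (S \<union> U) vals"
      using model(4) by (simp_all add: graphical_model_def)
    have "finite (Pi\<^sub>E (S \<union> U) vals)" using gm model by (intro finite_PiE) auto
    then have "finite (set_pmf p)" using gm(2) finite_subset by blast
    moreover have "card (vals X) \<le> K" if "X \<in> W" for X
      unfolding K_def using finW that by (intro Max_ge) auto
    ultimately interpret sampled_greedy p vals S U W c L c_inf N K ws pick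
      using model pos ws rule gm \<open>0 < N\<close> by unfold_locales auto
    let ?feasible = "{A. A \<subseteq> W \<and> real (sum c A) \<le> L}"
    have "finite ?feasible" by (rule finite_subset[of _ "Pow W"]) (use finW in auto)
    moreover have "{} \<in> ?feasible" using pos by simp
    ultimately have "Max (F ` ?feasible) \<in> F ` ?feasible" by (intro Max_in) auto
    then obtain B where B: "B \<subseteq> W" "real (sum c B) \<le> L" "Max (F ` ?feasible) = F B" by auto
    have "real a * y \<le> real N" unfolding N_eq by (rule mult_left_mono[OF \<open>y \<le> m\<close>]) simp
    then have "likely (alg d) \<delta> (\<lambda>A. (1 - 1 / exp 1) * F B - \<epsilon> \<le> F A)"
      using assms B pos by (intro alg_accuracy) (simp_all add: a_def y_def)
    moreover have "{(A, t). \<not> (1 - 1 / exp 1) * F B - \<epsilon> \<le> F A}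
        = space (measure_pmf (alg d)) - {(A, t). (1 - 1 / exp 1) * F B - \<epsilon> \<le> F A}" by auto
    ultimately have prob: "1 - \<delta> \<le> measure_pmf.prob (alg d) {(A, t). (1 - 1 / exp 1) * F B - \<epsilon> \<le> F A}"
      using measure_pmf.prob_compl[of "{(A, t). (1 - 1 / exp 1) * F B - \<epsilon> \<le> F A}" "alg d"]
      by (simp add: likely_def)
    have n: "length ws = card W" using ws distinct_card by fastforce
    have T: "real (4 * d\<^sup>2 + 8 * d + 15) * (8 * real N * c_inf * real (length ws) ^ (d + 2))
        = C * (c_inf * real (card W) ^ (d + 2) * m)"
      by (simp add: C_def N_eq n)
    have "surely (alg d) (C * (c_inf * real (card W) ^ (d + 2) * m)) (\<lambda>A. A \<subseteq> W \<and> real (sum c A) \<le> L)"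
      using surely_partial_enumeration_greedy[of d] assms unfolding T ws(2) by simp
    then show "let F = info_gain p U;
           OPT = Max (F ` {A. A \<subseteq> W \<and> real (sum c A) \<le> L});
           K = Max ((\<lambda>X. card (vals X)) ` W);
           N = samples \<epsilon> \<delta> L (card W) K;
           alg = partial_enumeration_greedy (sample_increase c_inf N p S U) c L pick d ws
       in measure_pmf.prob alg {(A, t). F A \<ge> (1 - 1 / exp 1) * OPT - \<epsilon>} \<ge> 1 - \<delta> \<and>
          (\<forall>(A, t) \<in> set_pmf alg.
             A \<subseteq> W \<and> real (sum c A) \<le> L \<and>
             t \<le> C * (c_inf * real (card W) ^ (d + 2) *
                   max 1 (real_of_int
                     \<lceil>(L * ln (real K) / \<epsilon>)\<^sup>2 * ln (real (card W) ^ (d + 2) / \<delta>)\<rceil>)))"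
      unfolding Let_def K_def[symmetric] N_def[symmetric] B(3) y_def[symmetric] m_def[symmetric]
      using prob by (auto simp: surely_def)
  qed
qed


end
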